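(* Let $\lambda$ be a dominant integral weight and $\{\beta_i\}_{i\in I}$ any $\lambda$-chain. The collection $\mathcal{A}$ of admissible subsets $J\subseteq I$, together with the weight function $\mu$, the depth function $\delta$ and the root operators $F_1,\ldots,F_r$ (all defined in the context), forms a semiperfect crystal. Thus the following character formula holds: $$\chi(\lambda)=\sum_{J\in\mathcal{A}}e^{\mu(J)}.$$
   Context: Root system. Let $V$ be a finite-dimensional real vector space with a nondegenerate symmetric bilinear form $\langle\cdot,\cdot\rangle$, and let $\Phi\subset V$ be the set of real roots of a complex symmetrizable Kac-Moody algebra $\mathfrak{g}$, with simple roots $\alpha_1,\ldots,\alpha_r$. Put $\alpha^\vee=2\alpha/\langle\alpha,\alpha\rangle$ for $\alpha\in\Phi$, $s_\alpha(v)=v-\langle v,\alpha^\vee\rangle\alpha$ and $s_{\alpha,k}(v)=s_\alpha(v)+k\alpha$ ($k\in\mathbb{Z}$). Let $W\subset GL(V)$ be the Weyl group generated by the $s_\alpha$, $\alpha\in\Phi$, with length function $\ell$ with respect to the simple reflections $s_p=s_{\alpha_p}$. Thus: $\alpha_1,\dots,\alpha_r$ are linearly independent; $\langle\alpha_p,\alpha_p\rangle>0$; $\langle\alpha_p,\alpha_q^\vee\rangle\in\mathbb{Z}_{\le0}$ for $p\ne q$; and $\Phi=\bigcup_p W\alpha_p$. $\Phi^+$ is the set of roots in the nonnegative span of the simple roots, $\Phi=\Phi^+\sqcup(-\Phi^+)$; $\mathrm{sgn}(\alpha)=1$ (we write $\alpha>0$) for $\alpha\in\Phi^+$ and $\mathrm{sgn}(\alpha)=-1$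 ($\alpha<0$) for $\alpha\in-\Phi^+$. In Bruhat order, $w\lessdot ws_\alpha$ ($\alpha\in\Phi^+$) means $\ell(ws_\alpha)=\ell(w)+1$. Let $\Lambda=\{v\in V\mid\langle v,\alpha_p^\vee\rangle\in\mathbb{Z}\ \forall p\}$, $\Lambda^+=\{v\in\Lambda\mid\langle v,\alpha^\vee\rangle\ge0\ \forall\alpha\in\Phi^+\}$ (dominant weights). Fix $\omega_1,\ldots,\omega_r\in V$ with $\langle\omega_p,\alpha_q^\vee\rangle=\delta_{pq}$ (fundamental weights) and $\rho\in\Lambda$ with $\langle\rho,\alpha_p^\vee\rangle=1$ for all $p$. Characters. Fix a linear map $\mathrm{ht}:V\to\mathbb{R}$ with $\mathrm{ht}(\alpha_p)=1$ for all $p$. $R$ is the ring of formal sums $\sum_{\nu\in\Lambda}c_\nu e^\nu$, $c_\nu\in\mathbb{Z}$, with finitely many $\nu$ with $c_\nu\ne0$ and $\mathrm{ht}(\nu)>h$ for every $h\in\mathbb{R}$; $e^\mu e^\nu=e^{\mu+\nu}$. For $\lambda\in\Lambda^+$, $$\chi(\lambda)=\frac{\sum_{w\in W}(-1)^{\ell(w)}e^{w(\lambda+\rho)-\rho}}{\sum_{w\in W}(-1)^{\ell(w)}e^{w(\rho)-\rho}}\in R,$$ which is the character of the irreducible integrable $\mathfrak{g}$-module of highest weight $\lambda$. Crystals. A crystal is a tuple $(X,\mu,\delta,\{F_1,\ldots,F_r\})$ where $X$ is a set, $\mu,\delta:X\to\Lambda$ are maps, and each $F_p$ is a bijection between two subsets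 of $X$, such that, writing $\varepsilon(x)=\mu(x)-\delta(x)$, $\delta(x,p)=\langle\delta(x),\alpha_p^\vee\rangle$, $\varepsilon(x,p)=\langle\varepsilon(x),\alpha_p^\vee\rangle$: (A1) $\delta(x)\in-\Lambda^+$, $\varepsilon(x)\in\Lambda^+$; (A2) $F_p$ is a bijection from $\{x\mid\varepsilon(x,p)>0\}$ to $\{x\mid\delta(x,p)<0\}$ (its inverse is denoted $E_p$); (A3) $\mu(F_p(x))=\mu(x)-\alpha_p$ and $\delta(F_p(x),p)=\delta(x,p)-1$. Write $x\preceq_p y$ if $x=F_p^k(y)$ for some $k\ge0$. A timing pattern assigns an element $t(x,p)$ of a totally ordered set to each pair $(x,p)$ with $\delta(x,p)<0$. It is coherent if, for all $(x,p)$ with $\delta(x,p)<0$ and $\varepsilon(x,p)>0$: (i) $t(x,p)\ge t(F_p(x),p)$; (ii) for all $q\ne p$, all integers $\delta<0$ and all $t\ge t(x,p)$, there is $y\succeq_q x$ with $\delta(y,q)=\delta$ and $t(y,q)=t$ if and only if there is $y'\succeq_q F_p(x)$ with $\delta(y',q)=\delta$ and $t(y',q)=t$. A crystal is semiperfect if it also satisfies: (A4) there exists a coherent timing pattern for $X$; (A5) $X$ has a maximum object with respect to the partial order generated by all $\preceq_p$, $p=1,\dots,r$. $\lambda$-chains. A $\lambda$-chain is a family $\{\beta_i\}_{i\in I}$ of positive roots indexed by a totally ordered set $I$ such that: (1) for each $\alpha\in\Phi^+$, $\#\{i\in I\mid\beta_i=\alpha\}=\langle\lambda,\alpha^\vee\rangle$;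 (2) for any roots $\alpha,\beta,\gamma\in\Phi$ with $\alpha\ne\pm\beta$ and $\gamma^\vee=\alpha^\vee+k\beta^\vee$ for some integer $k$, and any $i\in I$ with $\beta_i=\beta$, one has $N_i(\gamma)=N_i(\alpha)+kN_i(\beta)$. Here, for $\alpha\in\Phi^+$, $N_i(\alpha)=\#\{j<i\mid\beta_j=\alpha\}$ and $N_i(-\alpha)=1-N_i(\alpha)$. Admissible subsets. Put $r_i=s_{\beta_i}$, $l_i^\emptyset=\#\{j<i\mid\beta_j=\beta_i\}$, $\widehat r_i=s_{\beta_i,l_i^\emptyset}$. A finite (possibly empty) subset $J=\{j_1<\dots<j_s\}\subseteq I$ is admissible if $1\lessdot r_{j_1}\lessdot r_{j_1}r_{j_2}\lessdot\cdots\lessdot r_{j_1}\cdots r_{j_s}$. Its weight is $\mu(J)=\widehat r_{j_1}\cdots\widehat r_{j_s}(\lambda)$. $\mathcal{A}$ is the set of admissible subsets. Foldings. $\Gamma(\emptyset)=(\{(\beta_i,1)\}_{i\in I},\rho)$. For $\Gamma=(\{(\gamma_i,\varepsilon_i)\}_{i\in I},\gamma_\infty)$ with $\gamma_i\in\Phi$, $\varepsilon_i=\pm1$, $\gamma_\infty\in W\rho$, let $\phi_i(\Gamma)=(\{(\delta_j,\zeta_j)\}_{j\in I},s_{\gamma_i}(\gamma_\infty))$, where $(\delta_j,\zeta_j)$ is $(\gamma_j,\varepsilon_j)$ if $j<i$, $(\gamma_i,-\varepsilon_i)$ if $j=i$, and $(s_{\gamma_i}(\gamma_j),\varepsilon_j)$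 if $j>i$. For finite $J=\{j_1<\dots<j_s\}$, $\Gamma(J)=\phi_{j_1}\cdots\phi_{j_s}(\Gamma(\emptyset))$. For $\Gamma=\Gamma(J)=(\{(\gamma_i,\varepsilon_i)\},\gamma_\infty)$, the levels are $$l_i=\delta_i'+\sum_{j<i,\ \varepsilon_j=1,\ \gamma_j=\pm\gamma_i}\mathrm{sgn}(\gamma_j),\qquad\delta_i'=0\text{ if }\gamma_i>0,\quad\delta_i'=-1\text{ if }\gamma_i<0.$$ Root operators. Let $\infty$ be greater than all elements of $I$. For $J\in\mathcal{A}$, $\Gamma=\Gamma(J)$ and $p\in\{1,\dots,r\}$, let $I_{\alpha_p}=\{i\in I\mid\gamma_i=\pm\alpha_p\}$ (a finite set), $\widehat I_{\alpha_p}=I_{\alpha_p}\cup\{\infty\}$, and $M(J,p)=\max(\{l_i\mid i\in I_{\alpha_p}\}\cup\{\langle\mu(J),\alpha_p^\vee\rangle\})$ (one has $M(J,p)\ge0$). $F_p(J)$ is defined if and only if $M(J,p)>0$. In this case let $m$ be the minimum $i\in I_{\alpha_p}$ with $l_i=M(J,p)$, or $m=\infty$ if there is none; let $k$ be the predecessor of $m$ in $\widehat I_{\alpha_p}$ (it exists). Then $F_p(J)=J\triangle\{k,m\}$ if $m\ne\infty$ and $F_p(J)=J\triangle\{k\}$ if $m=\infty$, where $\triangle$ is symmetric difference. Depth and rise on $\mathcal{A}$. $\varepsilon(J,p)=M(J,p)$ and $\delta(J,p)=\langle\mu(J),\alpha_p^\vee\rangle-M(J,p)$; correspondingly $\varepsilon(J)=\sum_pM(J,p)\,\omega_p$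 and $\delta(J)=\mu(J)-\varepsilon(J)$. *)

theory Defs
  imports "HOL-Analysis.Analysis"
begin

text \<open>The locale assumptions are those satisfied by the simple roots of a complex symmetrizable
  Kac--Moody algebra. Conversely, any data satisfying them come from such an algebra, with
  generalized Cartan matrix given by the numbers \<open>\<langle>\<alpha> p, coroot (\<alpha> q)\<rangle>\<close>. The space is
  finite-dimensional but possibly zero, so no Euclidean type class is imposed; the
  form need not be positive definite.\<close>

locale kac_moody_roots =
  fixes pairing :: "'v::real_vector \<Rightarrow> 'v \<Rightarrow> real"  ("\<langle>_, _\<rangle>")
    and r :: nat
    and \<alpha> :: "nat \<Rightarrow> 'v"
    and \<omega> :: "nat \<Rightarrow> 'v"
    and \<rho> :: 'v
    and ht :: "'v \<Rightarrow> real"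
  assumes fin_dim: "\<exists>Bs::'v set. finite Bs \<and> span Bs = UNIV"
    and bilinear_pairing: "bilinear pairing"
    and sym_pairing: "\<langle>x, y\<rangle> = \<langle>y, x\<rangle>"
    and nondegenerate: "(\<forall>y. \<langle>x, y\<rangle> = 0) \<Longrightarrow> x = 0"
    and inj_simple: "inj_on \<alpha> {1..r}"
    and independent_simple: "independent (\<alpha> ` {1..r})"
    and simple_pos: "p \<in> {1..r} \<Longrightarrow> \<langle>\<alpha> p, \<alpha> p\<rangle> > 0"
    and cartan_int: "p \<in> {1..r} \<Longrightarrow> q \<in> {1..r} \<Longrightarrow> p \<noteq> q \<Longrightarrow>
          \<langle>\<alpha> p, (2 / \<langle>\<alpha> q, \<alpha> q\<rangle>) *\<^sub>R \<alpha> q\<rangle> \<in> \<int>"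
    and cartan_nonpos: "p \<in> {1..r} \<Longrightarrow> q \<in> {1..r} \<Longrightarrow> p \<noteq> q \<Longrightarrow>
          \<langle>\<alpha> p, (2 / \<langle>\<alpha> q, \<alpha> q\<rangle>) *\<^sub>R \<alpha> q\<rangle> \<le> 0"
    and fund_weights: "p \<in> {1..r} \<Longrightarrow> q \<in> {1..r} \<Longrightarrow>
          \<langle>\<omega> p, (2 / \<langle>\<alpha> q, \<alpha> q\<rangle>) *\<^sub>R \<alpha> q\<rangle> = (if p = q then 1 else 0)"
    and rho: "p \<in> {1..r} \<Longrightarrow> \<langle>\<rho>, (2 / \<langle>\<alpha> p, \<alpha> p\<rangle>) *\<^sub>R \<alpha> p\<rangle> = 1"
    and linear_ht: "linear ht"
    and ht_simple: "p \<in> {1..r} \<Longrightarrow> ht (\<alpha> p) = 1"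
begin

subsection \<open>Roots, Weyl group, weights\<close>

definition coroot :: "'v \<Rightarrow> 'v" where
  "coroot a = (2 / \<langle>a, a\<rangle>) *\<^sub>R a"

definition reflect :: "'v \<Rightarrow> 'v \<Rightarrow> 'v" where
  "reflect a v = v - \<langle>v, coroot a\<rangle> *\<^sub>R a"

definition aff_refl :: "'v \<Rightarrow> int \<Rightarrow> 'v \<Rightarrow> 'v" where
  "aff_refl a k v = reflect a v + of_int k *\<^sub>R a"

text \<open>The group generated by the reflections in the vectors of \<open>S\<close>. Reflections in
  vectors of nonzero norm are involutions, so closure under inverses is automatic.\<close>

inductive_set refl_group :: "'v set \<Rightarrow> ('v \<Rightarrow> 'v) set" for S where
  refl_group_id: "id \<in> refl_group S"
| refl_group_step: "w \<in> refl_group S \<Longrightarrow> a \<in> S \<Longrightarrow> reflect a \<circ> w \<in> refl_group S"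

text \<open>The real roots are the conjugates of the simple roots under the group generated by the
  simple reflections; lemma \<open>weyl_eq_refl_group_roots\<close> below shows that this group is also
  generated by the reflections in all roots.\<close>

definition weyl :: "('v \<Rightarrow> 'v) set" where
  "weyl = refl_group (\<alpha> ` {1..r})"

definition roots :: "'v set" where
  "roots = {w (\<alpha> p) | w p. w \<in> weyl \<and> p \<in> {1..r}}"

definition pos_roots :: "'v set" where
  "pos_roots = {a \<in> roots. \<exists>c. (\<forall>p\<in>{1..r}. c p \<ge> 0) \<and> a = (\<Sum>p\<in>{1..r}. c p *\<^sub>R \<alpha> p)}"

definition root_sgn :: "'v \<Rightarrow> int" where
  "root_sgn a = (if a \<in> pos_roots then 1 else -1)"

definition len :: "('v \<Rightarrow> 'v) \<Rightarrow> nat" where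
  "len w = (LEAST n. \<exists>ps. length ps = n \<and> set ps \<subseteq> {1..r} \<and>
              w = foldr (\<lambda>p f. reflect (\<alpha> p) \<circ> f) ps id)"

definition bruhat_cover :: "('v \<Rightarrow> 'v) \<Rightarrow> ('v \<Rightarrow> 'v) \<Rightarrow> bool" where
  "bruhat_cover w w' \<longleftrightarrow> w \<in> weyl \<and>
     (\<exists>a\<in>pos_roots. w' = w \<circ> reflect a \<and> len w' = len w + 1)"

definition weights :: "'v set" where
  "weights = {v. \<forall>p\<in>{1..r}. \<langle>v, coroot (\<alpha> p)\<rangle> \<in> \<int>}"

definition dominant :: "'v set" where
  "dominant = {v \<in> weights. \<forall>a\<in>pos_roots. \<langle>v, coroot a\<rangle> \<ge> 0}"

subsection \<open>Characters\<close>

text \<open>A formal sum is represented by its coefficient function.\<close>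

definition char_ring :: "('v \<Rightarrow> int) set" where
  "char_ring = {c. {\<nu>. c \<nu> \<noteq> 0} \<subseteq> weights \<and> (\<forall>h. finite {\<nu>. c \<nu> \<noteq> 0 \<and> ht \<nu> > h})}"

definition char_mult :: "('v \<Rightarrow> int) \<Rightarrow> ('v \<Rightarrow> int) \<Rightarrow> 'v \<Rightarrow> int" where
  "char_mult c d \<nu> = (\<Sum>\<mu> | c \<mu> \<noteq> 0 \<and> d (\<nu> - \<mu>) \<noteq> 0. c \<mu> * d (\<nu> - \<mu>))"

text \<open>\<open>formal_sum A c f\<close> is the sum of \<open>c x\<close> times the exponential of \<open>f x\<close> over \<open>x \<in> A\<close>. For
  infinite \<open>A\<close> it is meaningful, as an element of the character ring, when the family satisfies
  \<open>formal_summable\<close>.\<close>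

definition formal_sum :: "'a set \<Rightarrow> ('a \<Rightarrow> int) \<Rightarrow> ('a \<Rightarrow> 'v) \<Rightarrow> 'v \<Rightarrow> int" where
  "formal_sum A c f \<nu> = (\<Sum>x | x \<in> A \<and> f x = \<nu>. c x)"

definition formal_summable :: "'a set \<Rightarrow> ('a \<Rightarrow> 'v) \<Rightarrow> bool" where
  "formal_summable A f \<longleftrightarrow> f ` A \<subseteq> weights \<and> (\<forall>h. finite {x \<in> A. ht (f x) > h})"

definition weyl_sum :: "'v \<Rightarrow> 'v \<Rightarrow> int" where
  "weyl_sum l = formal_sum weyl (\<lambda>w. (-1) ^ len w) (\<lambda>w. w (l + \<rho>) - \<rho>)"

text \<open>The quotient of \<open>weyl_sum l\<close> by \<open>weyl_sum 0\<close> in the character ring.\<close>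

definition weyl_char :: "'v \<Rightarrow> 'v \<Rightarrow> int" where
  "weyl_char l = (THE c. c \<in> char_ring \<and> char_mult (weyl_sum 0) c = weyl_sum l)"

subsection \<open>Crystals\<close>

text \<open>In the following, \<open>X\<close> is the underlying set, \<open>wt\<close> the weight map, \<open>dp\<close> the depth map
  and \<open>F p\<close> the partial maps; \<open>dp_at\<close> and \<open>rise_at\<close> are the coordinates of depth and rise
  (weight minus depth).\<close>

definition dp_at :: "('x \<Rightarrow> 'v) \<Rightarrow> 'x \<Rightarrow> nat \<Rightarrow> real" where
  "dp_at dp x p = \<langle>dp x, coroot (\<alpha> p)\<rangle>"

definition rise_at :: "('x \<Rightarrow> 'v) \<Rightarrow> ('x \<Rightarrow> 'v) \<Rightarrow> 'x \<Rightarrow> nat \<Rightarrow> real" where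
  "rise_at wt dp x p = \<langle>wt x - dp x, coroot (\<alpha> p)\<rangle>"

definition crystal ::
  "'x set \<Rightarrow> ('x \<Rightarrow> 'v) \<Rightarrow> ('x \<Rightarrow> 'v) \<Rightarrow> (nat \<Rightarrow> 'x \<rightharpoonup> 'x) \<Rightarrow> bool" where
  "crystal X wt dp F \<longleftrightarrow>
     wt ` X \<subseteq> weights \<and> dp ` X \<subseteq> weights \<and>
     (\<forall>x\<in>X. - dp x \<in> dominant \<and> wt x - dp x \<in> dominant) \<and>
     (\<forall>p\<in>{1..r}. dom (F p) = {x \<in> X. rise_at wt dp x p > 0} \<and>
        bij_betw (the \<circ> F p) {x \<in> X. rise_at wt dp x p > 0} {x \<in> X. dp_at dp x p < 0}) \<and>
     (\<forall>p\<in>{1..r}. \<forall>x\<in>X. \<forall>y. F p x = Some y \<longrightarrow>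
        wt y = wt x - \<alpha> p \<and> dp_at dp y p = dp_at dp x p - 1)"

definition string_le :: "'x set \<Rightarrow> (nat \<Rightarrow> 'x \<rightharpoonup> 'x) \<Rightarrow> nat \<Rightarrow> 'x \<Rightarrow> 'x \<Rightarrow> bool" where
  "string_le X F p x y \<longleftrightarrow> x \<in> X \<and> y \<in> X \<and>
     (\<exists>k::nat. ((\<lambda>z. Option.bind z (F p)) ^^ k) (Some y) = Some x)"

text \<open>Timing patterns take values in the set \<open>T\<close>, totally ordered by the relation \<open>le\<close>
  (\<open>(a, b) \<in> le\<close> meaning that \<open>a\<close> is at most \<open>b\<close>).\<close>

definition coherent_timing ::
  "'x set \<Rightarrow> ('x \<Rightarrow> 'v) \<Rightarrow> ('x \<Rightarrow> 'v) \<Rightarrow> (nat \<Rightarrow> 'x \<rightharpoonup> 'x) \<Rightarrow>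
   't set \<Rightarrow> ('t \<times> 't) set \<Rightarrow> ('x \<Rightarrow> nat \<Rightarrow> 't) \<Rightarrow> bool" where
  "coherent_timing X wt dp F T le t \<longleftrightarrow>
     linear_order_on T le \<and>
     (\<forall>x\<in>X. \<forall>p\<in>{1..r}. dp_at dp x p < 0 \<longrightarrow> t x p \<in> T) \<and>
     (\<forall>x\<in>X. \<forall>p\<in>{1..r}. dp_at dp x p < 0 \<and> rise_at wt dp x p > 0 \<longrightarrow>
        (t (the (F p x)) p, t x p) \<in> le \<and>
        (\<forall>q\<in>{1..r}. q \<noteq> p \<longrightarrow> (\<forall>d::int. d < 0 \<longrightarrow> (\<forall>s\<in>T. (t x p, s) \<in> le \<longrightarrow>
           ((\<exists>y. string_le X F q x y \<and> dp_at dp y q = of_int d \<and> t y q = s) \<longleftrightarrow>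
            (\<exists>y. string_le X F q (the (F p x)) y \<and> dp_at dp y q = of_int d \<and> t y q = s))))))"

text \<open>One cannot quantify over the type of times inside a formula. The type \<open>'x \<times> nat\<close>,
  with an arbitrary linear order on an arbitrary subset, suffices: lemma
  \<open>semiperfect_if_coherent_timing\<close> below shows that times in any other type can be
  transferred to it.\<close>

definition semiperfect ::
  "'x set \<Rightarrow> ('x \<Rightarrow> 'v) \<Rightarrow> ('x \<Rightarrow> 'v) \<Rightarrow> (nat \<Rightarrow> 'x \<rightharpoonup> 'x) \<Rightarrow> bool" where
  "semiperfect X wt dp F \<longleftrightarrow>
     crystal X wt dp F \<and>
     (\<exists>(T :: ('x \<times> nat) set) le t. coherent_timing X wt dp F T le t) \<and>
     (\<exists>m\<in>X. \<forall>x\<in>X. (\<lambda>u v. \<exists>p\<in>{1..r}. string_le X F p u v)\<^sup>*\<^sup>* x m)"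

subsection \<open>Chains of roots and admissible subsets\<close>

definition chain_count :: "'i::linorder set \<Rightarrow> ('i \<Rightarrow> 'v) \<Rightarrow> 'i \<Rightarrow> 'v \<Rightarrow> int" where
  "chain_count I \<beta> i a =
     (if a \<in> pos_roots then int (card {j \<in> I. j < i \<and> \<beta> j = a})
      else 1 - int (card {j \<in> I. j < i \<and> \<beta> j = - a}))"

text \<open>Finiteness is required explicitly, as \<open>card\<close> is 0 on infinite sets.\<close>

definition lambda_chain :: "'v \<Rightarrow> 'i::linorder set \<Rightarrow> ('i \<Rightarrow> 'v) \<Rightarrow> bool" where
  "lambda_chain l I \<beta> \<longleftrightarrow>
     (\<forall>i\<in>I. \<beta> i \<in> pos_roots) \<and>
     (\<forall>a\<in>pos_roots. finite {i \<in> I. \<beta> i = a} \<and>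
        real (card {i \<in> I. \<beta> i = a}) = \<langle>l, coroot a\<rangle>) \<and>
     (\<forall>a\<in>roots. \<forall>b\<in>roots. \<forall>c\<in>roots. \<forall>k::int. \<forall>i\<in>I.
        a \<noteq> b \<and> a \<noteq> - b \<and> coroot c = coroot a + of_int k *\<^sub>R coroot b \<and> \<beta> i = b \<longrightarrow>
        chain_count I \<beta> i c = chain_count I \<beta> i a + k * chain_count I \<beta> i b)"

definition refl_product :: "('i \<Rightarrow> 'v) \<Rightarrow> 'i list \<Rightarrow> 'v \<Rightarrow> 'v" where
  "refl_product \<beta> js = foldr (\<lambda>j f. reflect (\<beta> j) \<circ> f) js id"

definition admissible :: "'i::linorder set \<Rightarrow> ('i \<Rightarrow> 'v) \<Rightarrow> 'i set set" where
  "admissible I \<beta> = {J. J \<subseteq> I \<and> finite J \<and>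
     (\<forall>k < card J.
        bruhat_cover (refl_product \<beta> (take k (sorted_list_of_set J)))
                     (refl_product \<beta> (take (Suc k) (sorted_list_of_set J))))}"

definition weight :: "'v \<Rightarrow> 'i::linorder set \<Rightarrow> ('i \<Rightarrow> 'v) \<Rightarrow> 'i set \<Rightarrow> 'v" where
  "weight l I \<beta> J =
     foldr (\<lambda>i. aff_refl (\<beta> i) (int (card {j \<in> I. j < i \<and> \<beta> j = \<beta> i})))
       (sorted_list_of_set J) l"

subsection \<open>Foldings and root operators\<close>

definition fold_at ::
  "'i::linorder \<Rightarrow> ('i \<Rightarrow> 'v \<times> int) \<times> 'v \<Rightarrow> ('i \<Rightarrow> 'v \<times> int) \<times> 'v" where
  "fold_at i \<Gamma> = (case \<Gamma> of (g, ginf) \<Rightarrow>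
     ((\<lambda>j. if j < i then g j
           else if j = i then (fst (g i), - snd (g i))
           else (reflect (fst (g i)) (fst (g j)), snd (g j))),
      reflect (fst (g i)) ginf))"

definition folding ::
  "('i::linorder \<Rightarrow> 'v) \<Rightarrow> 'i set \<Rightarrow> ('i \<Rightarrow> 'v \<times> int) \<times> 'v" where
  "folding \<beta> J = foldr fold_at (sorted_list_of_set J) ((\<lambda>i. (\<beta> i, 1)), \<rho>)"

definition gam :: "('i::linorder \<Rightarrow> 'v) \<Rightarrow> 'i set \<Rightarrow> 'i \<Rightarrow> 'v" where
  "gam \<beta> J i = fst (fst (folding \<beta> J) i)"

definition eps :: "('i::linorder \<Rightarrow> 'v) \<Rightarrow> 'i set \<Rightarrow> 'i \<Rightarrow> int" where
  "eps \<beta> J i = snd (fst (folding \<beta> J) i)"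

definition level :: "'i::linorder set \<Rightarrow> ('i \<Rightarrow> 'v) \<Rightarrow> 'i set \<Rightarrow> 'i \<Rightarrow> int" where
  "level I \<beta> J i =
     (if gam \<beta> J i \<in> pos_roots then 0 else -1) +
     (\<Sum>j | j \<in> I \<and> j < i \<and> eps \<beta> J j = 1 \<and> (gam \<beta> J j = gam \<beta> J i \<or> gam \<beta> J j = - gam \<beta> J i).
        root_sgn (gam \<beta> J j))"

definition simple_inds :: "'i::linorder set \<Rightarrow> ('i \<Rightarrow> 'v) \<Rightarrow> 'i set \<Rightarrow> nat \<Rightarrow> 'i set" where
  "simple_inds I \<beta> J p = {i \<in> I. gam \<beta> J i = \<alpha> p \<or> gam \<beta> J i = - \<alpha> p}"

definition max_level :: "'v \<Rightarrow> 'i::linorder set \<Rightarrow> ('i \<Rightarrow> 'v) \<Rightarrow> 'i set \<Rightarrow> nat \<Rightarrow> real" where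
  "max_level l I \<beta> J p =
     Max ((\<lambda>i. of_int (level I \<beta> J i)) ` simple_inds I \<beta> J p \<union> {\<langle>weight l I \<beta> J, coroot (\<alpha> p)\<rangle>})"

text \<open>The two branches of the inner conditional are the cases \<open>m \<noteq> \<infinity>\<close> and \<open>m = \<infinity>\<close>; the
  predecessor \<open>k\<close> is the largest simple index below \<open>m\<close>.\<close>

definition root_op ::
  "'v \<Rightarrow> 'i::linorder set \<Rightarrow> ('i \<Rightarrow> 'v) \<Rightarrow> nat \<Rightarrow> 'i set \<rightharpoonup> 'i set" where
  "root_op l I \<beta> p J =
     (if J \<in> admissible I \<beta> \<and> max_level l I \<beta> J p > 0 then
        let Ip = simple_inds I \<beta> J p;
            H = {i \<in> Ip. of_int (level I \<beta> J i) = max_level l I \<beta> J p}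
        in if H \<noteq> {} then
             (let m = Min H; k = Max {i \<in> Ip. i < m} in Some (sym_diff J {k, m}))
           else
             (let k = Max Ip in Some (sym_diff J {k}))
      else None)"

definition depth :: "'v \<Rightarrow> 'i::linorder set \<Rightarrow> ('i \<Rightarrow> 'v) \<Rightarrow> 'i set \<Rightarrow> 'v" where
  "depth l I \<beta> J = weight l I \<beta> J - (\<Sum>p\<in>{1..r}. max_level l I \<beta> J p *\<^sub>R \<omega> p)"

subsection \<open>Justification of the encodings\<close>

lemma pairing_simps:
  "\<langle>x + y, z\<rangle> = \<langle>x, z\<rangle> + \<langle>y, z\<rangle>" "\<langle>z, x + y\<rangle> = \<langle>z, x\<rangle> + \<langle>z, y\<rangle>"
  "\<langle>x - y, z\<rangle> = \<langle>x, z\<rangle> - \<langle>y, z\<rangle>" "\<langle>z, x - y\<rangle> = \<langle>z, x\<rangle> - \<langle>z, y\<rangle>"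
  "\<langle>c *\<^sub>R x, z\<rangle> = c * \<langle>x, z\<rangle>" "\<langle>z, c *\<^sub>R x\<rangle> = c * \<langle>z, x\<rangle>"
  using bilinear_pairing
  by (auto simp: bilinear_ladd bilinear_radd bilinear_lsub bilinear_rsub bilinear_lmul bilinear_rmul)

lemma linear_refl: "linear (reflect a)"
  by (rule linearI) (simp_all add: reflect_def pairing_simps algebra_simps)

lemma refl_isometry: "\<langle>a, a\<rangle> \<noteq> 0 \<Longrightarrow> \<langle>reflect a x, reflect a y\<rangle> = \<langle>x, y\<rangle>"
proof -
  assume a: "\<langle>a, a\<rangle> \<noteq> 0"
  have "\<langle>reflect a x, reflect a y\<rangle> =
      \<langle>x, y\<rangle> - 2 * \<langle>y, a\<rangle> * \<langle>x, a\<rangle> / \<langle>a, a\<rangle> - 2 * \<langle>x, a\<rangle> / \<langle>a, a\<rangle> * (\<langle>a, y\<rangle> - 2 * \<langle>y, a\<rangle> * (\<langle>a, a\<rangle> / \<langle>a, a\<rangle>))"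
    by (simp add: reflect_def coroot_def pairing_simps algebra_simps)
  also have "\<dots> = \<langle>x, y\<rangle>"
    using a by (simp add: sym_pairing[of a y])
  finally show ?thesis .
qed

lemma weyl_linear_isometry:
  assumes "w \<in> weyl" shows "linear w" "\<langle>w x, w y\<rangle> = \<langle>x, y\<rangle>"
proof -
  have "linear w \<and> (\<forall>x y. \<langle>w x, w y\<rangle> = \<langle>x, y\<rangle>)"
    using assms unfolding weyl_def
  proof induction
    case refl_group_id
    then show ?case by (simp add: linear_iff)
  next
    case (refl_group_step w a)
    then have "\<langle>a, a\<rangle> \<noteq> 0" using simple_pos by force
    moreover have "linear (reflect a \<circ> w)"
      using refl_group_step linear_refl by (intro linear_compose) auto
    ultimately show ?case
      using refl_group_step by (metis comp_apply refl_isometry)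
  qed
  then show "linear w" "\<langle>w x, w y\<rangle> = \<langle>x, y\<rangle>" by auto
qed

lemma weyl_comp: "v \<in> weyl \<Longrightarrow> w \<in> weyl \<Longrightarrow> v \<circ> w \<in> weyl"
  unfolding weyl_def
  by (induction rule: refl_group.induct) (auto simp: comp_assoc intro: refl_group.intros)

lemma refl_refl: "\<langle>a, a\<rangle> \<noteq> 0 \<Longrightarrow> reflect a \<circ> reflect a = id"
  by (rule ext) (simp add: reflect_def coroot_def pairing_simps field_simps)

lemma simple_refl_weyl: "p \<in> {1..r} \<Longrightarrow> reflect (\<alpha> p) \<in> weyl"
  using refl_group_step[OF refl_group_id] unfolding weyl_def by fastforce

lemma weyl_inverse:
  assumes "w \<in> weyl" shows "\<exists>v\<in>weyl. v \<circ> w = id \<and> w \<circ> v = id"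
  using assms unfolding weyl_def
proof induction
  case refl_group_id
  show ?case by (intro bexI[of _ id] conjI refl_group.refl_group_id) (rule id_comp)+
next
  case (refl_group_step w a)
  then obtain v where v: "v \<in> weyl" "v \<circ> w = id" "w \<circ> v = id" unfolding weyl_def by blast
  obtain p where p: "p \<in> {1..r}" "a = \<alpha> p" using refl_group_step by auto
  then have ra: "reflect a \<circ> reflect a = id" using simple_pos[of p] by (intro refl_refl) auto
  have "v \<circ> reflect a \<in> weyl" using v p simple_refl_weyl weyl_comp by blast
  moreover have "(v \<circ> reflect a) \<circ> (reflect a \<circ> w) = id"
    using v(2) ra by (simp add: fun_eq_iff)
  moreover have "(reflect a \<circ> w) \<circ> (v \<circ> reflect a) = id"
    using v(3) ra by (simp add: fun_eq_iff)
  ultimately show ?case unfolding weyl_def by blast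
qed

lemma refl_root_weyl:
  assumes "a \<in> roots" shows "reflect a \<in> weyl"
proof -
  obtain w p where w: "w \<in> weyl" "p \<in> {1..r}" "a = w (\<alpha> p)"
    using assms by (auto simp: roots_def)
  obtain v where v: "v \<in> weyl" "w \<circ> v = id" using weyl_inverse w by blast
  have "w (reflect (\<alpha> p) (v x)) = reflect a x" for x
  proof -
    have wv: "w (v x) = x" using v(2) by (simp add: fun_eq_iff)
    have "\<langle>w (v x), w (\<alpha> p)\<rangle> = \<langle>v x, \<alpha> p\<rangle>" "\<langle>w (\<alpha> p), w (\<alpha> p)\<rangle> = \<langle>\<alpha> p, \<alpha> p\<rangle>"
      using w(1) weyl_linear_isometry(2) by auto
    then show ?thesis
      using weyl_linear_isometry(1)[OF w(1)] wv
      by (simp add: reflect_def coroot_def w(3) pairing_simps linear_diff linear_cmul)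
  qed
  then have "reflect a = w \<circ> (reflect (\<alpha> p) \<circ> v)" by (simp add: fun_eq_iff)
  then show ?thesis using weyl_comp simple_refl_weyl v w by metis
qed

lemma simple_in_roots: "p \<in> {1..r} \<Longrightarrow> \<alpha> p \<in> roots"
proof -
  assume "p \<in> {1..r}"
  moreover have "id \<in> weyl" unfolding weyl_def by (rule refl_group_id)
  ultimately show ?thesis unfolding roots_def by (metis (mono_tags, lifting) CollectI id_apply)
qed

lemma weyl_eq_refl_group_roots: "weyl = refl_group roots"
proof
  show "weyl \<subseteq> refl_group roots"
  proof
    fix w assume "w \<in> weyl"
    then show "w \<in> refl_group roots" unfolding weyl_def
    proof induction
      case refl_group_id
      show ?case by (rule refl_group.refl_group_id)
    next
      case (refl_group_step w a)
      then have "a \<in> roots" using simple_in_roots by blast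
      with refl_group_step show ?case by (intro refl_group.refl_group_step)
    qed
  qed
  show "refl_group roots \<subseteq> weyl"
  proof
    fix w assume "w \<in> refl_group roots"
    then show "w \<in> weyl"
    proof induction
      case refl_group_id
      show ?case unfolding weyl_def by (rule refl_group.refl_group_id)
    next
      case (refl_group_step w a)
      then show ?case by (intro weyl_comp refl_root_weyl)
    qed
  qed
qed

lemma semiperfect_if_coherent_timing:
  fixes T :: "'t set" and X :: "'x set"
  assumes cr: "crystal X wt dp F"
    and co: "coherent_timing X wt dp F T le t"
    and mx: "\<exists>m\<in>X. \<forall>x\<in>X. (\<lambda>u v. \<exists>p\<in>{1..r}. string_le X F p u v)\<^sup>*\<^sup>* x m"
  shows "semiperfect X wt dp F"
proof -
  define D where "D = {(x, p). x \<in> X \<and> p \<in> {1..r} \<and> dp_at dp x p < 0}"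
  define S where "S = case_prod t ` D"
  define g where "g = inv_into D (case_prod t)"
  have inj: "inj_on g S" unfolding g_def S_def by (rule inj_on_inv_into) simp
  have tS: "t x p \<in> S" if "x \<in> X" "p \<in> {1..r}" "dp_at dp x p < 0" for x p
    using that unfolding S_def D_def by force
  have ST: "S \<subseteq> T" using co unfolding coherent_timing_def S_def D_def by auto
  define T' where "T' = g ` S"
  define le' where "le' = {(g a, g b) | a b. a \<in> S \<and> b \<in> S \<and> (a, b) \<in> le}"
  define t' where "t' = (\<lambda>x p. g (t x p))"
  have lin: "linear_order_on T le" using co unfolding coherent_timing_def by blast
  have gle: "(g a, g b) \<in> le' \<longleftrightarrow> (a, b) \<in> le" if "a \<in> S" "b \<in> S" for a b
    using that inj unfolding le'_def by (auto dest: inj_onD)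
  have geq: "g a = g b \<longleftrightarrow> a = b" if "a \<in> S" "b \<in> S" for a b
    using that inj by (auto dest: inj_onD)
  have lin': "linear_order_on T' le'"
    unfolding linear_order_on_def partial_order_on_def preorder_on_def
  proof (intro conjI)
    show "le' \<subseteq> T' \<times> T'" unfolding le'_def T'_def by auto
    show "refl_on T' le'"
      using lin ST gle unfolding T'_def refl_on_def order_on_defs by auto
    show "trans le'"
    proof (rule transI)
      fix x y z assume "(x, y) \<in> le'" "(y, z) \<in> le'"
      then obtain a b c where "a \<in> S" "b \<in> S" "c \<in> S" "x = g a" "y = g b" "z = g c"
        unfolding le'_def by auto
      then show "(x, z) \<in> le'" using \<open>(x, y) \<in> le'\<close> \<open>(y, z) \<in> le'\<close> gle lin
        unfolding order_on_defs trans_def by metis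
    qed
    show "antisym le'"
    proof (rule antisymI)
      fix x y assume "(x, y) \<in> le'" "(y, x) \<in> le'"
      moreover then obtain a b where "a \<in> S" "b \<in> S" "x = g a" "y = g b"
        unfolding le'_def by auto
      ultimately show "x = y" using gle lin
        unfolding order_on_defs antisym_def by metis
    qed
    show "total_on T' le'"
      unfolding total_on_def
    proof (intro ballI impI)
      fix x y assume "x \<in> T'" "y \<in> T'" "x \<noteq> y"
      then obtain a b where ab: "a \<in> S" "b \<in> S" "x = g a" "y = g b" "a \<noteq> b"
        unfolding T'_def by auto
      then have "(a, b) \<in> le \<or> (b, a) \<in> le"
        using lin ST unfolding linear_order_on_def total_on_def by blast
      then show "(x, y) \<in> le' \<or> (y, x) \<in> le'" using ab gle by blast
    qed
  qed
  have Fx: "the (F p x) \<in> X \<and> dp_at dp (the (F p x)) p < 0"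
    if "x \<in> X" "p \<in> {1..r}" "rise_at wt dp x p > 0" for x p
  proof -
    have "bij_betw (the \<circ> F p) {x \<in> X. rise_at wt dp x p > 0} {x \<in> X. dp_at dp x p < 0}"
      using cr that(2) unfolding crystal_def by blast
    then have "(the \<circ> F p) x \<in> {x \<in> X. dp_at dp x p < 0}"
      using that by (blast dest: bij_betwE)
    then show ?thesis by simp
  qed
  have "coherent_timing X wt dp F T' le' t'"
    unfolding coherent_timing_def
  proof (intro conjI ballI impI allI lin')
    fix x p assume "x \<in> X" "p \<in> {1..r}" "dp_at dp x p < 0"
    then show "t' x p \<in> T'" using tS unfolding t'_def T'_def by blast
  next
    fix x p assume h: "x \<in> X" "p \<in> {1..r}" "dp_at dp x p < 0 \<and> rise_at wt dp x p > 0"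
    have "(t (the (F p x)) p, t x p) \<in> le"
      using co h unfolding coherent_timing_def by blast
    then show "(t' (the (F p x)) p, t' x p) \<in> le'"
      using h Fx tS gle unfolding t'_def by blast
  next
    fix x p q d s
    assume h: "x \<in> X" "p \<in> {1..r}" "dp_at dp x p < 0 \<and> rise_at wt dp x p > 0"
      "q \<in> {1..r}" "q \<noteq> p" "d < (0::int)" "s \<in> T'" "(t' x p, s) \<in> le'"
    obtain a where a: "a \<in> S" "s = g a" using h(7) unfolding T'_def by blast
    have "(t x p, a) \<in> le" using h a gle tS unfolding t'_def by blast
    then have *: "(\<exists>y. string_le X F q x y \<and> dp_at dp y q = of_int d \<and> t y q = a) \<longleftrightarrow>
        (\<exists>y. string_le X F q (the (F p x)) y \<and> dp_at dp y q = of_int d \<and> t y q = a)"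
      using co h a ST unfolding coherent_timing_def by blast
    have "string_le X F q z y \<and> dp_at dp y q = of_int d \<and> t' y q = s \<longleftrightarrow>
          string_le X F q z y \<and> dp_at dp y q = of_int d \<and> t y q = a" for z y
      using a h(4,6) tS[of y q] geq unfolding t'_def string_le_def by auto
    then show "(\<exists>y. string_le X F q x y \<and> dp_at dp y q = of_int d \<and> t' y q = s) \<longleftrightarrow>
        (\<exists>y. string_le X F q (the (F p x)) y \<and> dp_at dp y q = of_int d \<and> t' y q = s)"
      using * by simp
  qed
  then show ?thesis using cr mx unfolding semiperfect_def by blast
qed

end

end

theory Submission
  imports Defs
begin

text \<open>For a simple root \<open>\<alpha> p\<close> and an admissible \<open>J\<close>, the levels at the indices \<open>i\<close> with
  \<open>\<gamma> i = \<plusminus>\<alpha> p\<close> are values of an affine functional along the folded chain: by condition (2), the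
  hyperplane of level \<open>l i\<close> is the image of the original hyperplane under the product of the affine
  reflections with index in \<open>J\<close> below \<open>i\<close>. Hence adding or removing such an index \<open>k\<close> reflects all
  later levels about level \<open>l k\<close>, and a root operator reflects one segment of the folded chain and
  translates what follows. Admissibility enters through the lifting property of the Bruhat order:
  between two consecutive such indices, the sign of \<open>w\<^sup>-\<^sup>1 (\<alpha> p)\<close> can change from negative to
  positive but not back, so that the sequence of levels has steps \<open>0\<close> and \<open>\<plusminus>1\<close> and starts at \<open>0\<close>.
  The index of the last maximal level is a coherent timing pattern.

  The character formula follows from the crystal structure by Stembridge's argument. In the product
  of the sum over \<open>J\<close> with the Weyl denominator, the terms of non-maximal elements cancel under a
  sign-reversing involution, which reflects an element in a string chosen by means of the timing
  pattern.\<close>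


text \<open>The set \<open>I\<close> may be any infinite linear order, without successors and not
  well-ordered, so nothing is proved by induction along it. Positions are initial segments
  (\<open>cut\<close>) rather than indices; the cut \<open>I\<close> itself plays the role of
  infinity, and inductions along the chain run over the finitely many elements of \<open>J\<close>
  inside a cut or between two cuts. With w the product of the reflections from \<open>J\<close>
  inside a cut, a correction 0 or -1 according to the sign of w^-1(\<alpha> p) makes the height
  meaningful at every cut. Levels and the pairing of the weight thus become values of one function.
  A root operator and its inverse are the same symmetric difference; what separates them is the sign
  of w^-1(\<alpha> p) at the end of the segment. Coherence rests on a locality: if the depth is
  negative, the segment ends at an index not later than the time, and beyond its end the folded
  roots do not change. Since the form may be indefinite, the relation between length and positive
  roots is not taken from Euclidean geometry but derived from computations in rank two.\<close>

context kac_moody_roots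
begin

declare One_nat_def [simp del]

section \<open>Elementary facts on reflections\<close>

lemma simple_norm_nz: "p \<in> {1..r} \<Longrightarrow> \<langle>\<alpha> p, \<alpha> p\<rangle> \<noteq> 0"
  using simple_pos by fastforce

lemma pair_coroot_self: "\<langle>a, a\<rangle> \<noteq> 0 \<Longrightarrow> \<langle>a, coroot a\<rangle> = 2"
  by (simp add: coroot_def pairing_simps)

lemma simple_pair_self [simp]: "p \<in> {1..r} \<Longrightarrow> \<langle>\<alpha> p, coroot (\<alpha> p)\<rangle> = 2"
  by (simp add: pair_coroot_self simple_norm_nz del: atLeastAtMost_iff)

lemma cartan_nonpos': "p \<in> {1..r} \<Longrightarrow> q \<in> {1..r} \<Longrightarrow> p \<noteq> q \<Longrightarrow> \<langle>\<alpha> p, coroot (\<alpha> q)\<rangle> \<le> 0"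
  using cartan_nonpos by (simp add: coroot_def)

lemma cartan_int': "p \<in> {1..r} \<Longrightarrow> q \<in> {1..r} \<Longrightarrow> \<langle>\<alpha> p, coroot (\<alpha> q)\<rangle> \<in> \<int>"
proof (cases "p = q")
  case False
  then show "p \<in> {1..r} \<Longrightarrow> q \<in> {1..r} \<Longrightarrow> ?thesis" using cartan_int by (simp add: coroot_def)
qed (simp del: atLeastAtMost_iff)

lemma reflect_minus: "reflect a (- v) = - reflect a v"
  using linear_neg[OF linear_refl] .

lemma coroot_minus: "coroot (- a) = - coroot a"
  using bilinear_pairing by (simp add: coroot_def bilinear_lneg bilinear_rneg)

lemma pairing_minus [simp]: "\<langle>- x, y\<rangle> = - \<langle>x, y\<rangle>" "\<langle>x, - y\<rangle> = - \<langle>x, y\<rangle>"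
  using bilinear_pairing by (simp_all add: bilinear_lneg bilinear_rneg)

lemma pairing_zero [simp]: "\<langle>0, y\<rangle> = 0" "\<langle>x, 0\<rangle> = 0"
  using bilinear_pairing by (simp_all add: bilinear_lzero bilinear_rzero)

lemma pairing_sum: "\<langle>\<Sum>i\<in>A. f i, y\<rangle> = (\<Sum>i\<in>A. \<langle>f i, y\<rangle>)"
  by (induction A rule: infinite_finite_induct) (auto simp: pairing_simps)

lemma reflect_uminus: "reflect (- a) = reflect a"
  by (simp add: reflect_def coroot_minus fun_eq_iff)

lemma reflect_self: "\<langle>a, a\<rangle> \<noteq> 0 \<Longrightarrow> reflect a a = - a"
  by (simp add: reflect_def pair_coroot_self scaleR_2)

lemma simple_reflect_self: "p \<in> {1..r} \<Longrightarrow> reflect (\<alpha> p) (\<alpha> p) = - \<alpha> p"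
  using reflect_self simple_norm_nz by blast

lemma simple_refl_refl: "p \<in> {1..r} \<Longrightarrow> reflect (\<alpha> p) \<circ> reflect (\<alpha> p) = id"
  using refl_refl simple_norm_nz by blast

lemma comp_simple_refl_refl: "p \<in> {1..r} \<Longrightarrow> w \<circ> reflect (\<alpha> p) \<circ> reflect (\<alpha> p) = w"
  using simple_refl_refl by (simp add: comp_assoc)

lemma simple_refl_refl_comp: "p \<in> {1..r} \<Longrightarrow> reflect (\<alpha> p) \<circ> (reflect (\<alpha> p) \<circ> w) = w"
  using simple_refl_refl by (simp add: comp_assoc[symmetric])

lemma id_weyl: "id \<in> weyl"
  unfolding weyl_def by (rule refl_group_id)

subsection \<open>Words and length\<close>

definition word :: "nat list \<Rightarrow> 'v \<Rightarrow> 'v" where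
  "word ps = foldr (\<lambda>p f. reflect (\<alpha> p) \<circ> f) ps id"

lemma word_simps [simp]: "word [] = id" "word (p # ps) = reflect (\<alpha> p) \<circ> word ps"
  by (simp_all add: word_def)

lemma word_append: "word (ps @ qs) = word ps \<circ> word qs"
  by (induction ps) (auto simp: comp_assoc)

lemma word_weyl: "set ps \<subseteq> {1..r} \<Longrightarrow> word ps \<in> weyl"
  by (induction ps) (auto simp: id_weyl simp del: atLeastAtMost_iff intro!: weyl_comp simple_refl_weyl)

lemma weyl_word: "w \<in> weyl \<Longrightarrow> \<exists>ps. set ps \<subseteq> {1..r} \<and> w = word ps"
  unfolding weyl_def
proof (induction rule: refl_group.induct)
  case refl_group_id
  show ?case by (intro exI[of _ "[]"]) auto
next
  case (refl_group_step w a)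
  then obtain ps p where "set ps \<subseteq> {1..r}" "w = word ps" "p \<in> {1..r}" "a = \<alpha> p" by auto
  then show ?case by (intro exI[of _ "p # ps"]) auto
qed

lemma len_word: "len w = (LEAST n. \<exists>ps. length ps = n \<and> set ps \<subseteq> {1..r} \<and> w = word ps)"
  by (simp add: len_def word_def)

lemma len_word_le: "set ps \<subseteq> {1..r} \<Longrightarrow> len (word ps) \<le> length ps"
  unfolding len_word by (rule Least_le) auto

lemma reduced_word:
  assumes "w \<in> weyl"
  obtains ps where "set ps \<subseteq> {1..r}" "w = word ps" "length ps = len w"
proof -
  have "\<exists>n ps. length ps = n \<and> set ps \<subseteq> {1..r} \<and> w = word ps"
    using weyl_word[OF assms] by blast
  from LeastI_ex[OF this] show ?thesis using that unfolding len_word[symmetric] by blast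
qed

lemma len_comp_word_le:
  assumes "w \<in> weyl" "set ps \<subseteq> {1..r}" shows "len (w \<circ> word ps) \<le> len w + length ps"
proof -
  obtain qs where "set qs \<subseteq> {1..r}" "w = word qs" "length qs = len w"
    using reduced_word[OF assms(1)] .
  then show ?thesis using len_word_le[of "qs @ ps"] assms by (simp add: word_append)
qed

lemma len_id [simp]: "len id = 0"
  using len_word_le[of "[]"] by simp

lemma len_0: "w \<in> weyl \<Longrightarrow> len w = 0 \<Longrightarrow> w = id"
  by (metis reduced_word length_0_conv word_simps(1))

lemma len_right_le: "w \<in> weyl \<Longrightarrow> p \<in> {1..r} \<Longrightarrow> len (w \<circ> reflect (\<alpha> p)) \<le> len w + 1"
  using len_comp_word_le[of w "[p]"] by simp

lemma len_left_le: 
  assumes "w \<in> weyl" "p \<in> {1..r}" shows "len (reflect (\<alpha> p) \<circ> w) \<le> len w + 1"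
proof -
  obtain qs where "set qs \<subseteq> {1..r}" "w = word qs" "length qs = len w"
    using reduced_word[OF assms(1)] .
  then show ?thesis using len_word_le[of "p # qs"] assms by simp
qed

lemma finite_weyl_len_le: "finite {w \<in> weyl. len w \<le> n}"
proof (rule finite_subset)
  show "{w \<in> weyl. len w \<le> n} \<subseteq> word ` {ps. set ps \<subseteq> {1..r} \<and> length ps \<le> n}"
    by (auto elim!: reduced_word)
  show "finite (word ` {ps. set ps \<subseteq> {1..r} \<and> length ps \<le> n})"
    by (intro finite_imageI finite_lists_length_le) simp
qed

subsection \<open>The cone of nonnegative combinations of simple roots\<close>

text \<open>The cone condition of \<open>pos_roots\<close> without membership in
  \<open>roots\<close>: unlike that set it is closed under addition and positive scaling, as the
  rank two arguments require.\<close>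

definition nonneg :: "'v \<Rightarrow> bool" where
  "nonneg v \<longleftrightarrow> (\<exists>c. (\<forall>p\<in>{1..r}. c p \<ge> 0) \<and> v = (\<Sum>p\<in>{1..r}. c p *\<^sub>R \<alpha> p))"

lemma pos_roots_nonneg: "a \<in> pos_roots \<longleftrightarrow> a \<in> roots \<and> nonneg a"
  by (simp add: pos_roots_def nonneg_def)

lemma nonneg_add: "nonneg u \<Longrightarrow> nonneg v \<Longrightarrow> nonneg (u + v)"
  unfolding nonneg_def
proof (elim exE conjE)
  fix c d assume "\<forall>p\<in>{1..r}. 0 \<le> c p" "\<forall>p\<in>{1..r}. 0 \<le> d p" "u = (\<Sum>p\<in>{1..r}. c p *\<^sub>R \<alpha> p)"
    "v = (\<Sum>p\<in>{1..r}. d p *\<^sub>R \<alpha> p)"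
  then show "\<exists>c. (\<forall>p\<in>{1..r}. 0 \<le> c p) \<and> u + v = (\<Sum>p\<in>{1..r}. c p *\<^sub>R \<alpha> p)"
    by (intro exI[of _ "\<lambda>p. c p + d p"]) (auto simp: scaleR_add_left sum.distrib)
qed

lemma nonneg_scale: "nonneg u \<Longrightarrow> x \<ge> 0 \<Longrightarrow> nonneg (x *\<^sub>R u)"
  unfolding nonneg_def
proof (elim exE conjE)
  fix c assume "\<forall>p\<in>{1..r}. 0 \<le> c p" "u = (\<Sum>p\<in>{1..r}. c p *\<^sub>R \<alpha> p)" "0 \<le> x"
  then show "\<exists>c. (\<forall>p\<in>{1..r}. 0 \<le> c p) \<and> x *\<^sub>R u = (\<Sum>p\<in>{1..r}. c p *\<^sub>R \<alpha> p)"
    by (intro exI[of _ "\<lambda>p. x * c p"]) (auto simp: scaleR_sum_right)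
qed

lemma nonneg_simple: "p \<in> {1..r} \<Longrightarrow> nonneg (\<alpha> p)"
  unfolding nonneg_def
proof (intro exI[of _ "\<lambda>q. if q = p then 1 else 0"] conjI ballI)
  assume "p \<in> {1..r}"
  then have "(\<Sum>q\<in>{1..r}. (if q = p then 1 else 0) *\<^sub>R \<alpha> q) = (\<Sum>q\<in>{1..r}. if q = p then \<alpha> q else 0)"
    by (intro sum.cong) auto
  then show "\<alpha> p = (\<Sum>q\<in>{1..r}. (if q = p then 1 else 0) *\<^sub>R \<alpha> q)"
    using \<open>p \<in> {1..r}\<close> by simp
qed auto

lemma simple_coeff_zero:
  assumes "(\<Sum>p\<in>{1..r}. c p *\<^sub>R \<alpha> p) = 0" "p \<in> {1..r}" shows "c p = 0"
proof -
  let ?g = "\<lambda>v. c (inv_into {1..r} \<alpha> v)"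
  have "(\<Sum>v\<in>\<alpha> ` {1..r}. ?g v *\<^sub>R v) = (\<Sum>p\<in>{1..r}. c p *\<^sub>R \<alpha> p)"
    unfolding sum.reindex[OF inj_simple] o_def
    by (intro sum.cong refl) (simp only: inv_into_f_f[OF inj_simple])
  then have "?g (\<alpha> p) = 0"
    using independent_simple assms by (intro independentD[OF independent_simple, of "\<alpha> ` {1..r}"]) auto
  then show ?thesis using inv_into_f_f[OF inj_simple] assms by simp
qed

lemma simple_coeff_eq:
  assumes "(\<Sum>p\<in>{1..r}. c p *\<^sub>R \<alpha> p) = (\<Sum>p\<in>{1..r}. d p *\<^sub>R \<alpha> p)" "p \<in> {1..r}"
  shows "c p = d p"
  using simple_coeff_zero[of "\<lambda>p. c p - d p"] assms
  by (simp add: scaleR_diff_left sum_subtractf)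

lemma nonneg_antisym: "nonneg v \<Longrightarrow> nonneg (- v) \<Longrightarrow> v = 0"
  unfolding nonneg_def
proof (elim exE conjE)
  fix c d assume c: "\<forall>p\<in>{1..r}. 0 \<le> c p" and d: "\<forall>p\<in>{1..r}. 0 \<le> d p" 
    and v: "v = (\<Sum>p\<in>{1..r}. c p *\<^sub>R \<alpha> p)" "- v = (\<Sum>p\<in>{1..r}. d p *\<^sub>R \<alpha> p)"
  have "(\<Sum>p\<in>{1..r}. (c p + d p) *\<^sub>R \<alpha> p) = v + - v"
    unfolding v by (simp only: v[symmetric] scaleR_add_left sum.distrib)
  then have *: "(\<Sum>p\<in>{1..r}. (c p + d p) *\<^sub>R \<alpha> p) = 0" by simp
  have "c p = 0" if "p \<in> {1..r}" for p
    using simple_coeff_zero[OF * that] bspec[OF c that] bspec[OF d that] by linarith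
  then show "v = 0" unfolding v by simp
qed

subsection \<open>Dihedral subgroups\<close>

text \<open>The alternating word of length k whose last letter is x. It grows on the left in effect
  (\<open>alt_Cons\<close>) but is defined through its last letter, because this is the reflection
  that acts first on a vector.\<close>

fun alt :: "nat \<Rightarrow> nat \<Rightarrow> nat \<Rightarrow> nat list" where
  "alt 0 x y = []"
| "alt (Suc k) x y = alt k y x @ [x]"

lemma alt_numeral:
  "alt 1 x y = [x]" "alt 2 x y = [y, x]" "alt 3 x y = [x, y, x]" "alt 4 x y = [y, x, y, x]"
  "alt 5 x y = [x, y, x, y, x]" "alt 6 x y = [y, x, y, x, y, x]"
  by (simp_all add: numeral_eq_Suc One_nat_def)

lemma length_alt [simp]: "length (alt k x y) = k"
  by (induction k arbitrary: x y) auto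

lemma set_alt: "set (alt k x y) \<subseteq> {x, y}"
  by (induction k arbitrary: x y) auto

lemma alt_Cons: "alt (Suc k) x y = (if even k then x else y) # alt k x y"
  by (induction k arbitrary: x y) auto

lemma alt_split: "\<exists>us. length us = j \<and> set us \<subseteq> {x, y} \<and> alt (j + m) x y = us @ alt m x y"
proof (induction j)
  case (Suc j)
  then obtain us where us: "length us = j" "set us \<subseteq> {x, y}" "alt (j + m) x y = us @ alt m x y" by blast
  then show ?case using alt_Cons[of "j + m" x y]
    by (intro exI[of _ "(if even (j + m) then x else y) # us"]) auto
qed auto

text \<open>Coordinates modulo the plane of two simple roots, with v left arbitrary. One rule thus
  evaluates words both on the plane (v = 0) and on the whole space, as the braid relations
  need.\<close>

lemma reflect_plane:
  assumes "p \<in> {1..r}" "q \<in> {1..r}" "\<langle>\<alpha> q, coroot (\<alpha> p)\<rangle> = - b"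
  shows "reflect (\<alpha> p) (v - x *\<^sub>R \<alpha> p - y *\<^sub>R \<alpha> q) =
      v - (\<langle>v, coroot (\<alpha> p)\<rangle> - x + b * y) *\<^sub>R \<alpha> p - y *\<^sub>R \<alpha> q"
proof -
  define K where "K = \<langle>v, coroot (\<alpha> p)\<rangle> - 2 * x + b * y"
  have K: "\<langle>v - x *\<^sub>R \<alpha> p - y *\<^sub>R \<alpha> q, coroot (\<alpha> p)\<rangle> = K"
    using assms by (simp add: pairing_simps K_def del: atLeastAtMost_iff)
  have "reflect (\<alpha> p) (v - x *\<^sub>R \<alpha> p - y *\<^sub>R \<alpha> q) = v - (x + K) *\<^sub>R \<alpha> p - y *\<^sub>R \<alpha> q"
    unfolding reflect_def K by (simp add: scaleR_add_left)
  also have "x + K = \<langle>v, coroot (\<alpha> p)\<rangle> - x + b * y" by (simp add: K_def)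
  finally show ?thesis .
qed

text \<open>The infinite dihedral case. The condition b y \<ge> 2 x is the invariant: after one
  reflection the roles of the two roots are exchanged, and a b \<ge> 4 gives a (b y - x) \<ge> 2 y
  for the new coordinates.\<close>

lemma word_alt_plane_nonneg:
  assumes "p \<in> {1..r}" "q \<in> {1..r}" "\<langle>\<alpha> q, coroot (\<alpha> p)\<rangle> = - b" "\<langle>\<alpha> p, coroot (\<alpha> q)\<rangle> = - a"
    "a \<ge> 0" "b \<ge> 0" "a * b \<ge> 4" "x \<ge> 0" "y \<ge> 0" "b * y \<ge> 2 * x"
  shows "\<exists>x' y'. x' \<ge> 0 \<and> y' \<ge> 0 \<and>
     word (alt k p q) (x *\<^sub>R \<alpha> p + y *\<^sub>R \<alpha> q) = x' *\<^sub>R \<alpha> p + y' *\<^sub>R \<alpha> q"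
  using assms
proof (induction k arbitrary: p q a b x y)
  case (Suc k)
  have 1: "reflect (\<alpha> p) (x *\<^sub>R \<alpha> p + y *\<^sub>R \<alpha> q) = (b * y - x) *\<^sub>R \<alpha> p + y *\<^sub>R \<alpha> q"
    using reflect_plane[OF Suc.prems(1-3), of 0 "- x" "- y"]
    by (simp add: algebra_simps)
  have "a * (b * y - x) \<ge> 2 * y"
  proof -
    have "a * (b * y) \<ge> a * (2 * x)" using Suc.prems by (intro mult_left_mono) auto
    moreover have "a * b * y \<ge> 4 * y" using Suc.prems by (intro mult_right_mono) auto
    ultimately show ?thesis by (simp add: algebra_simps)
  qed
  moreover have "b * y - x \<ge> 0" using Suc.prems by linarith
  ultimately have "\<exists>x' y'. x' \<ge> 0 \<and> y' \<ge> 0 \<and>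
     word (alt k q p) (y *\<^sub>R \<alpha> q + (b * y - x) *\<^sub>R \<alpha> p) = x' *\<^sub>R \<alpha> q + y' *\<^sub>R \<alpha> p"
    using Suc.prems by (intro Suc.IH[of q p a b]) (auto simp: mult.commute)
  then show ?case using 1 by (simp add: word_append) (metis add.commute)
qed auto

lemma int_cartan_cases:
  fixes a b :: real
  assumes "a \<in> \<int>" "b \<in> \<int>" "a \<ge> 0" "b \<ge> 0" "a = 0 \<longleftrightarrow> b = 0" "a * b < 4"
  shows "(a, b) \<in> {(0,0), (1,1), (1,2), (2,1), (1,3), (3,1)}"
proof -
  obtain m n :: int where mn: "a = of_int m" "b = of_int n" using assms by (auto elim!: Ints_cases)
  have nn: "m \<ge> 0" "n \<ge> 0" "m = 0 \<longleftrightarrow> n = 0" and *: "m * n < 4"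
    using assms unfolding mn by (auto simp flip: of_int_mult)
  show ?thesis
  proof (cases "m = 0")
    case False
    then have "m \<ge> 1" "n \<ge> 1" using nn by linarith+
    moreover have "m * 1 \<le> m * n" "1 * n \<le> m * n"
      using calculation by (auto intro!: mult_left_mono mult_right_mono)
    ultimately have "m \<le> 3" "n \<le> 3" using * by linarith+
    then have "m \<in> {1,2,3}" "n \<in> {1,2,3}" using \<open>m \<ge> 1\<close> \<open>n \<ge> 1\<close> by auto
    then show ?thesis using * unfolding mn by auto
  qed (use nn mn in auto)
qed

text \<open>The product of the two off-diagonal Cartan integers decides. If it is at least 4, no
  alternating word ever makes \<alpha> p negative; otherwise the rank two system is finite and has a
  braid relation, before whose length \<alpha> p stays nonnegative.\<close>

lemma dihedral:
  assumes p: "p \<in> {1..r}" and q: "q \<in> {1..r}" and pq: "p \<noteq> q"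
  shows "(\<forall>k. \<exists>x y. x \<ge> 0 \<and> y \<ge> 0 \<and> word (alt k q p) (\<alpha> p) = x *\<^sub>R \<alpha> p + y *\<^sub>R \<alpha> q) \<or>
     (\<exists>m\<ge>1. word (alt m q p) = word (alt m p q) \<and>
       (\<forall>k<m. \<exists>x y. x \<ge> 0 \<and> y \<ge> 0 \<and> word (alt k q p) (\<alpha> p) = x *\<^sub>R \<alpha> p + y *\<^sub>R \<alpha> q))"
proof -
  define a where "a = - \<langle>\<alpha> p, coroot (\<alpha> q)\<rangle>"
  define b where "b = - \<langle>\<alpha> q, coroot (\<alpha> p)\<rangle>"
  have ab: "a \<in> \<int>" "b \<in> \<int>" "a \<ge> 0" "b \<ge> 0" 
    using cartan_int'[OF p q] cartan_int'[OF q p] cartan_nonpos'[OF p q] cartan_nonpos'[OF q p] pq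
    unfolding a_def b_def by auto
  have ab0: "a = 0 \<longleftrightarrow> b = 0"
    using simple_norm_nz[OF p] simple_norm_nz[OF q] unfolding a_def b_def
    by (auto simp: coroot_def pairing_simps sym_pairing[of "\<alpha> p" "\<alpha> q"])
  have ba: "\<langle>\<alpha> p, coroot (\<alpha> q)\<rangle> = - a" "\<langle>\<alpha> q, coroot (\<alpha> p)\<rangle> = - b" by (simp_all add: a_def b_def)
  show ?thesis
  proof (cases "a * b \<ge> 4")
    case True
    have "\<exists>x y. x \<ge> 0 \<and> y \<ge> 0 \<and> word (alt k q p) (0 *\<^sub>R \<alpha> q + 1 *\<^sub>R \<alpha> p) = x *\<^sub>R \<alpha> q + y *\<^sub>R \<alpha> p" for k
      using True ab ba by (intro word_alt_plane_nonneg[OF q p, of a b]) (auto simp: mult.commute)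
    then show ?thesis by (intro disjI1) (simp, metis add.commute)
  next
    case False
    define P where "P = (\<lambda>v x y. v - x *\<^sub>R \<alpha> p - y *\<^sub>R \<alpha> q)"
    have Rp: "reflect (\<alpha> p) (P v x y) = P v (\<langle>v, coroot (\<alpha> p)\<rangle> - x + b * y) y" for v x y
      unfolding P_def using reflect_plane[OF p q ba(2)] .
    have Rq: "reflect (\<alpha> q) (P v x y) = P v x (\<langle>v, coroot (\<alpha> q)\<rangle> - y + a * x)" for v x y
      unfolding P_def using reflect_plane[OF q p ba(1), of v y x] by (simp add: algebra_simps)
    have P0: "v = P v 0 0" for v by (simp add: P_def)
    have Pp: "\<alpha> p = P 0 (-1) 0" by (simp add: P_def)
    have pos: "\<exists>x y. x \<ge> 0 \<and> y \<ge> 0 \<and> P 0 u v = x *\<^sub>R \<alpha> p + y *\<^sub>R \<alpha> q" if "u \<le> 0" "v \<le> 0" for u v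
      using that by (intro exI[of _ "- u"] exI[of _ "- v"]) (auto simp: P_def)
    note alt.simps(2) [simp del]
    \<comment> \<open>The orders of the product of the two reflections in types A1 x A1, A2, B2 and
      G2.\<close>
    define m where "m = (if a = 0 then 2 else if a * b = 1 then 3 else if a * b = 2 then 4 else (6::nat))"
    have cs: "a = 0 \<and> b = 0 \<and> m = 2 \<or> a = 1 \<and> b = 1 \<and> m = 3 \<or> a = 1 \<and> b = 2 \<and> m = 4 \<or> a = 2 \<and> b = 1 \<and> m = 4
       \<or> a = 1 \<and> b = 3 \<and> m = 6 \<or> a = 3 \<and> b = 1 \<and> m = 6"
      using int_cartan_cases[OF ab ab0] False unfolding m_def by auto
    have P_cong: "P v x y = P v x' y'" if "x = x'" "y = y'" for v x y x' y' using that by simp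
    \<comment> \<open>The coordinates of both sides are computed symbolically for arbitrary v; only
      the order of summands remains to be matched.\<close>
    have "word (alt m q p) (P v 0 0) = word (alt m p q) (P v 0 0)" for v
      using cs by (elim disjE conjE)
        (simp_all add: alt_numeral Rp Rq, (rule P_cong; rule add.commute)+)
    then have braid: "word (alt m q p) v = word (alt m p q) v" for v
      by (simp only: P0[symmetric])
    have small: "k = 0 \<or> k = 1 \<or> k = 2 \<or> k = 3 \<or> k = 4 \<or> k = 5" if "k < m" for k
      using that cs by auto
    have "\<exists>x y. word (alt k q p) (P 0 (-1) 0) = P 0 x y \<and> x \<le> 0 \<and> y \<le> 0" if "k < m" for k
      using small[OF that] cs that by (elim disjE conjE)
        (simp_all add: alt_numeral Rp Rq, (rule exI, rule exI, rule conjI, rule refl, simp)+)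
    then have "\<exists>x y. x \<ge> 0 \<and> y \<ge> 0 \<and> word (alt k q p) (\<alpha> p) = x *\<^sub>R \<alpha> p + y *\<^sub>R \<alpha> q" if "k < m" for k
      using pos that unfolding Pp by metis
    then show ?thesis using braid cs by (intro disjI2 exI[of _ m]) auto
  qed
qed

subsection \<open>Length and positivity\<close>

text \<open>Factorization of w along a coset of the rank two subgroup: taking k maximal leaves a
  remainder v with descents at neither p nor q. The stripped word ends in q because w has a descent
  there.\<close>

lemma strip_alternating:
  assumes w: "w \<in> weyl" and p: "p \<in> {1..r}" and q: "q \<in> {1..r}"
    and less: "len (w \<circ> reflect (\<alpha> q)) < len w"
  obtains k v where "1 \<le> k" "v \<in> weyl" "w = v \<circ> word (alt k q p)" "len w = len v + k"
    "len (v \<circ> reflect (\<alpha> p)) \<ge> len v" "len (v \<circ> reflect (\<alpha> q)) \<ge> len v"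
proof -
  define Q where "Q = (\<lambda>k. \<exists>v\<in>weyl. w = v \<circ> word (alt k q p) \<and> len w = len v + k)"
  define k where "k = (GREATEST k. Q k)"
  have bound: "Q k \<Longrightarrow> k \<le> len w" for k unfolding Q_def by auto
  have wq: "w \<circ> reflect (\<alpha> q) \<in> weyl" using weyl_comp[OF w simple_refl_weyl[OF q]] .
  have "len w \<le> len (w \<circ> reflect (\<alpha> q)) + 1"
    using len_right_le[OF wq q] by (simp add: comp_simple_refl_refl q del: atLeastAtMost_iff)
  with less have "len w = len (w \<circ> reflect (\<alpha> q)) + 1" by linarith
  then have Q1: "Q 1" unfolding Q_def
    by (intro bexI[OF _ wq]) (simp add: alt_numeral comp_simple_refl_refl q del: atLeastAtMost_iff)
  have Qk: "Q k" unfolding k_def by (rule GreatestI_nat[of Q 1]) (use Q1 bound in auto)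
  have k1: "1 \<le> k" unfolding k_def by (rule Greatest_le_nat[of Q]) (use Q1 bound in auto)
  have nQ: "\<not> Q (Suc k)"
  proof
    assume "Q (Suc k)"
    then have "Suc k \<le> k" unfolding k_def by (rule Greatest_le_nat[of Q]) (use bound in auto)
    then show False by simp
  qed
  obtain v where v: "v \<in> weyl" "w = v \<circ> word (alt k q p)" "len w = len v + k"
    using Qk unfolding Q_def by blast
  have sub: "set (alt j q p) \<subseteq> {1..r}" for j using set_alt[of j q p] p q by blast
  obtain j where j: "k = Suc j" using k1 by (cases k) auto
  \<comment> \<open>x is the first letter of the stripped word and y the other one. A descent of v
    at x would cancel that letter and make w too short; a descent at y would lengthen the stripped
    word, against the maximality of k.\<close>
  define x where "x = (if even j then q else p)"
  define y where "y = (if even j then p else q)"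
  have xy: "x \<in> {1..r}" "y \<in> {1..r}" using p q by (auto simp: x_def y_def)
  have altk: "alt k q p = x # alt j q p" "alt (Suc k) q p = y # alt k q p"
    using alt_Cons[of j q p] alt_Cons[of k q p] unfolding j x_def y_def by auto
  have "w = (v \<circ> reflect (\<alpha> x)) \<circ> word (alt j q p)" unfolding v(2) altk by (simp add: comp_assoc)
  then have "len w \<le> len (v \<circ> reflect (\<alpha> x)) + j"
    using len_comp_word_le[OF weyl_comp[OF v(1) simple_refl_weyl[OF xy(1)]] sub[of j]] by simp
  then have X: "len (v \<circ> reflect (\<alpha> x)) \<ge> len v" using v(3) j by simp
  have Y: "len (v \<circ> reflect (\<alpha> y)) \<ge> len v"
  proof (rule ccontr)
    assume *: "\<not> len (v \<circ> reflect (\<alpha> y)) \<ge> len v"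
    have vy: "v \<circ> reflect (\<alpha> y) \<in> weyl" using weyl_comp[OF v(1) simple_refl_weyl[OF xy(2)]] .
    have "len v \<le> len (v \<circ> reflect (\<alpha> y)) + 1"
      using len_right_le[OF vy xy(2)] by (simp add: comp_simple_refl_refl xy del: atLeastAtMost_iff)
    with * have "len w = len (v \<circ> reflect (\<alpha> y)) + Suc k" using v(3) by linarith
    moreover have "w = (v \<circ> reflect (\<alpha> y)) \<circ> word (alt (Suc k) q p)"
    proof -
      have "(v \<circ> reflect (\<alpha> y)) \<circ> word (y # alt k q p) =
          (v \<circ> reflect (\<alpha> y) \<circ> reflect (\<alpha> y)) \<circ> word (alt k q p)" by (simp add: comp_assoc)
      then show ?thesis unfolding altk(2) v(2) using xy by (simp only: comp_simple_refl_refl)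
    qed
    ultimately have "Q (Suc k)" unfolding Q_def using vy by blast
    with nQ show False ..
  qed
  have "len (v \<circ> reflect (\<alpha> p)) \<ge> len v" "len (v \<circ> reflect (\<alpha> q)) \<ge> len v"
    using X Y unfolding x_def y_def by (auto split: if_splits)
  then show thesis using that k1 v by blast
qed

text \<open>Reduction to rank two: by induction the shorter factor v of w sends both simple roots of
  the dihedral part into the cone, so it suffices that the alternating factor keeps \<alpha> p in
  the cone of these two roots.\<close>

lemma nonneg_if_len_ascent:
  assumes "w \<in> weyl" "p \<in> {1..r}" "len (w \<circ> reflect (\<alpha> p)) \<ge> len w"
  shows "nonneg (w (\<alpha> p))"
  using assms
proof (induction "len w" arbitrary: w p rule: less_induct)
  case less
  note p = less.prems(2)
  show ?case
  proof (cases "len w = 0")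
    case True
    then have "w = id" using len_0 less.prems(1) by blast
    then show ?thesis using nonneg_simple[OF p] by simp
  next
    case False
    obtain qs where qs: "set qs \<subseteq> {1..r}" "w = word qs" "length qs = len w"
      using reduced_word[OF less.prems(1)] .
    with False obtain us q where us: "qs = us @ [q]" by (metis length_0_conv rev_exhaust)
    have q: "q \<in> {1..r}" using qs us by auto
    have "w \<circ> reflect (\<alpha> q) = word us"
      unfolding qs(2) us using comp_simple_refl_refl[OF q] by (simp add: word_append)
    then have qless: "len (w \<circ> reflect (\<alpha> q)) < len w"
      using len_word_le[of us] qs us by auto
    then have pq: "p \<noteq> q" using less.prems by auto
    obtain k v where v: "1 \<le> k" "v \<in> weyl" "w = v \<circ> word (alt k q p)" "len w = len v + k"
      "len (v \<circ> reflect (\<alpha> p)) \<ge> len v" "len (v \<circ> reflect (\<alpha> q)) \<ge> len v"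
      using strip_alternating[OF less.prems(1) p q qless] .
    have vpos: "nonneg (v (\<alpha> p))" "nonneg (v (\<alpha> q))"
      using less.hyps v p q by auto
    have lin: "linear v" using weyl_linear_isometry(1)[OF v(2)] .
    have pos: "nonneg (w (\<alpha> p))"
      if "\<exists>x y. x \<ge> 0 \<and> y \<ge> 0 \<and> word (alt k q p) (\<alpha> p) = x *\<^sub>R \<alpha> p + y *\<^sub>R \<alpha> q"
      using that vpos unfolding v(3)
      by (auto simp: linear_add[OF lin] linear_cmul[OF lin] intro!: nonneg_add nonneg_scale)
    show ?thesis
    proof (rule ccontr)
      \<comment> \<open>Only k \<ge> m is left, with m the braid length. The braid relation rewrites
        the last m letters to end in p, so w s_p is v followed by k - 1 letters and would be shorter
        than w.\<close>
      assume neg: "\<not> nonneg (w (\<alpha> p))"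
      with pos dihedral[OF p q pq] obtain m where m: "m \<ge> 1" "word (alt m q p) = word (alt m p q)" "\<not> k < m"
        by meson
      obtain us where us: "length us = k - m" "set us \<subseteq> {q, p}" "alt k q p = us @ alt m q p"
        using alt_split[of "k - m" q p m] m by auto
      obtain n where n: "m = Suc n" using m by (cases m) auto
      define ys where "ys = us @ alt n q p"
      have "w = v \<circ> word ys \<circ> reflect (\<alpha> p)"
        unfolding v(3) us(3) word_append m(2) unfolding n ys_def alt.simps word_append word_simps
        by (simp only: comp_assoc comp_id)
      then have "w \<circ> reflect (\<alpha> p) = v \<circ> word ys"
        using comp_simple_refl_refl[OF p] by simp
      moreover have "set ys \<subseteq> {1..r}" using us set_alt[of n q p] p q unfolding ys_def set_append by blast
      ultimately have "len (w \<circ> reflect (\<alpha> p)) \<le> len v + length ys"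
        using len_comp_word_le v by metis
      moreover have "length ys < k" using us n m unfolding ys_def by simp
      ultimately show False using v less.prems by linarith
    qed
  qed
qed

lemma weyl_simple_root: "w \<in> weyl \<Longrightarrow> p \<in> {1..r} \<Longrightarrow> w (\<alpha> p) \<in> roots"
  unfolding roots_def by blast

lemma weyl_roots: "w \<in> weyl \<Longrightarrow> a \<in> roots \<Longrightarrow> w a \<in> roots"
  unfolding roots_def by clarsimp (metis comp_apply weyl_comp)

lemma weyl_minus: "w \<in> weyl \<Longrightarrow> w (- a) = - w a"
  using linear_neg weyl_linear_isometry(1) by blast

lemma root_norm_pos: "a \<in> roots \<Longrightarrow> \<langle>a, a\<rangle> > 0"
  unfolding roots_def using weyl_linear_isometry(2) simple_pos by fastforce

lemma root_norm_nz: "a \<in> roots \<Longrightarrow> \<langle>a, a\<rangle> \<noteq> 0"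
  using root_norm_pos by fastforce

lemma root_nonzero: "a \<in> roots \<Longrightarrow> a \<noteq> 0"
  using root_norm_nz[of a] by auto

lemma minus_roots: "a \<in> roots \<Longrightarrow> - a \<in> roots"
  using weyl_roots[OF refl_root_weyl, of a a] reflect_self[OF root_norm_nz, of a] by simp

text \<open>\<open>nonneg_if_len_ascent\<close> applies to w or to w s_p, whichever does not get
  shorter, and these two send \<alpha> p to opposite roots.\<close>

lemma root_pos_or_neg: "a \<in> roots \<Longrightarrow> a \<in> pos_roots \<or> - a \<in> pos_roots"
proof -
  assume a: "a \<in> roots"
  then obtain w p where w: "w \<in> weyl" "p \<in> {1..r}" "a = w (\<alpha> p)" unfolding roots_def by blast
  have ws: "w \<circ> reflect (\<alpha> p) \<in> weyl" using weyl_comp[OF w(1) simple_refl_weyl[OF w(2)]] .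
  have neg: "(w \<circ> reflect (\<alpha> p)) (\<alpha> p) = - a"
    using w simple_reflect_self weyl_minus by simp
  have "nonneg a \<or> nonneg (- a)"
  proof (cases "len (w \<circ> reflect (\<alpha> p)) \<ge> len w")
    case True
    then show ?thesis using nonneg_if_len_ascent w by blast
  next
    case False
    then show ?thesis using nonneg_if_len_ascent[OF ws w(2)] neg
      by (simp add: comp_simple_refl_refl w del: atLeastAtMost_iff)
  qed
  then show ?thesis using a minus_roots by (auto simp: pos_roots_nonneg)
qed

lemma pos_not_neg: "a \<in> pos_roots \<Longrightarrow> - a \<notin> pos_roots"
  using nonneg_antisym root_nonzero by (auto simp: pos_roots_nonneg)

lemma pos_roots_roots: "a \<in> pos_roots \<Longrightarrow> a \<in> roots"
  by (simp add: pos_roots_nonneg)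

lemma not_pos_iff: "a \<in> roots \<Longrightarrow> a \<notin> pos_roots \<longleftrightarrow> - a \<in> pos_roots"
  using root_pos_or_neg pos_not_neg by blast

lemma simple_pos_root: "p \<in> {1..r} \<Longrightarrow> \<alpha> p \<in> pos_roots"
  by (simp add: pos_roots_nonneg simple_in_roots nonneg_simple del: atLeastAtMost_iff)

text \<open>Reflections subtract Cartan integer multiples of simple roots. Integrality is used to
  bound the height of a positive root below by 1 and to exclude proper multiples of simple
  roots.\<close>

lemma root_int_coeffs: "a \<in> roots \<Longrightarrow> \<exists>c::nat \<Rightarrow> int. a = (\<Sum>p\<in>{1..r}. of_int (c p) *\<^sub>R \<alpha> p)"
proof -
  have "\<exists>c::nat \<Rightarrow> int. w (\<alpha> p) = (\<Sum>p\<in>{1..r}. of_int (c p) *\<^sub>R \<alpha> p)" if "w \<in> weyl" "p \<in> {1..r}" for w p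
    using that(1) unfolding weyl_def
  proof (induction rule: refl_group.induct)
    case refl_group_id
    have "(\<Sum>q\<in>{1..r}. of_int (if q = p then 1 else 0) *\<^sub>R \<alpha> q) = (\<Sum>q\<in>{1..r}. if q = p then \<alpha> q else 0)"
      by (intro sum.cong) auto
    then show ?case using that(2) by (intro exI[of _ "\<lambda>q. if q = p then 1 else 0"]) simp
  next
    case (refl_group_step w a)
    then obtain c :: "nat \<Rightarrow> int" and q where c: "w (\<alpha> p) = (\<Sum>p\<in>{1..r}. of_int (c p) *\<^sub>R \<alpha> p)"
      and q: "q \<in> {1..r}" "a = \<alpha> q" by blast
    have "\<langle>w (\<alpha> p), coroot a\<rangle> \<in> \<int>"
      unfolding c q(2) pairing_sum using q(1) cartan_int' 
      by (intro Ints_sum) (auto simp: pairing_simps simp del: atLeastAtMost_iff)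
    then obtain n where n: "\<langle>w (\<alpha> p), coroot a\<rangle> = of_int n" by (auto elim: Ints_cases)
    have "(\<Sum>s\<in>{1..r}. of_int (c s - (if s = q then n else 0)) *\<^sub>R \<alpha> s) =
       (\<Sum>s\<in>{1..r}. of_int (c s) *\<^sub>R \<alpha> s - (if s = q then of_int n *\<^sub>R \<alpha> s else 0))"
      by (intro sum.cong) (auto simp: scaleR_diff_left)
    also have "\<dots> = w (\<alpha> p) - of_int n *\<^sub>R \<alpha> q"
      using q by (simp add: sum_subtractf c)
    also have "\<dots> = (reflect a \<circ> w) (\<alpha> p)" using n q by (simp add: reflect_def)
    finally show ?case by (intro exI[of _ "\<lambda>s. c s - (if s = q then n else 0)"]) simp
  qed
  then show "a \<in> roots \<Longrightarrow> ?thesis" unfolding roots_def by blast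
qed

lemma linear_sum_simple:
  "linear f \<Longrightarrow> f (\<Sum>p\<in>{1..r}. c p *\<^sub>R \<alpha> p) = (\<Sum>p\<in>{1..r}. c p *\<^sub>R f (\<alpha> p))"
  by (simp add: linear_sum linear_cmul)

lemma pos_root_ht: "a \<in> pos_roots \<Longrightarrow> ht a \<ge> 1"
proof -
  assume a: "a \<in> pos_roots"
  obtain c where c: "\<forall>p\<in>{1..r}. c p \<ge> 0" "a = (\<Sum>p\<in>{1..r}. c p *\<^sub>R \<alpha> p)"
    using a unfolding pos_roots_def by blast
  obtain d :: "nat \<Rightarrow> int" where d: "a = (\<Sum>p\<in>{1..r}. of_int (d p) *\<^sub>R \<alpha> p)"
    using root_int_coeffs pos_roots_roots[OF a] by blast
  have cd: "c p = of_int (d p)" if "p \<in> {1..r}" for p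
    using simple_coeff_eq[OF _ that, of c "\<lambda>p. of_int (d p)"] c d by simp
  have "ht a = (\<Sum>p\<in>{1..r}. of_int (d p))"
    unfolding d linear_sum_simple[OF linear_ht] using ht_simple by (intro sum.cong) auto
  also have "\<dots> = of_int (\<Sum>p\<in>{1..r}. d p)" by simp
  finally have ht: "ht a = of_int (\<Sum>p\<in>{1..r}. d p)" .
  have d0: "d p \<ge> 0" if "p \<in> {1..r}" for p using c(1) cd that by fastforce
  have "(\<Sum>p\<in>{1..r}. d p) \<noteq> 0"
  proof
    assume "(\<Sum>p\<in>{1..r}. d p) = 0"
    then have "\<forall>p\<in>{1..r}. d p = 0" using d0 by (subst (asm) sum_nonneg_eq_0_iff) auto
    then have "a = 0" unfolding d by simp
    then show False using root_nonzero pos_roots_roots[OF a] by blast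
  qed
  moreover have "(\<Sum>p\<in>{1..r}. d p) \<ge> 0" using d0 by (intro sum_nonneg) auto
  ultimately show ?thesis unfolding ht by (simp flip: of_int_sum)
qed

text \<open>The reflection changes only the coefficient at p, so a root that becomes negative has no
  other nonzero coefficient and is a multiple of \<alpha> p; the rest of the proof shows that the
  multiple is \<alpha> p itself.\<close>

lemma simple_reflect_pos:
  assumes p: "p \<in> {1..r}" and a: "a \<in> pos_roots" "a \<noteq> \<alpha> p"
  shows "reflect (\<alpha> p) a \<in> pos_roots"
proof (rule ccontr)
  assume neg: "reflect (\<alpha> p) a \<notin> pos_roots"
  have ar: "a \<in> roots" using a pos_roots_roots by blast
  then have "reflect (\<alpha> p) a \<in> roots" using weyl_roots simple_refl_weyl[OF p] by blast
  then have "- reflect (\<alpha> p) a \<in> pos_roots" using neg root_pos_or_neg by blast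
  then obtain d where d: "\<forall>p\<in>{1..r}. d p \<ge> 0" "- reflect (\<alpha> p) a = (\<Sum>p\<in>{1..r}. d p *\<^sub>R \<alpha> p)"
    unfolding pos_roots_def by blast
  obtain c where c: "\<forall>p\<in>{1..r}. c p \<ge> 0" "a = (\<Sum>p\<in>{1..r}. c p *\<^sub>R \<alpha> p)"
    using a unfolding pos_roots_def by blast
  define n where "n = \<langle>a, coroot (\<alpha> p)\<rangle>"
  have "(\<Sum>q\<in>{1..r}. (if q = p then n - c p else - c q) *\<^sub>R \<alpha> q) = 
      (\<Sum>q\<in>{1..r}. (if q = p then n *\<^sub>R \<alpha> q else 0) - c q *\<^sub>R \<alpha> q)"
    by (intro sum.cong) (auto simp: scaleR_diff_left)
  also have "\<dots> = - reflect (\<alpha> p) a"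
    using p unfolding reflect_def n_def[symmetric] by (simp add: sum_subtractf c(2))
  finally have "(\<Sum>q\<in>{1..r}. (if q = p then n - c p else - c q) *\<^sub>R \<alpha> q) = (\<Sum>p\<in>{1..r}. d p *\<^sub>R \<alpha> p)"
    using d(2) by simp
  from simple_coeff_eq[OF this] have c0: "c q = 0" if "q \<in> {1..r}" "q \<noteq> p" for q
    using that c(1) d(1) by fastforce
  have "a = (\<Sum>q\<in>{1..r}. if q = p then c p *\<^sub>R \<alpha> p else 0)"
    unfolding c(2) using c0 by (intro sum.cong) auto
  then have ac: "a = c p *\<^sub>R \<alpha> p" using p by simp
  obtain m :: "nat \<Rightarrow> int" where m: "a = (\<Sum>p\<in>{1..r}. of_int (m p) *\<^sub>R \<alpha> p)"
    using root_int_coeffs ar by blast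
  have cm: "c p = of_int (m p)" using simple_coeff_eq[of c "\<lambda>p. of_int (m p)", OF _ p] c m by simp
  \<comment> \<open>So far a is an integer multiple of \<alpha> p. Moving a back to a simple root
    \<alpha> q shows that this integer divides 1, since v (\<alpha> p) has integer coefficients as
    well.\<close>
  obtain w q where w: "w \<in> weyl" "q \<in> {1..r}" "a = w (\<alpha> q)" using ar unfolding roots_def by blast
  obtain v where v: "v \<in> weyl" "v \<circ> w = id" using weyl_inverse[OF w(1)] by blast
  have "\<alpha> q = v a" using v(2) unfolding w(3) by (simp add: fun_eq_iff)
  then have aq: "\<alpha> q = c p *\<^sub>R v (\<alpha> p)"
    using ac linear_cmul[OF weyl_linear_isometry(1)[OF v(1)]] by metis
  obtain e :: "nat \<Rightarrow> int" where e: "v (\<alpha> p) = (\<Sum>p\<in>{1..r}. of_int (e p) *\<^sub>R \<alpha> p)"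
    using root_int_coeffs weyl_simple_root[OF v(1) p] by blast
  have "(\<Sum>s\<in>{1..r}. (c p * of_int (e s)) *\<^sub>R \<alpha> s) = \<alpha> q"
    unfolding aq e by (simp add: scaleR_sum_right)
  also have "\<dots> = (\<Sum>s\<in>{1..r}. (if s = q then 1 else 0) *\<^sub>R \<alpha> s)"
  proof -
    have "(\<Sum>s\<in>{1..r}. (if s = q then 1 else 0) *\<^sub>R \<alpha> s) = (\<Sum>s\<in>{1..r}. if s = q then \<alpha> s else 0)"
      by (intro sum.cong) auto
    then show ?thesis using w(2) by simp
  qed
  finally have "c p * of_int (e q) = 1" using simple_coeff_eq w(2) by fastforce
  then have "m p * e q = 1" unfolding cm by (metis of_int_eq_1_iff of_int_mult)
  moreover have "m p \<ge> 0" using c(1) p cm by fastforce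
  ultimately have "m p = 1" using zmult_eq_1_iff by auto
  then show False using ac cm a(2) by simp
qed

text \<open>The strong exchange property: multiplying by the reflection in a deletes the letter at
  which the image of a turns negative, where that image is a simple root.\<close>

lemma pos_conj_len_less:
  assumes "set ps \<subseteq> {1..r}" "a \<in> pos_roots" "word ps a \<notin> pos_roots"
  shows "\<exists>qs. set qs \<subseteq> {1..r} \<and> length qs < length ps \<and> word ps \<circ> reflect a = word qs"
  using assms
proof (induction ps)
  case (Cons p ps)
  have p: "p \<in> {1..r}" and ps: "set ps \<subseteq> {1..r}" using Cons.prems by auto
  have wps: "word ps \<in> weyl" using word_weyl ps by blast
  show ?case
  proof (cases "word ps a \<in> pos_roots")
    case False
    then obtain qs where qs: "set qs \<subseteq> {1..r}" "length qs < length ps" "word ps \<circ> reflect a = word qs"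
      using Cons ps by blast
    have "word (p # ps) \<circ> reflect a = word (p # qs)"
      unfolding word_simps comp_assoc qs(3) ..
    moreover have "set (p # qs) \<subseteq> {1..r}" "length (p # qs) < length (p # ps)" using p qs by auto
    ultimately show ?thesis by blast
  next
    case True
    then have eq: "word ps a = \<alpha> p"
      using simple_reflect_pos[OF p True] Cons.prems(3) by auto
    have "reflect (\<alpha> p) (word ps v) = word ps (reflect a v)" for v
      using weyl_linear_isometry[OF wps]
      by (simp add: reflect_def coroot_def pairing_simps linear_diff linear_cmul flip: eq)
    then have "word (p # ps) \<circ> reflect a = word ps \<circ> (reflect a \<circ> reflect a)"
      by (simp add: fun_eq_iff)
    then have "word (p # ps) \<circ> reflect a = word ps"
      by (simp only: refl_refl[OF root_norm_nz[OF pos_roots_roots[OF Cons.prems(2)]]] comp_id)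
    then show ?thesis using ps by (intro exI[of _ ps]) (simp only: list.size, simp)
  qed
qed simp

lemma weyl_conj_reflect: "w \<in> weyl \<Longrightarrow> reflect (w a) \<circ> w = w \<circ> reflect a"
  using weyl_linear_isometry[of w]
  by (simp add: fun_eq_iff reflect_def coroot_def pairing_simps linear_diff linear_cmul)

lemma root_refl_refl: "a \<in> roots \<Longrightarrow> reflect a (reflect a v) = v"
  using refl_refl[OF root_norm_nz] by (simp add: fun_eq_iff)

lemma len_reflect_less:
  assumes "w \<in> weyl" "a \<in> pos_roots" "w a \<notin> pos_roots"
  shows "len (w \<circ> reflect a) < len w"
proof -
  obtain ps where ps: "set ps \<subseteq> {1..r}" "w = word ps" "length ps = len w"
    using reduced_word[OF assms(1)] .
  then show ?thesis using pos_conj_len_less[of ps a] len_word_le assms by fastforce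
qed

lemma len_reflect_greater:
  assumes "w \<in> weyl" "a \<in> pos_roots" "w a \<in> pos_roots"
  shows "len (w \<circ> reflect a) > len w"
proof -
  have a: "a \<in> roots" using assms pos_roots_roots by blast
  have "(w \<circ> reflect a) a \<notin> pos_roots"
    using reflect_self[OF root_norm_nz[OF a]] weyl_minus[OF assms(1)] pos_not_neg[OF assms(3)] by simp
  from len_reflect_less[OF weyl_comp[OF assms(1) refl_root_weyl[OF a]] assms(2) this]
  show ?thesis by (simp only: comp_assoc refl_refl[OF root_norm_nz[OF a]] comp_id)
qed

lemma len_reflect_less_iff:
  "w \<in> weyl \<Longrightarrow> a \<in> pos_roots \<Longrightarrow> len w < len (w \<circ> reflect a) \<longleftrightarrow> w a \<in> pos_roots"
  using len_reflect_less len_reflect_greater by (meson order_less_asym)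

lemma len_left_reflect_less_iff:
  assumes "w \<in> weyl" "b \<in> roots" "w b \<in> pos_roots"
  shows "len w < len (reflect (w b) \<circ> w) \<longleftrightarrow> b \<in> pos_roots"
proof (cases "b \<in> pos_roots")
  case True
  then show ?thesis using len_reflect_greater weyl_conj_reflect assms by simp
next
  case False
  then have b: "- b \<in> pos_roots" using not_pos_iff assms by blast
  moreover have "w (- b) \<notin> pos_roots" using pos_not_neg[OF assms(3)] weyl_minus[OF assms(1)] by simp
  ultimately have "len (w \<circ> reflect (- b)) < len w" using len_reflect_less assms by blast
  then show ?thesis using False weyl_conj_reflect[OF assms(1)] by (simp add: reflect_uminus)
qed

lemma len_simple_right:
  assumes "w \<in> weyl" "p \<in> {1..r}"
  shows "len (w \<circ> reflect (\<alpha> p)) = (if w (\<alpha> p) \<in> pos_roots then len w + 1 else len w - 1)"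
    "w (\<alpha> p) \<notin> pos_roots \<Longrightarrow> len w \<ge> 1"
proof -
  have ws: "w \<circ> reflect (\<alpha> p) \<in> weyl" using weyl_comp simple_refl_weyl assms by blast
  have "len w \<le> len (w \<circ> reflect (\<alpha> p)) + 1"
    using len_right_le[OF ws assms(2)] by (simp add: comp_simple_refl_refl assms del: atLeastAtMost_iff)
  then show "len (w \<circ> reflect (\<alpha> p)) = (if w (\<alpha> p) \<in> pos_roots then len w + 1 else len w - 1)"
    using len_right_le[OF assms] len_reflect_less[OF assms(1) simple_pos_root[OF assms(2)]]
      len_reflect_greater[OF assms(1) simple_pos_root[OF assms(2)]] by auto
  show "len w \<ge> 1" if "w (\<alpha> p) \<notin> pos_roots"
    using len_reflect_less[OF assms(1) simple_pos_root[OF assms(2)] that] by simp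
qed

lemma len_simple_left:
  assumes "w \<in> weyl" "p \<in> {1..r}" "b \<in> roots" "w b = \<alpha> p"
  shows "b \<in> pos_roots \<Longrightarrow> len (reflect (\<alpha> p) \<circ> w) = len w + 1"
    "b \<notin> pos_roots \<Longrightarrow> len (reflect (\<alpha> p) \<circ> w) + 1 = len w"
proof -
  have "reflect (\<alpha> p) \<circ> w = w \<circ> reflect b" using weyl_conj_reflect assms by metis
  have sw: "reflect (\<alpha> p) \<circ> w \<in> weyl" using weyl_comp simple_refl_weyl assms by blast
  have le: "len w \<le> len (reflect (\<alpha> p) \<circ> w) + 1"
    using len_left_le[OF sw assms(2)] by (simp add: simple_refl_refl_comp assms del: atLeastAtMost_iff)
  show "b \<in> pos_roots \<Longrightarrow> len (reflect (\<alpha> p) \<circ> w) = len w + 1"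
    using len_left_le[OF assms(1,2)] len_left_reflect_less_iff[OF assms(1,3)] simple_pos_root[OF assms(2)] assms(4)
    by fastforce
  show "len (reflect (\<alpha> p) \<circ> w) + 1 = len w" if b: "b \<notin> pos_roots"
  proof -
    have nb: "- b \<in> pos_roots" using b not_pos_iff assms by blast
    have "w (- b) \<notin> pos_roots"
      using pos_not_neg[OF simple_pos_root[OF assms(2)]] weyl_minus[OF assms(1)] assms(4) by simp
    then have "len (w \<circ> reflect (- b)) < len w" using len_reflect_less[OF assms(1) nb] by blast
    then show ?thesis using le \<open>reflect (\<alpha> p) \<circ> w = w \<circ> reflect b\<close> by (simp add: reflect_uminus)
  qed
qed

text \<open>The lifting property of the Bruhat order: a cover that is not left multiplication by
  a simple reflection cannot create a left descent.\<close>

lemma cover_keeps_left_ascent: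
  assumes w: "w \<in> weyl" and p: "p \<in> {1..r}" and a: "a \<in> roots" "w a = \<alpha> p" "a \<in> pos_roots"
    and b: "b \<in> pos_roots" "b \<noteq> a" and cover: "len (w \<circ> reflect b) = len w + 1"
  shows "reflect b a \<in> pos_roots"
proof (rule ccontr)
  assume neg: "reflect b a \<notin> pos_roots"
  let ?s = "reflect (\<alpha> p)"
  have br: "b \<in> roots" using b pos_roots_roots by blast
  have wb: "w b \<in> pos_roots" using len_reflect_less_iff[OF w b(1)] cover by simp
  have w': "w \<circ> reflect b \<in> weyl" using weyl_comp[OF w refl_root_weyl[OF br]] .
  have sw: "?s \<circ> w \<in> weyl" using weyl_comp[OF simple_refl_weyl[OF p] w] .
  have "(w \<circ> reflect b) (reflect b a) = \<alpha> p" using root_refl_refl[OF br] a by simp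
  then have len': "len (?s \<circ> (w \<circ> reflect b)) + 1 = len (w \<circ> reflect b)"
    using len_simple_left(2)[OF w' p _ _ neg] weyl_roots[OF refl_root_weyl[OF br] a(1)] by simp
  have lens: "len (?s \<circ> w) = len w + 1" using len_simple_left(1)[OF w p a] .
  have "w b \<noteq> \<alpha> p"
  proof
    assume "w b = \<alpha> p"
    then have "w b = w a" using a by simp
    moreover obtain v where "v \<circ> w = id" using weyl_inverse[OF w] by blast
    ultimately have "b = a" by (metis comp_apply id_apply)
    then show False using b by simp
  qed
  then have "(?s \<circ> w) b \<in> pos_roots" using simple_reflect_pos[OF p wb] by simp
  then have "len ((?s \<circ> w) \<circ> reflect b) > len (?s \<circ> w)" using len_reflect_greater[OF sw b(1)] by simp
  then show False using len' lens cover by (simp add: comp_assoc)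
qed


lemma formal_sum_card:
  "formal_sum (X :: 'x set) (\<lambda>_. 1) wt \<nu> = int (card {x \<in> X. wt x = \<nu>})"
  unfolding formal_sum_def by simp

subsection \<open>The Weyl denominator\<close>

text \<open>Along a reduced word each letter subtracts a multiple, with coefficient at least 1, of a
  positive root, whose height is at least 1. For \<rho> this bound gives all the finiteness and
  uniqueness needed for the denominator.\<close>

lemma weyl_ht_le:
  assumes "w \<in> weyl" "\<And>p. p \<in> {1..r} \<Longrightarrow> \<langle>v, coroot (\<alpha> p)\<rangle> \<ge> 1"
  shows "ht (w v) \<le> ht v - len w"
  using assms(1)
proof (induction "len w" arbitrary: w)
  case 0
  then show ?case using len_0 by fastforce
next
  case (Suc n)
  obtain qs where qs: "set qs \<subseteq> {1..r}" "w = word qs" "length qs = len w"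
    using reduced_word[OF Suc.prems] .
  then obtain us q where us: "qs = us @ [q]" using Suc.hyps(2) by (metis length_0_conv nat.distinct(1) rev_exhaust)
  have q: "q \<in> {1..r}" and us': "set us \<subseteq> {1..r}" using qs us by auto
  define w' where "w' = word us"
  have w: "w = w' \<circ> reflect (\<alpha> q)" unfolding qs us w'_def by (simp add: word_append)
  have w': "w' \<in> weyl" using word_weyl us' unfolding w'_def by blast
  have "len w' \<le> n" using len_word_le[OF us'] qs us Suc.hyps(2) unfolding w'_def by simp
  moreover have "len w \<le> len w' + 1" unfolding w using len_right_le[OF w' q] .
  ultimately have n: "n = len w'" "len w = len w' + 1" using Suc.hyps(2) by linarith+
  have lin: "linear w'" using weyl_linear_isometry(1)[OF w'] .
  let ?c = "\<langle>v, coroot (\<alpha> q)\<rangle>"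
  have "w' (\<alpha> q) \<in> pos_roots"
    using len_reflect_less_iff[OF w' simple_pos_root[OF q]] n(2) w by simp
  then have "ht (w' (\<alpha> q)) \<ge> 1" by (rule pos_root_ht)
  then have "1 * 1 \<le> ?c * ht (w' (\<alpha> q))" using assms(2)[OF q] by (intro mult_mono) auto
  moreover have "w v = w' v - ?c *\<^sub>R w' (\<alpha> q)"
    unfolding w by (simp add: reflect_def linear_diff[OF lin] linear_cmul[OF lin])
  then have "ht (w v) = ht (w' v) - ?c * ht (w' (\<alpha> q))"
    by (simp add: linear_diff[OF linear_ht] linear_cmul[OF linear_ht])
  moreover have "ht (w' v) \<le> ht v - len w'" using Suc.hyps(1)[OF n(1) w'] .
  ultimately show ?case using n by simp
qed

lemma rho_coroot: "p \<in> {1..r} \<Longrightarrow> \<langle>\<rho>, coroot (\<alpha> p)\<rangle> = 1"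
  using rho by (simp add: coroot_def)

lemma weyl_rho_ht: "w \<in> weyl \<Longrightarrow> ht (w \<rho>) \<le> ht \<rho> - len w"
  by (rule weyl_ht_le) (auto simp: rho_coroot simp del: atLeastAtMost_iff)

text \<open>A nontrivial Weyl group element strictly lowers the height of \<rho>, so its stabilizer
  is trivial and the exponents of the denominator are pairwise distinct.\<close>

lemma weyl_rho_inj:
  assumes "w \<in> weyl" "w' \<in> weyl" "w \<rho> = w' \<rho>" shows "w = w'"
proof -
  obtain v where v: "v \<in> weyl" "v \<circ> w = id" "w \<circ> v = id" using weyl_inverse[OF assms(1)] by blast
  have "v \<circ> w' \<in> weyl" using weyl_comp v assms by blast
  moreover have "(v \<circ> w') \<rho> = \<rho>" using v(2) assms(3) by (metis comp_apply id_apply)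
  ultimately have "len (v \<circ> w') = 0" using weyl_rho_ht[of "v \<circ> w'"] by simp
  then have "v \<circ> w' = id" using len_0 \<open>v \<circ> w' \<in> weyl\<close> by blast
  then have "w \<circ> (v \<circ> w') = w" by simp
  then show ?thesis using v(3) by (simp only: comp_assoc[symmetric] id_comp)
qed

lemma weights_diff: "u \<in> weights \<Longrightarrow> v \<in> weights \<Longrightarrow> u - v \<in> weights"
  unfolding weights_def by (auto simp: pairing_simps)

lemma weyl_sum_0: "w \<in> weyl \<Longrightarrow> weyl_sum 0 (w \<rho> - \<rho>) = (-1) ^ len w"
proof -
  assume w: "w \<in> weyl"
  then have "{x \<in> weyl. x (0 + \<rho>) - \<rho> = w \<rho> - \<rho>} = {w}"
    using weyl_rho_inj by auto
  then show ?thesis unfolding weyl_sum_def formal_sum_def by simp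
qed

lemma weyl_sum_0_support: "weyl_sum 0 \<nu> \<noteq> 0 \<Longrightarrow> \<exists>w\<in>weyl. \<nu> = w \<rho> - \<rho>"
proof (rule ccontr)
  assume a: "weyl_sum 0 \<nu> \<noteq> 0" "\<not> (\<exists>w\<in>weyl. \<nu> = w \<rho> - \<rho>)"
  then have "{x \<in> weyl. x (0 + \<rho>) - \<rho> = \<nu>} = {}" by auto
  then have "weyl_sum 0 \<nu> = 0" unfolding weyl_sum_def formal_sum_def by (simp only: sum.empty)
  then show False using a by simp
qed

lemma char_ring_ht_bounded:
  assumes "c \<in> char_ring" shows "\<exists>B. \<forall>\<nu>. c \<nu> \<noteq> 0 \<longrightarrow> ht \<nu> \<le> B"
proof -
  have fin: "finite {\<nu>. c \<nu> \<noteq> 0 \<and> ht \<nu> > 0}" using assms unfolding char_ring_def by blast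
  then have "\<exists>B. \<forall>x\<in>ht ` {\<nu>. c \<nu> \<noteq> 0 \<and> ht \<nu> > 0}. x \<le> B"
    using bdd_above_finite[of "ht ` {\<nu>. c \<nu> \<noteq> 0 \<and> ht \<nu> > 0}"] unfolding bdd_above_def by blast
  then obtain B where B: "\<And>\<nu>. c \<nu> \<noteq> 0 \<Longrightarrow> ht \<nu> > 0 \<Longrightarrow> ht \<nu> \<le> B" by blast
  have "c \<nu> \<noteq> 0 \<Longrightarrow> ht \<nu> \<le> max B 0" for \<nu> using B[of \<nu>] by fastforce
  then show ?thesis by blast
qed

text \<open>The heights in the support of c are bounded above, which turns into a bound on the
  length of w by \<open>weyl_rho_ht\<close>.\<close>

lemma finite_char_mult_support:
  assumes "c \<in> char_ring" shows "finite {w \<in> weyl. c (\<nu> - (w \<rho> - \<rho>)) \<noteq> 0}"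
proof -
  obtain B where B: "\<And>\<nu>. c \<nu> \<noteq> 0 \<Longrightarrow> ht \<nu> \<le> B" using char_ring_ht_bounded[OF assms] by blast
  have "len w \<le> nat \<lceil>B - ht \<nu>\<rceil>" if w: "w \<in> weyl" "c (\<nu> - (w \<rho> - \<rho>)) \<noteq> 0" for w
  proof -
    have "ht \<nu> - ht (w \<rho>) + ht \<rho> \<le> B"
      using B[OF w(2)] by (simp add: linear_diff[OF linear_ht])
    then have "real (len w) \<le> B - ht \<nu>" using weyl_rho_ht[OF w(1)] by linarith
    then show ?thesis by linarith
  qed
  then show ?thesis by (intro finite_subset[OF _ finite_weyl_len_le[of "nat \<lceil>B - ht \<nu>\<rceil>"]]) auto
qed

text \<open>\<open>A\<close> may be any finite superset of the support, so that two series can be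
  expanded over a common index set.\<close>

lemma char_mult_weyl_sum:
  assumes "finite A" "A \<subseteq> weyl" "{w \<in> weyl. c (\<nu> - (w \<rho> - \<rho>)) \<noteq> 0} \<subseteq> A"
  shows "char_mult (weyl_sum 0) c \<nu> = (\<Sum>w\<in>A. (-1) ^ len w * c (\<nu> - (w \<rho> - \<rho>)))"
proof -
  let ?f = "\<lambda>w. w \<rho> - \<rho>" and ?A = "{w \<in> weyl. c (\<nu> - (w \<rho> - \<rho>)) \<noteq> 0}"
  have eq: "{\<mu>. weyl_sum 0 \<mu> \<noteq> 0 \<and> c (\<nu> - \<mu>) \<noteq> 0} = ?f ` ?A"
    using weyl_sum_0_support weyl_sum_0 by (auto; force)
  have inj: "inj_on ?f ?A" by (rule inj_onI) (use weyl_rho_inj in auto)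
  have "char_mult (weyl_sum 0) c \<nu> = (\<Sum>w\<in>?A. weyl_sum 0 (?f w) * c (\<nu> - ?f w))"
    unfolding char_mult_def eq sum.reindex[OF inj] by simp
  also have "\<dots> = (\<Sum>w\<in>?A. (-1) ^ len w * c (\<nu> - ?f w))"
    by (intro sum.cong) (auto simp: weyl_sum_0)
  also have "\<dots> = (\<Sum>w\<in>A. (-1) ^ len w * c (\<nu> - (w \<rho> - \<rho>)))"
    using assms by (intro sum.mono_neutral_left) auto
  finally show ?thesis .
qed

text \<open>The denominator is 1 plus terms of strictly smaller height, so at a weight of greatest
  height where c and d differ the two products differ by the same amount. This uniqueness justifies
  the definite description in \<open>weyl_char\<close>.\<close>

lemma char_mult_weyl_sum_inject:
  assumes c: "c \<in> char_ring" and d: "d \<in> char_ring"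
    and eq: "char_mult (weyl_sum 0) c = char_mult (weyl_sum 0) d"
  shows "c = d"
proof (rule ccontr)
  assume "c \<noteq> d"
  then obtain \<nu>0 where \<nu>0: "c \<nu>0 \<noteq> d \<nu>0" by (auto simp: fun_eq_iff)
  \<comment> \<open>The cutoff just below a known difference makes the set finite and nonempty, so
    that a greatest height exists.\<close>
  define N where "N = {\<nu>. c \<nu> \<noteq> d \<nu> \<and> ht \<nu> > ht \<nu>0 - 1}"
  have fin: "finite N"
  proof (rule finite_subset)
    show "N \<subseteq> {\<nu>. c \<nu> \<noteq> 0 \<and> ht \<nu> > ht \<nu>0 - 1} \<union> {\<nu>. d \<nu> \<noteq> 0 \<and> ht \<nu> > ht \<nu>0 - 1}"
      unfolding N_def by auto
    show "finite \<dots>" using c d unfolding char_ring_def by blast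
  qed
  have "\<nu>0 \<in> N" using \<nu>0 unfolding N_def by simp
  then have hN: "Max (ht ` N) \<in> ht ` N" using fin by (intro Max_in) auto
  then obtain \<nu> where \<nu>: "\<nu> \<in> N" "ht \<nu> = Max (ht ` N)" by (metis imageE)
  have top: "c \<nu>' = d \<nu>'" if "ht \<nu>' > ht \<nu>" for \<nu>'
  proof (rule ccontr)
    assume "c \<nu>' \<noteq> d \<nu>'"
    then have "\<nu>' \<in> N" using that \<nu>(1) unfolding N_def by simp
    then have "ht \<nu>' \<le> Max (ht ` N)" using fin by simp
    then show False using that \<nu>(2) by simp
  qed
  define A where "A = {w \<in> weyl. c (\<nu> - (w \<rho> - \<rho>)) \<noteq> 0} \<union> {w \<in> weyl. d (\<nu> - (w \<rho> - \<rho>)) \<noteq> 0} \<union> {id}"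
  have A: "finite A" "A \<subseteq> weyl" unfolding A_def using finite_char_mult_support c d id_weyl by auto
  have "(\<Sum>w\<in>A. (-1) ^ len w * (c (\<nu> - (w \<rho> - \<rho>)) - d (\<nu> - (w \<rho> - \<rho>)))) =
      char_mult (weyl_sum 0) c \<nu> - char_mult (weyl_sum 0) d \<nu>"
    using char_mult_weyl_sum[OF A, of c \<nu>] char_mult_weyl_sum[OF A, of d \<nu>]
    unfolding A_def by (simp add: right_diff_distrib sum_subtractf subset_iff)
  also have "\<dots> = 0" using eq by simp
  finally have 0: "(\<Sum>w\<in>A. (-1) ^ len w * (c (\<nu> - (w \<rho> - \<rho>)) - d (\<nu> - (w \<rho> - \<rho>)))) = 0" .
  have "c (\<nu> - (w \<rho> - \<rho>)) = d (\<nu> - (w \<rho> - \<rho>))" if w: "w \<in> A" "w \<noteq> id" for w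
  proof (rule top)
    have ww: "w \<in> weyl" using A w by blast
    then have "len w \<noteq> 0" using len_0 w(2) by blast
    then show "ht \<nu> < ht (\<nu> - (w \<rho> - \<rho>))"
      using weyl_rho_ht[OF ww] by (simp add: linear_diff[OF linear_ht])
  qed
  then have "(\<Sum>w\<in>A. (-1) ^ len w * (c (\<nu> - (w \<rho> - \<rho>)) - d (\<nu> - (w \<rho> - \<rho>)))) =
      (\<Sum>w\<in>A. if w = id then c \<nu> - d \<nu> else 0)"
    by (intro sum.cong) auto
  also have "\<dots> = c \<nu> - d \<nu>" using A(1) by (simp add: A_def)
  finally show False using 0 \<nu>(1) unfolding N_def by simp
qed

lemma weyl_char_eqI:
  "c \<in> char_ring \<Longrightarrow> char_mult (weyl_sum 0) c = weyl_sum l \<Longrightarrow> weyl_char l = c"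
  unfolding weyl_char_def using char_mult_weyl_sum_inject by (intro the_equality) auto

subsection \<open>Strings in a crystal\<close>

lemma coroot_pos_comb:
  assumes "a \<in> pos_roots" "\<And>p. p \<in> {1..r} \<Longrightarrow> \<langle>v, coroot (\<alpha> p)\<rangle> \<ge> 0"
  shows "\<langle>v, coroot a\<rangle> \<ge> 0"
proof -
  obtain c where c: "\<forall>p\<in>{1..r}. c p \<ge> 0" "a = (\<Sum>p\<in>{1..r}. c p *\<^sub>R \<alpha> p)"
    using assms(1) unfolding pos_roots_def by blast
  have "\<langle>v, \<alpha> p\<rangle> \<ge> 0" if p: "p \<in> {1..r}" for p
    using assms(2)[OF p] simple_pos[OF p] by (simp add: coroot_def pairing_simps zero_le_divide_iff)
  then have "\<langle>a, v\<rangle> \<ge> 0"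
    unfolding c(2) pairing_sum using c(1) by (intro sum_nonneg) (auto simp: pairing_simps sym_pairing[of v])
  then show ?thesis
    using root_norm_pos[OF pos_roots_roots[OF assms(1)]]
    by (simp add: coroot_def pairing_simps sym_pairing[of v])
qed

lemma dominantI:
  "v \<in> weights \<Longrightarrow> (\<And>p. p \<in> {1..r} \<Longrightarrow> \<langle>v, coroot (\<alpha> p)\<rangle> \<ge> 0) \<Longrightarrow> v \<in> dominant"
  unfolding dominant_def using coroot_pos_comb by blast

lemma dominantD: "v \<in> dominant \<Longrightarrow> p \<in> {1..r} \<Longrightarrow> \<langle>v, coroot (\<alpha> p)\<rangle> \<ge> 0"
  unfolding dominant_def using simple_pos_root by blast

lemma dominant_weights: "v \<in> dominant \<Longrightarrow> v \<in> weights"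
  unfolding dominant_def by blast

lemma weights_int: "v \<in> weights \<Longrightarrow> p \<in> {1..r} \<Longrightarrow> \<langle>v, coroot (\<alpha> p)\<rangle> \<in> \<int>"
  unfolding weights_def by blast

context
  fixes X :: "'x set" and wt dp :: "'x \<Rightarrow> 'v" and F :: "nat \<Rightarrow> 'x \<rightharpoonup> 'x"
  assumes cr: "crystal X wt dp F"
begin

text \<open>By integrality and dominance, depth and rise are natural numbers up to sign:
  \<open>dn\<close> counts the steps up to the top of the p-string through x, and \<open>rn\<close>
  those down to its bottom.\<close>

definition dn :: "'x \<Rightarrow> nat \<Rightarrow> nat" where "dn x p = nat \<lfloor>- dp_at dp x p\<rfloor>"
definition rn :: "'x \<Rightarrow> nat \<Rightarrow> nat" where "rn x p = nat \<lfloor>rise_at wt dp x p\<rfloor>"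

lemma dp_at_dn: "x \<in> X \<Longrightarrow> p \<in> {1..r} \<Longrightarrow> dp_at dp x p = - real (dn x p)"
proof -
  assume *: "x \<in> X" "p \<in> {1..r}"
  then have "- dp x \<in> dominant" using cr unfolding crystal_def by blast
  from dominantD[OF this *(2)] weights_int[OF dominant_weights[OF this] *(2)]
  show ?thesis unfolding dn_def dp_at_def by (auto simp: Ints_def)
qed

lemma rise_at_rn: "x \<in> X \<Longrightarrow> p \<in> {1..r} \<Longrightarrow> rise_at wt dp x p = real (rn x p)"
proof -
  assume *: "x \<in> X" "p \<in> {1..r}"
  then have "wt x - dp x \<in> dominant" using cr unfolding crystal_def by blast
  from dominantD[OF this *(2)] weights_int[OF dominant_weights[OF this] *(2)]
  show ?thesis unfolding rn_def rise_at_def by (auto simp: Ints_def)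
qed

lemma wt_pairing: "x \<in> X \<Longrightarrow> p \<in> {1..r} \<Longrightarrow> \<langle>wt x, coroot (\<alpha> p)\<rangle> = real (rn x p) - real (dn x p)"
  using dp_at_dn[of x p] rise_at_rn[of x p] unfolding dp_at_def rise_at_def by (simp add: pairing_simps)

lemma F_defined:
  assumes "x \<in> X" "p \<in> {1..r}" "rn x p > 0"
  obtains y where "F p x = Some y"
proof -
  have "x \<in> dom (F p)" using cr assms rise_at_rn unfolding crystal_def by auto
  then show thesis using that by blast
qed

lemma F_step:
  assumes "F p x = Some y" "p \<in> {1..r}"
  shows "x \<in> X" "y \<in> X" "dn y p = Suc (dn x p)" "Suc (rn y p) = rn x p" "wt y = wt x - \<alpha> p"
proof -
  have "x \<in> dom (F p)" using assms by blast
  then have x: "x \<in> X" "rise_at wt dp x p > 0" using cr assms(2) unfolding crystal_def by blast+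
  have "(the \<circ> F p) x \<in> {x \<in> X. dp_at dp x p < 0}"
    using cr assms(2) x unfolding crystal_def bij_betw_def by blast
  then have y: "y \<in> X" using assms(1) by simp
  have *: "wt y = wt x - \<alpha> p" "dp_at dp y p = dp_at dp x p - 1"
    using cr assms x unfolding crystal_def by blast+
  show "x \<in> X" "y \<in> X" "wt y = wt x - \<alpha> p" using x y * by blast+
  show dn: "dn y p = Suc (dn x p)" using * dp_at_dn[OF x(1) assms(2)] dp_at_dn[OF y assms(2)] by simp
  have "\<langle>wt y, coroot (\<alpha> p)\<rangle> = \<langle>wt x, coroot (\<alpha> p)\<rangle> - 2"
    unfolding *(1) pairing_simps using assms(2) by (simp del: atLeastAtMost_iff)
  then show "Suc (rn y p) = rn x p"
    using wt_pairing[OF x(1) assms(2)] wt_pairing[OF y assms(2)] dn by simp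
qed

lemma F_onto:
  assumes "y \<in> X" "p \<in> {1..r}" "dn y p > 0"
  obtains x where "F p x = Some y"
proof -
  have "y \<in> {x \<in> X. dp_at dp x p < 0}" using assms dp_at_dn by simp
  then have "y \<in> (the \<circ> F p) ` {x \<in> X. rise_at wt dp x p > 0}"
    using cr assms(2) unfolding crystal_def bij_betw_def by blast
  then obtain x where x: "x \<in> X" "rise_at wt dp x p > 0" "y = the (F p x)" by auto
  then have "x \<in> dom (F p)" using cr assms(2) unfolding crystal_def by blast
  then show thesis using that x(3) by auto
qed

lemma F_inj:
  assumes "F p x = Some y" "F p x' = Some y" "p \<in> {1..r}" shows "x = x'"
proof -
  have "{x, x'} \<subseteq> {x \<in> X. rise_at wt dp x p > 0}"
    using assms cr unfolding crystal_def by blast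
  moreover have "inj_on (the \<circ> F p) {x \<in> X. rise_at wt dp x p > 0}"
    using cr assms(3) unfolding crystal_def bij_betw_def by blast
  moreover have "(the \<circ> F p) x = (the \<circ> F p) x'" using assms(1,2) by simp
  ultimately show ?thesis by (meson inj_onD insert_subset)
qed

definition iter :: "nat \<Rightarrow> nat \<Rightarrow> 'x \<Rightarrow> 'x option" where
  "iter p n x = ((\<lambda>z. Option.bind z (F p)) ^^ n) (Some x)"

lemma iter_simps [simp]: "iter p 0 x = Some x" "iter p (Suc n) x = Option.bind (iter p n x) (F p)"
  by (simp_all add: iter_def)

lemma iter_add: "iter p n x = Some y \<Longrightarrow> iter p (n + m) x = iter p m y"
  by (induction m) auto

lemma iter_step:
  assumes "iter p n x = Some y" "p \<in> {1..r}" "x \<in> X"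
  shows "y \<in> X \<and> dn y p = dn x p + n \<and> rn y p + n = rn x p \<and> wt y = wt x - real n *\<^sub>R \<alpha> p"
  using assms(1)
proof (induction n arbitrary: y)
  case (Suc n)
  then obtain z where z: "iter p n x = Some z" "F p z = Some y" by (auto simp: bind_eq_Some_conv)
  from Suc.IH[OF z(1)] F_step[OF z(2) assms(2)] show ?case
    by (simp add: scaleR_add_left)
qed (use assms in auto)

lemma iter_defined:
  assumes "x \<in> X" "p \<in> {1..r}" "n \<le> rn x p" obtains y where "iter p n x = Some y"
proof -
  have "\<exists>y. iter p n x = Some y" using assms(3)
  proof (induction n)
    case (Suc n)
    then obtain y where y: "iter p n x = Some y" by auto
    then have "y \<in> X" "rn y p > 0" using iter_step[OF y assms(2,1)] Suc.prems by auto
    then obtain z where "F p y = Some z" using F_defined assms(2) by blast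
    then show ?case using y by simp
  qed simp
  then show thesis using that by blast
qed

lemma iter_inj: "iter p n x = Some y \<Longrightarrow> iter p n x' = Some y \<Longrightarrow> p \<in> {1..r} \<Longrightarrow> x = x'"
proof (induction n arbitrary: y)
  case (Suc n)
  then obtain z z' where "iter p n x = Some z" "F p z = Some y" "iter p n x' = Some z'" "F p z' = Some y"
    by (auto simp: bind_eq_Some_conv simp del: atLeastAtMost_iff)
  then show ?case using Suc F_inj by blast
qed simp

lemma iter_onto:
  assumes "y \<in> X" "p \<in> {1..r}" "n \<le> dn y p" shows "\<exists>x\<in>X. iter p n x = Some y"
  using assms
proof (induction n arbitrary: y)
  case (Suc n)
  then obtain z where z: "F p z = Some y" using F_onto[of y p] by auto
  then have "z \<in> X" "n \<le> dn z p" using F_step[OF z Suc.prems(2)] Suc.prems(3) by auto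
  then obtain x where "x \<in> X" "iter p n x = Some z" using Suc by blast
  then have "iter p (Suc n) x = Some y" using z by simp
  with \<open>x \<in> X\<close> show ?case by blast
qed auto

definition top_of :: "nat \<Rightarrow> 'x \<Rightarrow> 'x" where
  "top_of p x = (THE t. t \<in> X \<and> iter p (dn x p) t = Some x)"

lemma top_of:
  assumes "x \<in> X" "p \<in> {1..r}"
  shows "top_of p x \<in> X" "iter p (dn x p) (top_of p x) = Some x"
    "dn (top_of p x) p = 0" "rn (top_of p x) p = rn x p + dn x p" "wt (top_of p x) = wt x + real (dn x p) *\<^sub>R \<alpha> p"
proof -
  have "\<exists>!t. t \<in> X \<and> iter p (dn x p) t = Some x"
    using iter_onto[OF assms order.refl] iter_inj[OF _ _ assms(2)] by blast
  then have "top_of p x \<in> X \<and> iter p (dn x p) (top_of p x) = Some x"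
    unfolding top_of_def by (rule theI')
  then show *: "top_of p x \<in> X" "iter p (dn x p) (top_of p x) = Some x" by blast+
  show "dn (top_of p x) p = 0" "rn (top_of p x) p = rn x p + dn x p" "wt (top_of p x) = wt x + real (dn x p) *\<^sub>R \<alpha> p"
    using iter_step[OF *(2) assms(2) *(1)] by auto
qed

lemma top_of_eqI:
  assumes "iter p n t = Some x" "t \<in> X" "dn t p = 0" "p \<in> {1..r}"
  shows "top_of p x = t" "dn x p = n"
proof -
  have x: "x \<in> X" "dn x p = n" using iter_step[OF assms(1,4,2)] assms(3) by auto
  then show "dn x p = n" by blast
  have "iter p n (top_of p x) = Some x" using top_of(2)[OF x(1) assms(4)] x(2) by simp
  from iter_inj[OF this assms(1,4)] show "top_of p x = t" .
qed

text \<open>Positions are measured from the top, so the value depends only on the string and not on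
  the element of it that is named (\<open>str_at_at\<close>).\<close>

definition str_at :: "nat \<Rightarrow> nat \<Rightarrow> 'x \<Rightarrow> 'x" where
  "str_at p n x = the (iter p n (top_of p x))"

lemma str_at:
  assumes "x \<in> X" "p \<in> {1..r}" "n \<le> rn x p + dn x p"
  shows "str_at p n x \<in> X" "dn (str_at p n x) p = n" "rn (str_at p n x) p + n = rn x p + dn x p"
    "wt (str_at p n x) = wt x + (real (dn x p) - real n) *\<^sub>R \<alpha> p" "top_of p (str_at p n x) = top_of p x"
    "iter p n (top_of p x) = Some (str_at p n x)"
proof -
  note t = top_of[OF assms(1,2)]
  obtain y where y: "iter p n (top_of p x) = Some y" using iter_defined[OF t(1) assms(2)] assms(3) t(4) by metis
  then have at: "str_at p n x = y" unfolding str_at_def by simp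
  then show "iter p n (top_of p x) = Some (str_at p n x)" using y by simp
  show "str_at p n x \<in> X" "dn (str_at p n x) p = n" "rn (str_at p n x) p + n = rn x p + dn x p"
    "wt (str_at p n x) = wt x + (real (dn x p) - real n) *\<^sub>R \<alpha> p"
    using iter_step[OF y assms(2) t(1)] t unfolding at by (auto simp: scaleR_diff_left)
  show "top_of p (str_at p n x) = top_of p x" unfolding at using top_of_eqI[OF y t(1,3) assms(2)] by simp
qed

lemma str_at_self: "x \<in> X \<Longrightarrow> p \<in> {1..r} \<Longrightarrow> str_at p (dn x p) x = x"
  unfolding str_at_def using top_of by simp

lemma str_at_at:
  "x \<in> X \<Longrightarrow> p \<in> {1..r} \<Longrightarrow> n \<le> rn x p + dn x p \<Longrightarrow> str_at p m (str_at p n x) = str_at p m x"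
  using str_at(5) unfolding str_at_def[of p m] by simp

lemma F_str_at:
  assumes "x \<in> X" "p \<in> {1..r}" "Suc n \<le> rn x p + dn x p"
  shows "F p (str_at p n x) = Some (str_at p (Suc n) x)"
  using str_at(6)[OF assms(1,2), of n] str_at(6)[OF assms] assms(3) by simp

lemma F_str_at_self:
  assumes "F p x = Some y" "p \<in> {1..r}" shows "str_at p n y = str_at p n x"
proof -
  note s = F_step[OF assms]
  have "y = str_at p (Suc (dn x p)) x"
    using F_str_at[of x p "dn x p"] str_at_self[OF s(1) assms(2)] s assms by simp
  then show ?thesis using str_at_at[OF s(1) assms(2), of "Suc (dn x p)"] s by simp
qed

text \<open>Going up a string, at most one element has a given depth. The existential statements in
  the coherence condition thereby become statements about a single position.\<close>

lemma string_le_iff: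
  assumes "x \<in> X" "p \<in> {1..r}" "n > 0"
  shows "string_le X F p x y \<and> dp_at dp y p = - real n \<longleftrightarrow> n \<le> dn x p \<and> y = str_at p n x"
proof
  assume l: "string_le X F p x y \<and> dp_at dp y p = - real n"
  then obtain k where k: "iter p k y = Some x" "y \<in> X" unfolding string_le_def iter_def by blast
  have n: "dn y p = n" using l dp_at_dn[OF k(2) assms(2)] by simp
  note t = top_of[OF k(2) assms(2)]
  have "iter p (n + k) (top_of p y) = Some x" using iter_add[of p n "top_of p y" y k] t(2) n k by simp
  from top_of_eqI[OF this t(1,3) assms(2)] have "top_of p x = top_of p y" "dn x p = n + k" by simp_all
  then show "n \<le> dn x p \<and> y = str_at p n x" unfolding str_at_def using t n by simp
next
  assume r: "n \<le> dn x p \<and> y = str_at p n x"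
  note t = top_of[OF assms(1,2)] and a = str_at[OF assms(1,2), of n]
  have le: "n \<le> rn x p + dn x p" using r by simp
  have "iter p (dn x p - n) y = iter p (dn x p) (top_of p x)"
    using iter_add[of p n "top_of p x" y "dn x p - n"] a(6)[OF le] r by simp
  then have "string_le X F p x y"
    unfolding string_le_def iter_def[symmetric] using t r a(1)[OF le] assms(1) by auto
  then show "string_le X F p x y \<and> dp_at dp y p = - real n"
    using dp_at_dn[OF _ assms(2), of y] a(1,2)[OF le] r by simp
qed

section \<open>The maximum object and finiteness of the weight fibres\<close>

definition good :: "'x \<Rightarrow> bool" where "good x \<longleftrightarrow> (\<forall>p\<in>{1..r}. dn x p = 0)"

lemma good_le_imp_eq:
  assumes "good x" "(\<lambda>u v. \<exists>p\<in>{1..r}. string_le X F p u v)\<^sup>*\<^sup>* x m" shows "x = m"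
  using assms(2,1)
proof (induction rule: converse_rtranclp_induct)
  case (step y z)
  then obtain p k where p: "p \<in> {1..r}" "z \<in> X" "iter p k z = Some y"
    unfolding string_le_def iter_def by blast
  have "dn z p + k = 0" using iter_step[OF p(3,1,2)] step.prems p(1) unfolding good_def by auto
  then have "z = y" using p(3) by simp
  then show ?case using step by simp
qed simp

text \<open>An upper bound for the elements obtained by n steps down from m. Where an operator is
  undefined, \<open>the\<close> contributes an arbitrary element; this is harmless, as only
  finiteness and inclusion are used.\<close>

fun reach :: "'x \<Rightarrow> nat \<Rightarrow> 'x set" where
  "reach m 0 = {m}"
| "reach m (Suc n) = (\<Union>p\<in>{1..r}. (\<lambda>x. the (F p x)) ` reach m n)"

lemma finite_reach: "finite (reach m n)"
  by (induction n) auto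

lemma reach_if_le:
  assumes "(\<lambda>u v. \<exists>p\<in>{1..r}. string_le X F p u v)\<^sup>*\<^sup>* x m"
  shows "\<exists>n. x \<in> reach m n \<and> ht (wt x) = ht (wt m) - real n"
  using assms
proof (induction rule: converse_rtranclp_induct)
  case base
  show ?case by (intro exI[of _ 0]) simp
next
  case (step y z)
  then obtain p k where p: "p \<in> {1..r}" "z \<in> X" "iter p k z = Some y"
    unfolding string_le_def iter_def by blast
  from step obtain n where n: "z \<in> reach m n" "ht (wt z) = ht (wt m) - real n" by blast
  have "y \<in> reach m (n + k)" using p(3)
  proof (induction k arbitrary: y)
    case (Suc k)
    then obtain u where u: "iter p k z = Some u" "F p u = Some y" by (auto simp: bind_eq_Some_conv)
    from Suc.IH[OF u(1)] have "the (F p u) \<in> reach m (Suc (n + k))" using p(1) by auto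
    then show ?case using u by simp
  qed (use n in simp)
  moreover have "wt y = wt z - real k *\<^sub>R \<alpha> p" using iter_step[OF p(3,1,2)] by blast
  then have "ht (wt y) = ht (wt m) - real (n + k)"
    using n p ht_simple by (simp add: linear_diff[OF linear_ht] linear_cmul[OF linear_ht])
  ultimately show ?case by blast
qed

context
  fixes m :: 'x
  assumes m: "m \<in> X" and max: "\<And>x. x \<in> X \<Longrightarrow> (\<lambda>u v. \<exists>p\<in>{1..r}. string_le X F p u v)\<^sup>*\<^sup>* x m"
begin

lemma ht_le_max: "x \<in> X \<Longrightarrow> ht (wt x) \<le> ht (wt m)"
  using reach_if_le[OF max] by force

lemma good_max: "good m"
  unfolding good_def
proof
  fix p assume p: "p \<in> {1..r}"
  note t = top_of[OF m p]
  have "ht (wt (top_of p m)) = ht (wt m) + real (dn m p)"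
    unfolding t(5) using ht_simple p by (simp add: linear_add[OF linear_ht] linear_cmul[OF linear_ht])
  then show "dn m p = 0" using ht_le_max[OF t(1)] by simp
qed

lemma good_iff: "x \<in> X \<Longrightarrow> good x \<longleftrightarrow> x = m"
  using good_le_imp_eq[OF _ max] good_max by blast

lemma crystal_summable: "formal_summable X wt"
  unfolding formal_summable_def
proof (intro conjI allI)
  show "wt ` X \<subseteq> weights" using cr unfolding crystal_def by blast
  fix h
  have "{x \<in> X. ht (wt x) > h} \<subseteq> (\<Union>n\<le>nat \<lceil>ht (wt m) - h\<rceil>. reach m n)"
  proof
    fix x assume x: "x \<in> {x \<in> X. ht (wt x) > h}"
    then obtain n where n: "x \<in> reach m n" "ht (wt x) = ht (wt m) - real n" using reach_if_le[OF max] by blast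
    then have "n \<le> nat \<lceil>ht (wt m) - h\<rceil>" using x by simp linarith
    then show "x \<in> (\<Union>n\<le>nat \<lceil>ht (wt m) - h\<rceil>. reach m n)" using n(1) by blast
  qed
  then show "finite {x \<in> X. ht (wt x) > h}" by (rule finite_subset) (use finite_reach in auto)
qed

lemma finite_wt_fibre: "finite {x \<in> X. wt x = \<nu>}"
proof -
  have "finite {x \<in> X. ht (wt x) > ht \<nu> - 1}"
    using crystal_summable unfolding formal_summable_def by blast
  then show ?thesis by (rule finite_subset[rotated]) auto
qed

lemma formal_sum_char_ring: "formal_sum X (\<lambda>_. 1) wt \<in> char_ring"
proof -
  have supp: "{\<nu>. formal_sum X (\<lambda>_. 1) wt \<nu> \<noteq> 0} \<subseteq> wt ` X"
  proof
    fix \<nu> assume "\<nu> \<in> {\<nu>. formal_sum X (\<lambda>_. 1) wt \<nu> \<noteq> 0}"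
    then have "{x \<in> X. wt x = \<nu>} \<noteq> {}" unfolding formal_sum_card by force
    then show "\<nu> \<in> wt ` X" by blast
  qed
  have "finite {\<nu>. formal_sum X (\<lambda>_. 1) wt \<nu> \<noteq> 0 \<and> ht \<nu> > h}" for h
  proof (rule finite_subset)
    show "{\<nu>. formal_sum X (\<lambda>_. 1) wt \<nu> \<noteq> 0 \<and> ht \<nu> > h} \<subseteq> wt ` {x \<in> X. ht (wt x) > h}"
      using supp by blast
    show "finite \<dots>" using crystal_summable unfolding formal_summable_def by blast
  qed
  moreover have "wt ` X \<subseteq> weights" using cr unfolding crystal_def by blast
  ultimately show ?thesis using supp unfolding char_ring_def by blast
qed

end

text \<open>Turning every p-string upside down is an involution that exchanges \<open>dn\<close> and
  \<open>rn\<close> and therefore reflects the weight.\<close>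

lemma fibre_reflect:
  assumes p: "p \<in> {1..r}"
  shows "card {x \<in> X. wt x = reflect (\<alpha> p) \<nu>} = card {x \<in> X. wt x = \<nu>}"
proof -
  have rev: "wt (str_at p (rn x p) x) = reflect (\<alpha> p) (wt x)" "str_at p (rn x p) x \<in> X"
    "str_at p (rn (str_at p (rn x p) x) p) (str_at p (rn x p) x) = x" if x: "x \<in> X" for x
  proof -
    note a = str_at[OF x p, of "rn x p"]
    show "str_at p (rn x p) x \<in> X" using a by simp
    show "wt (str_at p (rn x p) x) = reflect (\<alpha> p) (wt x)"
      using a(4) unfolding reflect_def wt_pairing[OF x p] by (simp add: algebra_simps)
    have "rn (str_at p (rn x p) x) p = dn x p" using a(3) by simp
    then show "str_at p (rn (str_at p (rn x p) x) p) (str_at p (rn x p) x) = x"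
      using str_at_at[OF x p, of "rn x p"] str_at_self[OF x p] by simp
  qed
  have ss: "reflect (\<alpha> p) (reflect (\<alpha> p) v) = v" for v using root_refl_refl simple_in_roots p by blast
  show ?thesis
  proof (rule bij_betw_same_card)
    show "bij_betw (\<lambda>x. str_at p (rn x p) x) {x \<in> X. wt x = reflect (\<alpha> p) \<nu>} {x \<in> X. wt x = \<nu>}"
      by (rule bij_betw_byWitness[where f' = "\<lambda>x. str_at p (rn x p) x"]) (auto simp: rev ss)
  qed
qed

lemma fibre_weyl: "w \<in> weyl \<Longrightarrow> card {x \<in> X. wt x = w \<nu>} = card {x \<in> X. wt x = \<nu>}"
  unfolding weyl_def
proof (induction rule: refl_group.induct)
  case (refl_group_step w a)
  then show ?case using fibre_reflect by auto
qed simp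

text \<open>Since times decrease along a string, coherence with respect to the entries of depth
  \<open>-1\<close> relates all elements of a string other than its top.\<close>

context
  fixes T :: "'t set" and le :: "('t \<times> 't) set" and t :: "'x \<Rightarrow> nat \<Rightarrow> 't"
  assumes co: "coherent_timing X wt dp F T le t"
begin

text \<open>By \<open>t_le_crit\<close> this is the greatest time on the q-string through x, taken
  just below its top.\<close>

definition crit :: "'x \<Rightarrow> nat \<Rightarrow> 't" where "crit x q = t (str_at q 1 x) q"

lemma lin_le: "linear_order_on T le"
  using co unfolding coherent_timing_def by blast

lemma le_refl: "a \<in> T \<Longrightarrow> (a, a) \<in> le"
  using lin_le unfolding order_on_defs refl_on_def by blast

lemma le_trans: "(a, b) \<in> le \<Longrightarrow> (b, c) \<in> le \<Longrightarrow> (a, c) \<in> le"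
  using lin_le unfolding order_on_defs trans_def by blast

lemma le_total: "a \<in> T \<Longrightarrow> b \<in> T \<Longrightarrow> (a, b) \<in> le \<or> (b, a) \<in> le"
  using lin_le le_refl unfolding order_on_defs total_on_def by metis

lemma le_antisym: "(a, b) \<in> le \<Longrightarrow> (b, a) \<in> le \<Longrightarrow> a = b"
  using lin_le unfolding order_on_defs antisym_def by blast

lemma t_in_T: "x \<in> X \<Longrightarrow> p \<in> {1..r} \<Longrightarrow> dn x p > 0 \<Longrightarrow> t x p \<in> T"
  using co dp_at_dn unfolding coherent_timing_def by simp

lemma crit_in_T: "x \<in> X \<Longrightarrow> p \<in> {1..r} \<Longrightarrow> dn x p > 0 \<Longrightarrow> crit x p \<in> T"
  unfolding crit_def using t_in_T str_at[of x p 1] by simp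

lemma t_le_crit:
  assumes "x \<in> X" "p \<in> {1..r}" "Suc n \<le> rn x p + dn x p"
  shows "(t (str_at p (Suc n) x) p, crit x p) \<in> le"
  using assms(3)
proof (induction n)
  case 0
  then show ?case
    using t_in_T[of "str_at p 1 x" p] str_at(1,2)[OF assms(1,2), of 1] assms(2) le_refl unfolding crit_def
    by (simp add: One_nat_def)
next
  case (Suc n)
  let ?y = "str_at p (Suc n) x"
  have y: "?y \<in> X" "dn ?y p > 0" "rn ?y p > 0" using str_at[OF assms(1,2), of "Suc n"] Suc.prems by auto
  then have "(t (the (F p ?y)) p, t ?y p) \<in> le"
    using co assms(2) dp_at_dn[OF y(1) assms(2)] rise_at_rn[OF y(1) assms(2)] unfolding coherent_timing_def by auto
  then have "(t (str_at p (Suc (Suc n)) x) p, t ?y p) \<in> le"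
    using F_str_at[OF assms(1,2) Suc.prems] by simp
  then show ?case using Suc le_trans Suc_leD by blast
qed

text \<open>For q = p both elements lie on one string and share its critical time; for other q this
  is coherence at depth -1.\<close>

lemma crit_F:
  assumes F: "F p x = Some y" "p \<in> {1..r}" and d: "dn x p > 0" and s: "s \<in> T" "(t x p, s) \<in> le"
    and q: "q \<in> {1..r}"
  shows "dn x q > 0 \<and> crit x q = s \<longleftrightarrow> dn y q > 0 \<and> crit y q = s"
proof (cases "q = p")
  case True
  then show ?thesis using F_str_at_self[OF F] F_step[OF F] d unfolding crit_def by simp
next
  case False
  note st = F_step[OF F]
  have "(\<exists>z. string_le X F q x z \<and> dp_at dp z q = of_int (-1) \<and> t z q = s) \<longleftrightarrow>
        (\<exists>z. string_le X F q (the (F p x)) z \<and> dp_at dp z q = of_int (-1) \<and> t z q = s)"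
  proof -
    have "dp_at dp x p < 0 \<and> rise_at wt dp x p > 0"
      using d st(4) dp_at_dn[OF st(1) F(2)] rise_at_rn[OF st(1) F(2)] by simp
    with co st(1) F(2) q False have "\<forall>d::int. d < 0 \<longrightarrow> (\<forall>s\<in>T. (t x p, s) \<in> le \<longrightarrow>
           ((\<exists>y. string_le X F q x y \<and> dp_at dp y q = of_int d \<and> t y q = s) \<longleftrightarrow>
            (\<exists>y. string_le X F q (the (F p x)) y \<and> dp_at dp y q = of_int d \<and> t y q = s)))"
      unfolding coherent_timing_def by blast
    from spec[OF this, of "-1"] s show ?thesis by simp
  qed
  then show ?thesis
    using string_le_iff[OF st(1) q, of 1] string_le_iff[OF st(2) q, of 1]
    unfolding crit_def F(1) by (simp add: Suc_le_eq One_nat_def) metis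
qed

lemma crit_str_at:
  assumes "x \<in> X" "p \<in> {1..r}" "Suc n \<le> rn x p + dn x p" "s \<in> T" "(crit x p, s) \<in> le" "q \<in> {1..r}"
  shows "dn (str_at p (Suc n) x) q > 0 \<and> crit (str_at p (Suc n) x) q = s \<longleftrightarrow>
     dn (str_at p 1 x) q > 0 \<and> crit (str_at p 1 x) q = s"
  using assms(3)
proof (induction n)
  case (Suc n)
  have F: "F p (str_at p (Suc n) x) = Some (str_at p (Suc (Suc n)) x)"
    using F_str_at[OF assms(1,2)] Suc.prems by blast
  have "(t (str_at p (Suc n) x) p, s) \<in> le" using t_le_crit[OF assms(1,2), of n] Suc.prems assms(5) le_trans by auto
  moreover have "dn (str_at p (Suc n) x) p > 0" using str_at(2)[OF assms(1,2)] Suc.prems by simp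
  ultimately show ?case using crit_F[OF F assms(2) _ assms(4) _ assms(6)] Suc by simp
qed (simp add: One_nat_def)

lemma crit_string:
  assumes "x \<in> X" "p \<in> {1..r}" "dn x p > 0" "n > 0" "n \<le> rn x p + dn x p" "s \<in> T" "(crit x p, s) \<in> le"
    "q \<in> {1..r}"
  shows "dn (str_at p n x) q > 0 \<and> crit (str_at p n x) q = s \<longleftrightarrow> dn x q > 0 \<and> crit x q = s"
  using crit_str_at[OF assms(1,2) _ assms(6-8), of "n - 1"] crit_str_at[OF assms(1,2) _ assms(6-8), of "dn x p - 1"]
    assms(3-5) str_at_self[OF assms(1,2)] by simp

text \<open>The direction in which a bad element is reflected: the latest critical time decides,
  ties being broken by the index.\<close>

definition chosen :: "'x \<Rightarrow> nat \<Rightarrow> bool" where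
  "chosen x p \<longleftrightarrow> p \<in> {1..r} \<and> dn x p > 0 \<and>
    (\<forall>q\<in>{1..r}. dn x q > 0 \<longrightarrow> (crit x q, crit x p) \<in> le \<and> (q < p \<longrightarrow> crit x q \<noteq> crit x p))"

lemma chosen_unique: "chosen x p \<Longrightarrow> chosen x q \<Longrightarrow> p = q"
  unfolding chosen_def by (metis le_antisym linorder_neqE_nat)

lemma finite_linear_max:
  assumes "finite A" "A \<noteq> {}" "A \<subseteq> T" shows "\<exists>m\<in>A. \<forall>a\<in>A. (a, m) \<in> le"
  using assms
proof (induction A rule: finite_ne_induct)
  case (insert a A)
  then obtain m where m: "m \<in> A" "\<forall>a\<in>A. (a, m) \<in> le" by blast
  then consider "(a, m) \<in> le" | "(m, a) \<in> le" using le_total insert by blast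
  then show ?case using m insert.prems le_trans le_refl by cases blast+
qed (use le_refl in auto)

lemma chosen_exists:
  assumes "x \<in> X" "\<not> good x" shows "\<exists>p. chosen x p"
proof -
  define Q where "Q = {q \<in> {1..r}. dn x q > 0}"
  have Q: "finite Q" "Q \<noteq> {}" using assms(2) unfolding Q_def good_def by auto
  have "crit x ` Q \<subseteq> T" using crit_in_T assms(1) unfolding Q_def by blast
  then obtain m where m: "m \<in> crit x ` Q" "\<forall>a\<in>crit x ` Q. (a, m) \<in> le"
    using finite_linear_max[of "crit x ` Q"] Q by blast
  define p where "p = (LEAST p. p \<in> Q \<and> crit x p = m)"
  have "p \<in> Q \<and> crit x p = m" unfolding p_def by (rule LeastI_ex) (use m in auto)
  moreover have "crit x q \<noteq> m" if "q \<in> Q" "q < p" for q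
    using not_less_Least[of q "\<lambda>p. p \<in> Q \<and> crit x p = m"] that unfolding p_def by blast
  ultimately have "chosen x p" using m unfolding chosen_def Q_def by blast
  then show ?thesis ..
qed

text \<open>A direction with a critical time later than, or tied with, that of p at the new element
  would by \<open>crit_string\<close> have had the same critical time at x. Hence the choice cannot
  change along the string below its top.\<close>

lemma chosen_str_at:
  assumes "x \<in> X" "chosen x p" "n > 0" "n \<le> rn x p + dn x p"
  shows "chosen (str_at p n x) p"
proof -
  have p: "p \<in> {1..r}" "dn x p > 0" using assms(2) unfolding chosen_def by blast+
  let ?y = "str_at p n x"
  note a = str_at[OF assms(1) p(1) assms(4)]
  have cp: "crit ?y p = crit x p" unfolding crit_def using str_at_at[OF assms(1) p(1) assms(4)] by simp
  have iff: "dn ?y q > 0 \<and> crit ?y q = s \<longleftrightarrow> dn x q > 0 \<and> crit x q = s"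
    if "s \<in> T" "(crit x p, s) \<in> le" "q \<in> {1..r}" for q s
    using crit_string[OF assms(1) p assms(3,4) that] .
  have "(crit ?y q, crit ?y p) \<in> le \<and> (q < p \<longrightarrow> crit ?y q \<noteq> crit ?y p)" if q: "q \<in> {1..r}" "dn ?y q > 0" for q
  proof (intro conjI impI)
    have T: "crit x p \<in> T" "crit ?y q \<in> T" using crit_in_T assms(1) p a(1) q by blast+
    show "(crit ?y q, crit ?y p) \<in> le"
    proof (rule ccontr)
      assume neg: "(crit ?y q, crit ?y p) \<notin> le"
      then have "(crit x p, crit ?y q) \<in> le" using le_total T cp by auto
      with iff T q have "dn x q > 0" "crit x q = crit ?y q" by blast+
      then have "(crit ?y q, crit x p) \<in> le" using assms(2) q(1) unfolding chosen_def by metis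
      then show False using neg cp by simp
    qed
    show "crit ?y q \<noteq> crit ?y p" if "q < p"
    proof
      assume "crit ?y q = crit ?y p"
      then have "dn x q > 0" "crit x q = crit x p" using iff[OF T(1) le_refl[OF T(1)] q(1)] cp q by auto
      then show False using assms(2) that q unfolding chosen_def by blast
    qed
  qed
  then show ?thesis unfolding chosen_def using p a assms(3) by simp
qed

section \<open>The sign-reversing involution and the character formula\<close>

definition cdir :: "'x \<Rightarrow> nat" where "cdir x = (THE p. chosen x p)"
text \<open>The reflection shifted by \<rho>. The top of the string is left out and the remaining
  positions 1, ..., rn + dn are reversed, so position dn goes to rn + 1 and the image is again not a
  top.\<close>

definition flip :: "'x \<Rightarrow> 'x" where "flip x = str_at (cdir x) (Suc (rn x (cdir x))) x"

lemma cdir: "chosen x p \<Longrightarrow> cdir x = p"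
  unfolding cdir_def using chosen_unique by blast

lemma flip:
  assumes "x \<in> X" "\<not> good x"
  shows "flip x \<in> X" "\<not> good (flip x)" "flip (flip x) = x" "cdir (flip x) = cdir x" "cdir x \<in> {1..r}"
    "wt (flip x) + \<rho> = reflect (\<alpha> (cdir x)) (wt x + \<rho>)"
proof -
  obtain p where c: "chosen x p" using chosen_exists[OF assms] by blast
  then have p: "p \<in> {1..r}" "dn x p > 0" unfolding chosen_def by blast+
  let ?n = "Suc (rn x p)"
  have n: "?n \<le> rn x p + dn x p" using p by simp
  note a = str_at[OF assms(1) p(1) n]
  have fx: "flip x = str_at p ?n x" unfolding flip_def cdir[OF c] ..
  have cf: "chosen (flip x) p" unfolding fx using chosen_str_at[OF assms(1) c _ n] by simp
  show "flip x \<in> X" using a fx by simp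
  have "dn (flip x) p \<noteq> 0" using a(2) fx by simp
  then show "\<not> good (flip x)" using p(1) unfolding good_def by (meson)
  show "cdir (flip x) = cdir x" "cdir x \<in> {1..r}" using cdir[OF c] cdir[OF cf] p by auto
  have "rn (flip x) p = dn x p - 1" using a(3) unfolding fx by simp
  then have "flip (flip x) = str_at p (dn x p) (flip x)" unfolding flip_def[of "flip x"] cdir[OF cf] using p by simp
  also have "\<dots> = x" unfolding fx using str_at_at[OF assms(1) p(1) n] str_at_self[OF assms(1) p(1)] by simp
  finally show "flip (flip x) = x" .
  have "\<langle>wt x + \<rho>, coroot (\<alpha> p)\<rangle> = real (rn x p) - real (dn x p) + 1"
    using wt_pairing[OF assms(1) p(1)] rho_coroot[OF p(1)] by (simp add: pairing_simps)
  then show "wt (flip x) + \<rho> = reflect (\<alpha> (cdir x)) (wt x + \<rho>)"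
    unfolding cdir[OF c] fx reflect_def a(4) by (simp only:) (simp add: algebra_simps)
qed

text \<open>Comparing coefficients, the denominator times the sum over \<open>X\<close> becomes a
  signed count of pairs. Pairs with a non-maximal element cancel, and those with x = m make up the
  numerator for the weight of m.\<close>

lemma crystal_character:
  assumes "m \<in> X" "\<And>x. x \<in> X \<Longrightarrow> (\<lambda>u v. \<exists>p\<in>{1..r}. string_le X F p u v)\<^sup>*\<^sup>* x m"
  shows "weyl_char (wt m) = formal_sum X (\<lambda>_. 1) wt"
proof (rule weyl_char_eqI)
  show "formal_sum X (\<lambda>_. 1) wt \<in> char_ring" using formal_sum_char_ring[OF assms] .
  show "char_mult (weyl_sum 0) (formal_sum X (\<lambda>_. 1) wt) = weyl_sum (wt m)"
  proof (rule ext)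
    fix \<nu>
    let ?ch = "formal_sum X (\<lambda>_. 1) wt"
    define A where "A = {w \<in> weyl. ?ch (\<nu> - (w \<rho> - \<rho>)) \<noteq> 0}"
    \<comment> \<open>Invariance of the multiplicities under w allows wt x to be replaced by w (wt
      x). The condition then depends on x through wt x + \<rho>, exactly the vector that
      \<open>flip\<close> reflects.\<close>
    define P where "P = {(w, x). w \<in> weyl \<and> x \<in> X \<and> w (wt x + \<rho>) = \<nu> + \<rho>}"
    have A: "finite A" "A \<subseteq> weyl" using finite_char_mult_support[OF formal_sum_char_ring[OF assms]] unfolding A_def by auto
    define E where "E = (\<lambda>w. {x \<in> X. w (wt x + \<rho>) = \<nu> + \<rho>})"
    have E: "finite (E w) \<and> ?ch (\<nu> - (w \<rho> - \<rho>)) = int (card (E w))" if w: "w \<in> weyl" for w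
    proof -
      obtain v where v: "v \<in> weyl" "v \<circ> w = id" "w \<circ> v = id" using weyl_inverse[OF w] by blast
      have vw: "v (w u) = u" "w (v u) = u" for u using v by (simp_all add: fun_eq_iff)
      have lin: "linear w" "linear v" using weyl_linear_isometry(1) w v by blast+
      have E': "E w = {x \<in> X. wt x = v (\<nu> - (w \<rho> - \<rho>))}"
        unfolding E_def
      proof (intro Collect_cong conj_cong refl)
        fix x
        have "w (wt x + \<rho>) = \<nu> + \<rho> \<longleftrightarrow> w (wt x) = \<nu> - (w \<rho> - \<rho>)"
          by (auto simp: linear_add[OF lin(1)] algebra_simps)
        also have "\<dots> \<longleftrightarrow> wt x = v (\<nu> - (w \<rho> - \<rho>))" using vw by metis
        finally show "w (wt x + \<rho>) = \<nu> + \<rho> \<longleftrightarrow> wt x = v (\<nu> - (w \<rho> - \<rho>))" .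
      qed
      then show ?thesis using fibre_weyl[OF v(1)] finite_wt_fibre[OF assms] by (simp add: formal_sum_card)
    qed
    have Psig: "P = Sigma A E"
    proof -
      have "w \<in> A" if "w \<in> weyl" "x \<in> E w" for w x
      proof -
        have "card (E w) \<noteq> 0" using E[OF that(1)] that(2) by auto
        then show ?thesis using E[OF that(1)] that(1) unfolding A_def by simp
      qed
      then show ?thesis using A(2) unfolding P_def E_def by auto
    qed
    have finP: "finite P" unfolding Psig using A E by (intro finite_SigmaI) blast+
    have "char_mult (weyl_sum 0) ?ch \<nu> = (\<Sum>w\<in>A. (-1) ^ len w * ?ch (\<nu> - (w \<rho> - \<rho>)))"
      using char_mult_weyl_sum[OF A] unfolding A_def by simp
    also have "\<dots> = (\<Sum>w\<in>A. \<Sum>x\<in>E w. (-1) ^ len w)"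
      using E A(2) by (intro sum.cong) (auto simp: mult.commute)
    also have "\<dots> = (\<Sum>(w, x)\<in>P. (-1) ^ len w)"
      unfolding Psig using A E by (intro sum.Sigma) blast+
    also have "\<dots> = (\<Sum>(w, x)\<in>{(w, x). (w, x) \<in> P \<and> \<not> good x}. (-1) ^ len w) +
        (\<Sum>(w, x)\<in>{(w, x). (w, x) \<in> P \<and> good x}. (-1) ^ len w)"
      using finP by (subst sum.union_disjoint[symmetric]) (auto intro!: sum.cong elim: finite_subset[rotated])
    also have "(\<Sum>(w, x)\<in>{(w, x). (w, x) \<in> P \<and> \<not> good x}. (-1) ^ len w) = (0 :: int)" (is "sum ?g ?B = 0")
    proof -
      \<comment> \<open>The sign belongs to the Weyl group component, whose length parity always
        changes; so the terms cancel even where \<open>flip\<close> fixes x.\<close>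
      define i where "i = (\<lambda>(w::'v \<Rightarrow> 'v, x). (w \<circ> reflect (\<alpha> (cdir x)), flip x))"
      have i: "i b \<in> ?B \<and> i (i b) = b \<and> ?g (i b) = - ?g b" if b: "b \<in> ?B" for b
      proof -
        obtain w x where wx: "b = (w, x)" "w \<in> weyl" "x \<in> X" "w (wt x + \<rho>) = \<nu> + \<rho>" "\<not> good x"
          using b unfolding P_def by auto
        note f = flip[OF wx(3,5)]
        let ?s = "reflect (\<alpha> (cdir x))"
        have ws: "w \<circ> ?s \<in> weyl" using weyl_comp wx(2) simple_refl_weyl f(5) by blast
        have "(w \<circ> ?s) (wt (flip x) + \<rho>) = \<nu> + \<rho>"
          unfolding f(6) using wx(4) root_refl_refl simple_in_roots f(5) by simp
        then have "i b \<in> ?B" unfolding i_def wx P_def using ws f by simp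
        moreover have "i (i b) = b" unfolding i_def wx using f comp_simple_refl_refl[OF f(5)] by simp
        moreover have "?g (i b) = - ?g b"
          unfolding i_def wx using len_simple_right[OF wx(2) f(5)]
          by (cases "len w") (auto simp: power_add split: if_splits)
        ultimately show ?thesis by blast
      qed
      have "sum ?g ?B = (\<Sum>b\<in>?B. ?g (i b))"
        by (rule sum.reindex_bij_witness[of _ i i]) (use i in auto)
      also have "\<dots> = (\<Sum>b\<in>?B. - ?g b)" by (rule sum.cong) (use i in auto)
      also have "\<dots> = - sum ?g ?B" by (rule sum_negf)
      finally show ?thesis by simp
    qed
    also have "(\<Sum>(w, x)\<in>{(w, x). (w, x) \<in> P \<and> good x}. (-1) ^ len w) = weyl_sum (wt m) \<nu>"
      unfolding weyl_sum_def formal_sum_def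
      by (rule sum.reindex_bij_witness[of _ "\<lambda>w. (w, m)" fst])
        (use good_iff[OF assms] assms(1) in \<open>auto simp: P_def algebra_simps\<close>)
    finally show "char_mult (weyl_sum 0) ?ch \<nu> = weyl_sum (wt m) \<nu>" by simp
  qed
qed

end

end

text \<open>Every operator lowers the height by 1, so an element of greatest height can only be the
  maximum object.\<close>

lemma semiperfect_character:
  fixes X :: "'x set"
  assumes sp: "semiperfect X wt dp F" and l: "x \<in> X" "\<And>y. y \<in> X \<Longrightarrow> ht (wt y) \<le> ht (wt x)"
  shows "formal_summable X wt" "weyl_char (wt x) = formal_sum X (\<lambda>_. 1) wt"
proof -
  obtain m where m: "m \<in> X" "\<And>x. x \<in> X \<Longrightarrow> (\<lambda>u v. \<exists>p\<in>{1..r}. string_le X F p u v)\<^sup>*\<^sup>* x m"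
    and cr: "crystal X wt dp F"
    using sp unfolding semiperfect_def by blast
  obtain T le and t :: "'x \<Rightarrow> nat \<Rightarrow> 'x \<times> nat" where co: "coherent_timing X wt dp F T le t"
    using sp unfolding semiperfect_def by blast
  show "formal_summable X wt" using crystal_summable[OF cr m] .
  obtain n where n: "x \<in> reach F m n" "ht (wt x) = ht (wt m) - real n"
    using reach_if_le[OF cr m(2)[OF l(1)]] by blast
  then have "n = 0" using l(2)[OF m(1)] by simp
  then have "x = m" using n(1) reach.simps(1)[OF cr] by simp
  then show "weyl_char (wt x) = formal_sum X (\<lambda>_. 1) wt" using crystal_character[OF cr co m] by simp
qed

end

section \<open>Foldings along a fixed chain\<close>

lemma sorted_list_of_set_append:
  fixes S T :: "'i::linorder set"
  assumes "finite S" "finite T" "\<And>x y. x \<in> S \<Longrightarrow> y \<in> T \<Longrightarrow> x < y"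
  shows "sorted_list_of_set (S \<union> T) = sorted_list_of_set S @ sorted_list_of_set T"
proof (rule sorted_distinct_set_unique)
  show "sorted (sorted_list_of_set S @ sorted_list_of_set T)"
    using assms by (auto simp: sorted_append intro: less_imp_le)
  show "distinct (sorted_list_of_set S @ sorted_list_of_set T)"
    using assms by auto
qed (use assms in auto)

locale root_chain = kac_moody_roots pairing r \<alpha> \<omega> \<rho> ht
  for pairing :: "'v::real_vector \<Rightarrow> 'v \<Rightarrow> real"  ("\<langle>_, _\<rangle>")
    and r :: nat and \<alpha> \<omega> :: "nat \<Rightarrow> 'v" and \<rho> :: 'v and ht :: "'v \<Rightarrow> real" +
  fixes l :: 'v and I :: "'i::linorder set" and \<beta> :: "'i \<Rightarrow> 'v"
  assumes chain: "lambda_chain l I \<beta>"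
begin

subsection \<open>Products of reflections along a chain\<close>

lemma inv_weyl:
  assumes "w \<in> weyl" shows "w (inv w a) = a" "inv w (w a) = a" "inv w \<in> weyl" "bij w"
proof -
  obtain v where v: "v \<in> weyl" "v \<circ> w = id" "w \<circ> v = id" using weyl_inverse[OF assms] by blast
  then show b: "bij w" using o_bij by blast
  have "inv w = v" using inv_unique_comp v by blast
  then show "inv w \<in> weyl" using v by simp
  show "w (inv w a) = a" using b by (simp add: bij_is_surj surj_f_inv_f)
  show "inv w (w a) = a" using b by (simp add: bij_is_inj)
qed

lemma weyl_coroot: "w \<in> weyl \<Longrightarrow> \<langle>w u, coroot a\<rangle> = \<langle>u, coroot (inv w a)\<rangle>"
proof -
  assume w: "w \<in> weyl"
  have "\<langle>w u, w (inv w a)\<rangle> = \<langle>u, inv w a\<rangle>" "\<langle>w (inv w a), w (inv w a)\<rangle> = \<langle>inv w a, inv w a\<rangle>"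
    using weyl_linear_isometry(2)[OF w] by blast+
  then show ?thesis unfolding inv_weyl(1)[OF w] by (simp add: coroot_def pairing_simps)
qed

lemma inv_reflect_comp:
  assumes "w \<in> weyl" "b \<in> roots" shows "inv (w \<circ> reflect b) a = reflect b (inv w a)"
    "inv (reflect b \<circ> w) a = inv w (reflect b a)"
proof -
  have irb: "inv (reflect b) = reflect b"
    using inv_unique_comp[OF refl_refl refl_refl] root_norm_nz[OF assms(2)] by metis
  have b: "bij w" "bij (reflect b)" using inv_weyl(4) refl_root_weyl assms by blast+
  show "inv (w \<circ> reflect b) a = reflect b (inv w a)" "inv (reflect b \<circ> w) a = inv w (reflect b a)"
    unfolding o_inv_distrib[OF b] o_inv_distrib[OF b(2,1)] irb comp_apply by (rule refl)+
qed

lemma beta_pos: "i \<in> I \<Longrightarrow> \<beta> i \<in> pos_roots"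
  using conjunct1[OF chain[unfolded lambda_chain_def]] by (rule bspec)

lemma beta_root: "i \<in> I \<Longrightarrow> \<beta> i \<in> roots"
  using beta_pos pos_roots_roots by blast

lemma finite_beta: "finite {i \<in> I. \<beta> i = a}"
proof (cases "a \<in> pos_roots")
  case False
  then have "{i \<in> I. \<beta> i = a} = {}" using beta_pos by auto
  then show ?thesis by (simp only: finite.emptyI)
qed (use chain in \<open>auto simp: lambda_chain_def\<close>)

definition below :: "'i \<Rightarrow> 'i set" where "below i = {j \<in> I. j < i}"

text \<open>Initial segments serve as positions in the chain: \<open>below i\<close> stands for just
  before i, \<open>insert i (below i)\<close> for just after it, and \<open>I\<close> for
  infinity.\<close>

definition cut :: "'i set \<Rightarrow> bool" where
  "cut L \<longleftrightarrow> L \<subseteq> I \<and> (\<forall>i\<in>L. \<forall>j\<in>I. j < i \<longrightarrow> j \<in> L)"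

lemma cut_below [simp]: "cut (below i)"
  unfolding cut_def below_def by auto

lemma cut_I [simp]: "cut I"
  unfolding cut_def by auto

lemma cut_empty [simp]: "cut {}"
  unfolding cut_def by auto

lemma cut_subset: "cut L \<Longrightarrow> L \<subseteq> I"
  unfolding cut_def by auto

lemma cut_insert_below: "k \<in> I \<Longrightarrow> cut (insert k (below k))"
  unfolding cut_def below_def by auto

lemma below_subset_cut: "cut L \<Longrightarrow> i \<in> L \<Longrightarrow> below i \<subseteq> L"
  unfolding cut_def below_def by auto

definition rprod :: "'i set \<Rightarrow> 'v \<Rightarrow> 'v" where
  "rprod S = refl_product \<beta> (sorted_list_of_set S)"

text \<open>The affine counterpart of \<open>rprod S\<close> is \<open>\<lambda>v. weight v I \<beta> S\<close>.\<close>

definition lev0 :: "'i \<Rightarrow> int" where "lev0 i = int (card {j \<in> I. j < i \<and> \<beta> j = \<beta> i})"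

lemma rprod_empty [simp]: "rprod {} = id"
  by (simp add: rprod_def refl_product_def)

lemma rprod_singleton [simp]: "rprod {j} = reflect (\<beta> j)"
  by (simp add: rprod_def refl_product_def)

lemma refl_product_append: "refl_product \<beta> (xs @ ys) = refl_product \<beta> xs \<circ> refl_product \<beta> ys"
  unfolding refl_product_def by (induction xs) (auto simp: comp_assoc)

lemma rprod_Un:
  "finite S \<Longrightarrow> finite T \<Longrightarrow> (\<And>x y. x \<in> S \<Longrightarrow> y \<in> T \<Longrightarrow> x < y) \<Longrightarrow> rprod (S \<union> T) = rprod S \<circ> rprod T"
  unfolding rprod_def by (simp add: sorted_list_of_set_append refl_product_append)

lemma rprod_weyl: "finite S \<Longrightarrow> S \<subseteq> I \<Longrightarrow> rprod S \<in> weyl"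
proof -
  have "set xs \<subseteq> I \<Longrightarrow> refl_product \<beta> xs \<in> weyl" for xs
  proof (induction xs)
    case (Cons x xs)
    then have "reflect (\<beta> x) \<circ> refl_product \<beta> xs \<in> weyl"
      using weyl_comp refl_root_weyl beta_root by simp
    moreover have "refl_product \<beta> (x # xs) = reflect (\<beta> x) \<circ> refl_product \<beta> xs"
      by (simp add: refl_product_def)
    ultimately show ?case by (simp only:)
  qed (simp add: refl_product_def id_weyl)
  then show "finite S \<Longrightarrow> S \<subseteq> I \<Longrightarrow> ?thesis" unfolding rprod_def by simp
qed

lemma weight_empty [simp]: "weight v I \<beta> {} = v"
  by (simp add: weight_def)

lemma weight_singleton [simp]: "weight v I \<beta> {j} = aff_refl (\<beta> j) (lev0 j) v"
  by (simp add: weight_def lev0_def)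

lemma weight_Un:
  "finite S \<Longrightarrow> finite T \<Longrightarrow> (\<And>x y. x \<in> S \<Longrightarrow> y \<in> T \<Longrightarrow> x < y) \<Longrightarrow>
    weight v I \<beta> (S \<union> T) = weight (weight v I \<beta> T) I \<beta> S"
  unfolding weight_def by (simp add: sorted_list_of_set_append)

lemma weight_affine: "finite S \<Longrightarrow> weight v I \<beta> S = rprod S v + weight 0 I \<beta> S"
proof -
  have "foldr (\<lambda>i. aff_refl (\<beta> i) (f i)) xs v = refl_product \<beta> xs v + foldr (\<lambda>i. aff_refl (\<beta> i) (f i)) xs 0"
    for xs f
    by (induction xs) (auto simp: refl_product_def aff_refl_def linear_add[OF linear_refl])
  then show ?thesis unfolding weight_def rprod_def .
qed

lemma rprod_insert_above:
  "finite S \<Longrightarrow> (\<And>x. x \<in> S \<Longrightarrow> x < j) \<Longrightarrow> rprod (insert j S) = rprod S \<circ> reflect (\<beta> j)"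
  using rprod_Un[of S "{j}"] by simp

lemma weight_insert_above:
  "finite S \<Longrightarrow> (\<And>x. x \<in> S \<Longrightarrow> x < j) \<Longrightarrow>
    weight v I \<beta> (insert j S) = weight (aff_refl (\<beta> j) (lev0 j) v) I \<beta> S"
  using weight_Un[of S "{j}"] by simp

text \<open>Folding begins with the largest element of \<open>J\<close>, so every fold happens at a
  still unfolded index and multiplies all later roots on the left. The root at i thus involves only
  the elements of \<open>J\<close> below i.\<close>

lemma folding_at:
  assumes "finite J"
  shows "gam \<beta> J i = rprod {j \<in> J. j < i} (\<beta> i)" "eps \<beta> J i = (if i \<in> J then -1 else 1)"
proof -
  have *: "fst (fst (foldr fold_at js ((\<lambda>i. (\<beta> i, 1)), \<rho>)) i) = refl_product \<beta> (filter (\<lambda>j. j < i) js) (\<beta> i) \<and>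
     snd (fst (foldr fold_at js ((\<lambda>i. (\<beta> i, 1)), \<rho>)) i) = (if i \<in> set js then -1 else 1)"
    if "sorted js" "distinct js" for js i
    using that
  proof (induction js arbitrary: i)
    case Nil
    then show ?case by (simp add: refl_product_def)
  next
    case (Cons a js)
    have less: "\<forall>x\<in>set js. a < x" using Cons.prems by (auto simp: less_le)
    define G where "G = foldr fold_at js ((\<lambda>i. (\<beta> i, 1)), \<rho>)"
    have IH: "fst (fst G i) = refl_product \<beta> (filter (\<lambda>j. j < i) js) (\<beta> i)"
       "snd (fst G i) = (if i \<in> set js then -1 else 1)" for i
      using Cons unfolding G_def by auto
    have fa: "filter (\<lambda>j. j < a) js = []" "a \<notin> set js" using less by (auto simp: filter_empty_conv)
    have ga: "fst (fst G a) = \<beta> a" "snd (fst G a) = 1" using IH[of a] fa by (auto simp: refl_product_def)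
    have fG: "foldr fold_at (a # js) ((\<lambda>i. (\<beta> i, 1)), \<rho>) = fold_at a G" unfolding G_def by simp
    consider "i < a" | "i = a" | "a < i" by fastforce
    then show ?case
    proof cases
      case 1
      then have "filter (\<lambda>j. j < i) js = []" "i \<notin> set js" using less by (auto simp: filter_empty_conv)
      moreover have "\<not> a < i" "i \<noteq> a" using 1 by auto
      ultimately show ?thesis using IH[of i] unfolding fG
        by (simp add: fold_at_def case_prod_beta refl_product_def)
    next
      case 2
      then show ?thesis using fa ga unfolding fG by (simp add: fold_at_def case_prod_beta refl_product_def)
    next
      case 3
      moreover have "\<not> i < a" "i \<noteq> a" using 3 by auto
      ultimately show ?thesis using IH[of i] ga unfolding fG by (simp add: fold_at_def case_prod_beta refl_product_def)
    qed
  qed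
  have "filter (\<lambda>j. j < i) (sorted_list_of_set J) = sorted_list_of_set {j \<in> J. j < i}"
    by (rule sorted_distinct_set_unique) (use assms in \<open>auto intro: sorted_filter[of id, simplified]\<close>)
  then show "gam \<beta> J i = rprod {j \<in> J. j < i} (\<beta> i)" "eps \<beta> J i = (if i \<in> J then -1 else 1)"
    using *[of "sorted_list_of_set J" i] assms unfolding gam_def eps_def folding_def rprod_def by auto
qed

lemma Int_below: "J \<subseteq> I \<Longrightarrow> J \<inter> below i = {j \<in> J. j < i}"
  unfolding below_def by auto

abbreviation wat :: "'i set \<Rightarrow> 'i set \<Rightarrow> 'v \<Rightarrow> 'v" where "wat J L \<equiv> rprod (J \<inter> L)"

lemma gam_wat: "finite J \<Longrightarrow> J \<subseteq> I \<Longrightarrow> gam \<beta> J i = wat J (below i) (\<beta> i)"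
  using folding_at(1) Int_below by simp

subsection \<open>Signed counts and the chain condition\<close>

text \<open>The odd extension of the counting function, in place of the convention N(-a) = 1 - N(a).
  It is additive in \<open>L\<close>, and on \<open>I\<close> it gives the pairing of l with every
  coroot, positive or negative.\<close>

definition ncount :: "'i set \<Rightarrow> 'v \<Rightarrow> int" where
  "ncount L a = (if a \<in> pos_roots then int (card {j \<in> L. \<beta> j = a}) else - int (card {j \<in> L. \<beta> j = - a}))"

lemma ncount_minus: "a \<in> roots \<Longrightarrow> ncount L (- a) = - ncount L a"
  using not_pos_iff[of a] not_pos_iff[of "- a"] minus_roots[of a] unfolding ncount_def by auto

lemma ncount_Un:
  assumes "S \<union> T \<subseteq> I" "S \<inter> T = {}" shows "ncount (S \<union> T) a = ncount S a + ncount T a"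
proof -
  have "card {j \<in> S \<union> T. \<beta> j = b} = card {j \<in> S. \<beta> j = b} + card {j \<in> T. \<beta> j = b}" for b
  proof -
    have "{j \<in> S \<union> T. \<beta> j = b} = {j \<in> S. \<beta> j = b} \<union> {j \<in> T. \<beta> j = b}" by auto
    moreover have "finite {j \<in> S. \<beta> j = b}" "finite {j \<in> T. \<beta> j = b}"
      using assms by (auto intro!: finite_subset[OF _ finite_beta[of b]])
    ultimately show ?thesis using assms(2) by (simp add: card_Un_disjoint disjoint_iff)
  qed
  then show ?thesis unfolding ncount_def by simp
qed

lemma ncount_singleton:
  "k \<in> I \<Longrightarrow> b \<in> roots \<Longrightarrow> ncount {k} b = (if b = \<beta> k then 1 else if b = - \<beta> k then -1 else 0)"
proof -
  assume k: "k \<in> I" "b \<in> roots"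
  have "{j. j = k \<and> \<beta> j = c} = (if \<beta> k = c then {k} else {})" for c by auto
  moreover have "\<beta> k \<noteq> - \<beta> k" using pos_not_neg[OF beta_pos[OF k(1)]] beta_pos[OF k(1)] by metis
  ultimately show ?thesis unfolding ncount_def
    using beta_pos[OF k(1)] pos_not_neg[OF beta_pos[OF k(1)]] by auto
qed

lemma ncount_I: "a \<in> roots \<Longrightarrow> real_of_int (ncount I a) = \<langle>l, coroot a\<rangle>"
proof -
  have pos: "real (card {i \<in> I. \<beta> i = a}) = \<langle>l, coroot a\<rangle>" if "a \<in> pos_roots" for a
    using chain that unfolding lambda_chain_def by blast
  show "a \<in> roots \<Longrightarrow> ?thesis"
    using pos[of a] pos[of "- a"] root_pos_or_neg[of a] unfolding ncount_def by (auto simp: coroot_minus)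
qed

lemma lev0_ncount: "k \<in> I \<Longrightarrow> lev0 k = ncount (below k) (\<beta> k)"
  using beta_pos unfolding lev0_def ncount_def below_def by (simp add: conj_ac)

lemma coroot_reflect:
  assumes "\<langle>b, b\<rangle> \<noteq> 0" "\<langle>x, x\<rangle> \<noteq> 0"
  shows "coroot (reflect x b) = coroot b - \<langle>x, coroot b\<rangle> *\<^sub>R coroot x"
  using assms unfolding coroot_def refl_isometry[OF assms(2)]
  by (simp add: reflect_def coroot_def pairing_simps scaleR_diff_right sym_pairing[of x b])

lemma root_pairing_int: "a \<in> roots \<Longrightarrow> b \<in> roots \<Longrightarrow> \<langle>b, coroot a\<rangle> \<in> \<int>"
proof -
  assume ab: "a \<in> roots" "b \<in> roots"
  obtain w p where w: "w \<in> weyl" "p \<in> {1..r}" "a = w (\<alpha> p)" using ab unfolding roots_def by blast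
  have "inv w a = \<alpha> p" using inv_weyl(2)[OF w(1)] w(3) by simp
  then have eq: "\<langle>b, coroot a\<rangle> = \<langle>inv w b, coroot (\<alpha> p)\<rangle>"
    using weyl_coroot[OF w(1), of "inv w b" a] inv_weyl(1)[OF w(1)] by simp
  obtain c :: "nat \<Rightarrow> int" where c: "inv w b = (\<Sum>p\<in>{1..r}. of_int (c p) *\<^sub>R \<alpha> p)"
    using root_int_coeffs weyl_roots[OF inv_weyl(3)[OF w(1)] ab(2)] by blast
  show ?thesis unfolding eq c pairing_sum using w(2) cartan_int'
    by (intro Ints_sum) (auto simp: pairing_simps simp del: atLeastAtMost_iff)
qed

text \<open>The only use of condition (2) on \<open>\<lambda>\<close>-chains. The summands \<open>0\<close> or \<open>1\<close> turn the odd function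
  \<open>ncount\<close> into \<open>chain_count\<close>.\<close>

lemma chain_reflect:
  assumes k: "k \<in> I" and b: "b \<in> roots"
  shows "real_of_int (ncount (below k) b + (if b \<in> pos_roots then 0 else 1)) =
    ncount (below k) (reflect (\<beta> k) b) + (if reflect (\<beta> k) b \<in> pos_roots then 0 else 1)
    + ncount {k} (reflect (\<beta> k) b) + lev0 k * \<langle>\<beta> k, coroot b\<rangle>"
proof -
  let ?x = "\<beta> k" and ?c = "reflect (\<beta> k) b"
  have x: "?x \<in> roots" "?x \<in> pos_roots" using beta_root beta_pos k by auto
  have xx: "reflect ?x ?x = - ?x" using reflect_self root_norm_nz x by blast
  have c: "?c \<in> roots" using weyl_roots refl_root_weyl x b by blast
  have nx: "- ?x \<notin> pos_roots" using pos_not_neg x by blast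
  have lev: "ncount (below k) ?x = lev0 k" using lev0_ncount k by simp
  \<comment> \<open>Condition (2) is silent about proportional roots. For b = \<beta> k and its
    negative the identity is computed directly, the term for {k} compensating the change of
    sign.\<close>
  consider "b = ?x" | "b = - ?x" | "b \<noteq> ?x" "b \<noteq> - ?x" by blast
  then show ?thesis
  proof cases
    case 1
    have "ncount {k} (- ?x) = -1" using ncount_minus[OF x(1)] ncount_singleton[OF k x(1)] by simp
    then show ?thesis unfolding 1 xx
      using x nx lev ncount_minus[OF x(1)] pair_coroot_self[OF root_norm_nz[OF x(1)]] by simp
  next
    case 2
    have "reflect ?x (- ?x) = ?x" using xx reflect_minus by simp
    moreover have "ncount {k} ?x = 1" using ncount_singleton[OF k x(1)] by simp
    ultimately show ?thesis unfolding 2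
      using x nx lev ncount_minus[OF x(1)] pair_coroot_self[OF root_norm_nz[OF x(1)]]
      by (simp add: coroot_minus)
  next
    case 3
    have "?c \<noteq> ?x" "?c \<noteq> - ?x"
      using 3 root_refl_refl[OF x(1), of b] xx reflect_minus[of ?x ?x] by auto
    then have n0: "ncount {k} ?c = 0" using ncount_singleton[OF k c] by simp
    obtain m where m: "\<langle>?x, coroot b\<rangle> = of_int m" using root_pairing_int[OF b x(1)] by (auto elim: Ints_cases)
    have "coroot ?c = coroot b + of_int (- m) *\<^sub>R coroot ?x"
      using coroot_reflect[OF root_norm_nz[OF b] root_norm_nz[OF x(1)]] m by simp
    then have cc: "chain_count I \<beta> k ?c = chain_count I \<beta> k b + (- m) * chain_count I \<beta> k ?x"
      using chain b x(1) c k 3 unfolding lambda_chain_def by blast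
    have eq: "chain_count I \<beta> k a = ncount (below k) a + (if a \<in> pos_roots then 0 else 1)" for a
      unfolding chain_count_def ncount_def below_def by (simp add: conj_assoc)
    show ?thesis using cc n0 m lev x(2) unfolding eq
      by (simp flip: of_int_mult of_int_add)
  qed
qed

subsection \<open>Levels as values of an affine functional\<close>

definition psum :: "'i set \<Rightarrow> 'v \<Rightarrow> 'i set \<Rightarrow> int" where
  "psum J a L = (\<Sum>j | j \<in> L \<and> j \<notin> J \<and> (gam \<beta> J j = a \<or> gam \<beta> J j = - a). root_sgn (gam \<beta> J j))"

text \<open>At \<open>below i\<close> with folded root \<plusminus>a this is the level of i
  (\<open>level_eq\<close>), and at \<open>I\<close> it is the pairing of the weight with the coroot
  of a (\<open>weight_coroot\<close>). The offset 0 or -1 replaces \<delta>' at cuts where no folded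
  root supplies a sign.\<close>

definition height :: "'i set \<Rightarrow> 'v \<Rightarrow> 'i set \<Rightarrow> int" where
  "height J a L = psum J a L + (if inv (wat J L) a \<in> pos_roots then 0 else -1)"

definition hyp :: "'i set \<Rightarrow> 'v \<Rightarrow> 'i set" where
  "hyp J a = {i \<in> I. gam \<beta> J i = a \<or> gam \<beta> J i = - a}"

text \<open>Even for an infinite chain only finitely many subsets of \<open>J\<close> occur as
  \<open>J \<inter> below i\<close>, and each of them determines \<beta> i up to sign.\<close>

lemma finite_hyp:
  assumes "finite J" "J \<subseteq> I" shows "finite (hyp J a)"
proof (rule finite_subset)
  show "hyp J a \<subseteq> (\<Union>S\<in>Pow J. {i \<in> I. \<beta> i = inv (rprod S) a} \<union> {i \<in> I. \<beta> i = inv (rprod S) (- a)})"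
  proof
    fix i assume i: "i \<in> hyp J a"
    have w: "wat J (below i) \<in> weyl" using rprod_weyl assms by (metis finite_Int inf.coboundedI1)
    have "\<beta> i = inv (wat J (below i)) (gam \<beta> J i)" using inv_weyl(2)[OF w] gam_wat assms by simp
    then show "i \<in> (\<Union>S\<in>Pow J. {i \<in> I. \<beta> i = inv (rprod S) a} \<union> {i \<in> I. \<beta> i = inv (rprod S) (- a)})"
      using i unfolding hyp_def by (intro UN_I[of "J \<inter> below i"]) auto
  qed
  show "finite (\<Union>S\<in>Pow J. {i \<in> I. \<beta> i = inv (rprod S) a} \<union> {i \<in> I. \<beta> i = inv (rprod S) (- a)})"
    using assms finite_beta by auto
qed

lemma psum_Un:
  assumes "finite J" "J \<subseteq> I" "S \<union> T \<subseteq> I" "S \<inter> T = {}"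
  shows "psum J a (S \<union> T) = psum J a S + psum J a T"
proof -
  let ?A = "\<lambda>L. {j. j \<in> L \<and> j \<notin> J \<and> (gam \<beta> J j = a \<or> gam \<beta> J j = - a)}"
  have "finite (?A S)" "finite (?A T)"
    using assms by (auto intro!: finite_subset[OF _ finite_hyp[of J a]] simp: hyp_def)
  moreover have "?A (S \<union> T) = ?A S \<union> ?A T" by auto
  ultimately show ?thesis unfolding psum_def using assms(4) by (simp add: sum.union_disjoint disjoint_iff)
qed

text \<open>Where the folding is by one fixed w, a folded root is \<plusminus>a exactly if the
  original one is \<plusminus>w^-1(a); since original roots are positive, all counted terms have the
  sign of w^-1(a).\<close>

lemma psum_fixed:
  assumes "w \<in> weyl" "a \<in> pos_roots" "T \<subseteq> I" "\<And>j. j \<in> T \<Longrightarrow> j \<notin> J \<and> gam \<beta> J j = w (\<beta> j)"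
  shows "psum J a T = ncount T (inv w a)"
proof -
  have ar: "a \<in> roots" using assms pos_roots_roots by blast
  define c where "c = inv w a"
  have c: "c \<in> roots" unfolding c_def using weyl_roots[OF inv_weyl(3)] assms(1) ar by blast
  have wc: "w c = a" "w (- c) = - a" unfolding c_def using inv_weyl(1)[OF assms(1)] weyl_minus[OF assms(1)] by auto
  have inj: "w x = w y \<longleftrightarrow> x = y" for x y using inv_weyl(2)[OF assms(1)] by metis
  have na: "- a \<notin> pos_roots" using pos_not_neg assms(2) by blast
  have set: "{j. j \<in> T \<and> j \<notin> J \<and> (gam \<beta> J j = a \<or> gam \<beta> J j = - a)} = {j \<in> T. \<beta> j = c \<or> \<beta> j = - c}"
    using assms(4) wc inj by auto metis+
  show ?thesis
  proof (cases "c \<in> pos_roots")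
    case True
    then have "\<beta> j \<noteq> - c" if "j \<in> T" for j using pos_not_neg[OF True] beta_pos[of j] assms(3) that by auto
    then have "{j \<in> T. \<beta> j = c \<or> \<beta> j = - c} = {j \<in> T. \<beta> j = c}" by auto
    moreover have "(\<Sum>j\<in>{j \<in> T. \<beta> j = c}. root_sgn (gam \<beta> J j)) = (\<Sum>j\<in>{j \<in> T. \<beta> j = c}. 1)"
      by (rule sum.cong) (use assms wc in \<open>auto simp: root_sgn_def\<close>)
    ultimately show ?thesis unfolding psum_def set ncount_def c_def[symmetric] using True by simp
  next
    case False
    then have "\<beta> j \<noteq> c" if "j \<in> T" for j using beta_pos[of j] assms(3) that by auto
    then have "{j \<in> T. \<beta> j = c \<or> \<beta> j = - c} = {j \<in> T. \<beta> j = - c}" by auto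
    moreover have "(\<Sum>j\<in>{j \<in> T. \<beta> j = - c}. root_sgn (gam \<beta> J j)) = (\<Sum>j\<in>{j \<in> T. \<beta> j = - c}. - 1)"
      by (rule sum.cong) (use assms wc na in \<open>auto simp: root_sgn_def\<close>)
    ultimately show ?thesis unfolding psum_def set ncount_def c_def[symmetric] using False by simp
  qed
qed

text \<open>Induction on the number of folded indices in \<open>L\<close>, going back to the cut
  below the last one, k. Beyond k the folding is constant, k itself adds nothing to
  \<open>psum\<close>, and what remains to be compared is \<open>chain_reflect\<close>.\<close>

lemma height_eq:
  assumes J: "finite J" "J \<subseteq> I" and a: "a \<in> pos_roots" and L: "cut L"
  shows "real_of_int (height J a L) = ncount L (inv (wat J L) a) + \<langle>weight 0 I \<beta> (J \<inter> L), coroot a\<rangle>"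
  using L
proof (induction "card (J \<inter> L)" arbitrary: L)
  case 0
  then have e: "J \<inter> L = {}" using J by simp
  have "J \<inter> below j = {}" if "j \<in> L" for j using e below_subset_cut[OF 0(2) that] by auto
  then have "psum J a L = ncount L (inv id a)"
    using e gam_wat[OF J] cut_subset[OF 0(2)] id_weyl a by (intro psum_fixed) auto
  then show ?case unfolding height_def e using a by simp
next
  case (Suc n)
  define k where "k = Max (J \<inter> L)"
  have fin: "finite (J \<inter> L)" using J by simp
  have ne: "J \<inter> L \<noteq> {}" using Suc(2) by force
  have k: "k \<in> J" "k \<in> L" using Max_in[OF fin ne] unfolding k_def by auto
  have kmax: "j \<le> k" if "j \<in> J \<inter> L" for j using Max_ge[OF fin that] unfolding k_def .
  have kI: "k \<in> I" using k J by auto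
  have xr: "\<beta> k \<in> roots" using beta_root kI .
  have LI: "L \<subseteq> I" using cut_subset Suc by blast
  have bL: "below k \<subseteq> L" using below_subset_cut Suc k by blast
  have JL: "J \<inter> L = insert k (J \<inter> below k)" using k kmax bL LI unfolding below_def by force
  have kb: "k \<notin> J \<inter> below k" unfolding below_def by simp
  have finb: "finite (J \<inter> below k)" using J by simp
  have "n = card (J \<inter> below k)" using Suc(2) unfolding JL using kb finb by simp
  then have IH: "real_of_int (height J a (below k)) =
      ncount (below k) (inv (wat J (below k)) a) + \<langle>weight 0 I \<beta> (J \<inter> below k), coroot a\<rangle>"
    using Suc(1) by simp
  define w0 where "w0 = wat J (below k)"
  have w0: "w0 \<in> weyl" unfolding w0_def using rprod_weyl[OF finb] J by blast
  have ltk: "x < k" if "x \<in> J \<inter> below k" for x using that unfolding below_def by auto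
  have w: "wat J L = w0 \<circ> reflect (\<beta> k)" unfolding JL w0_def using rprod_insert_above[OF finb ltk] by simp
  have ww: "wat J L \<in> weyl" unfolding w using weyl_comp[OF w0 refl_root_weyl[OF xr]] .
  define b where "b = inv w0 a"
  have b: "b \<in> roots" unfolding b_def using weyl_roots[OF inv_weyl(3)[OF w0] pos_roots_roots[OF a]] .
  define c where "c = reflect (\<beta> k) b"
  have c: "inv (wat J L) a = c" unfolding w c_def b_def using inv_reflect_comp(1)[OF w0 xr] .
  define L1 where "L1 = {j \<in> L. k < j}"
  have L: "L = (below k \<union> {k}) \<union> L1" "(below k \<union> {k}) \<inter> L1 = {}" "below k \<inter> {k} = {}"
    using k bL LI unfolding L1_def below_def by auto
  have nL: "ncount L c = ncount (below k) c + ncount {k} c + ncount L1 c"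
    using ncount_Un[of "below k \<union> {k}" L1 c] ncount_Un[of "below k" "{k}" c] L LI by auto
  have g1: "j \<notin> J \<and> gam \<beta> J j = wat J L (\<beta> j)" if j: "j \<in> L1" for j
  proof
    have jL: "j \<in> L" "k < j" using j unfolding L1_def by auto
    show "j \<notin> J" using kmax[of j] jL by auto
    have "J \<inter> below j = J \<inter> L"
      using jL kmax below_subset_cut[OF Suc(3) jL(1)] J LI unfolding below_def by force
    then show "gam \<beta> J j = wat J L (\<beta> j)" using gam_wat[OF J] by simp
  qed
  have "L1 \<subseteq> I" using LI unfolding L1_def by blast
  then have "psum J a L1 = ncount L1 c"
    using psum_fixed[OF ww a, of L1 J] g1 unfolding c by blast
  moreover have "psum J a {k} = 0" unfolding psum_def using k(1) by (intro sum.neutral) auto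
  ultimately have gL: "psum J a L = psum J a (below k) + ncount L1 c"
    using psum_Un[OF J, of "below k \<union> {k}" L1 a] psum_Un[OF J, of "below k" "{k}" a] L LI by auto
  have z: "\<langle>weight 0 I \<beta> (J \<inter> L), coroot a\<rangle> =
      lev0 k * \<langle>\<beta> k, coroot b\<rangle> + \<langle>weight 0 I \<beta> (J \<inter> below k), coroot a\<rangle>"
  proof -
    have "weight 0 I \<beta> (J \<inter> L) = weight (of_int (lev0 k) *\<^sub>R \<beta> k) I \<beta> (J \<inter> below k)"
      unfolding JL using weight_insert_above[OF finb ltk] by (simp add: aff_refl_def linear_0[OF linear_refl])
    also have "\<dots> = of_int (lev0 k) *\<^sub>R w0 (\<beta> k) + weight 0 I \<beta> (J \<inter> below k)"
      using weight_affine[OF finb, of "of_int (lev0 k) *\<^sub>R \<beta> k"] linear_cmul[OF weyl_linear_isometry(1)[OF w0]]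
      unfolding w0_def[symmetric] by simp
    finally show ?thesis using weyl_coroot[OF w0, of "\<beta> k" a] unfolding b_def by (simp add: pairing_simps)
  qed
  define e :: "'v \<Rightarrow> int" where "e = (\<lambda>x. if x \<in> pos_roots then 0 else 1)"
  have "height J a L = psum J a (below k) + ncount L1 c - e c"
    unfolding height_def c gL e_def by simp
  moreover have "height J a (below k) = psum J a (below k) - e b"
    unfolding height_def w0_def[symmetric] b_def e_def by simp
  moreover have "real_of_int (ncount (below k) b) + e b =
      ncount (below k) c + e c + ncount {k} c + lev0 k * \<langle>\<beta> k, coroot b\<rangle>"
    using chain_reflect[OF kI b] unfolding e_def c_def[symmetric] by simp
  ultimately show ?case
    using IH unfolding c nL z w0_def[symmetric] b_def[symmetric] by simp
qed

text \<open>On all of \<open>I\<close>, condition (1) turns the count in \<open>height_eq\<close>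
  into the pairing of l, which completes the translation part to the full affine image.\<close>

lemma weight_coroot:
  assumes J: "finite J" "J \<subseteq> I" and a: "a \<in> pos_roots"
  shows "\<langle>weight l I \<beta> J, coroot a\<rangle> = real_of_int (height J a I)"
proof -
  have JI: "J \<inter> I = J" using J by blast
  have w: "rprod J \<in> weyl" using rprod_weyl J by blast
  have "inv (rprod J) a \<in> roots" using weyl_roots[OF inv_weyl(3)[OF w] pos_roots_roots[OF a]] .
  then show ?thesis
    using height_eq[OF J a cut_I] ncount_I weyl_coroot[OF w] unfolding JI
    by (simp add: weight_affine[OF J(1), of l] pairing_simps)
qed

text \<open>As \<beta> i is positive, the sign of the folded root is that of w^-1(a). This
  identifies the offset in \<open>height\<close> with \<delta>'.\<close>

lemma hyp_sign:
  assumes J: "finite J" "J \<subseteq> I" and a: "a \<in> pos_roots" and i: "i \<in> hyp J a"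
  shows "gam \<beta> J i = a \<longleftrightarrow> inv (wat J (below i)) a \<in> pos_roots"
    "gam \<beta> J i \<in> pos_roots \<longleftrightarrow> gam \<beta> J i = a"
proof -
  have w: "wat J (below i) \<in> weyl" using rprod_weyl J by (metis finite_Int inf.coboundedI1)
  have iI: "i \<in> I" using i unfolding hyp_def by blast
  have na: "- a \<notin> pos_roots" using pos_not_neg a by blast
  have nb: "- \<beta> i \<notin> pos_roots" using pos_not_neg beta_pos[OF iI] by blast
  have g: "wat J (below i) (\<beta> i) = a \<or> wat J (below i) (- \<beta> i) = a"
    using i gam_wat[OF J] weyl_minus[OF w] unfolding hyp_def by auto
  show "gam \<beta> J i \<in> pos_roots \<longleftrightarrow> gam \<beta> J i = a" using i a na unfolding hyp_def by auto
  show "gam \<beta> J i = a \<longleftrightarrow> inv (wat J (below i)) a \<in> pos_roots"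
  proof (cases "gam \<beta> J i = a")
    case True
    then have "inv (wat J (below i)) a = \<beta> i" using gam_wat[OF J] inv_weyl(2)[OF w] by metis
    then show ?thesis using True beta_pos[OF iI] by simp
  next
    case False
    then have "wat J (below i) (- \<beta> i) = a" using g gam_wat[OF J] by simp
    then have "inv (wat J (below i)) a = - \<beta> i" using inv_weyl(2)[OF w] by metis
    then show ?thesis using False nb by simp
  qed
qed

lemma level_eq:
  assumes J: "finite J" "J \<subseteq> I" and a: "a \<in> pos_roots" and i: "i \<in> hyp J a"
  shows "level I \<beta> J i = height J a (below i)"
proof -
  have "{j. j \<in> I \<and> j < i \<and> eps \<beta> J j = 1 \<and> (gam \<beta> J j = gam \<beta> J i \<or> gam \<beta> J j = - gam \<beta> J i)} =
     {j. j \<in> below i \<and> j \<notin> J \<and> (gam \<beta> J j = a \<or> gam \<beta> J j = - a)}"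
    using i folding_at(2)[OF J(1)] unfolding hyp_def below_def by auto
  then show ?thesis
    unfolding level_def height_def psum_def using hyp_sign[OF assms] by simp
qed

subsection \<open>Flipping one element\<close>

lemma wat_weyl: "finite J \<Longrightarrow> J \<subseteq> I \<Longrightarrow> wat J L \<in> weyl"
  using rprod_weyl by (metis finite_Int inf.coboundedI1)

lemma root_aff_invol: "a \<in> roots \<Longrightarrow> aff_refl a n (aff_refl a n v) = v"
  using root_refl_refl reflect_self[OF root_norm_nz]
  by (simp add: aff_refl_def linear_add[OF linear_refl] linear_cmul[OF linear_refl])

text \<open>Conjugation: moving the reflection in \<beta> k to the left past w, the product below k,
  makes it the reflection in w (\<beta> k) = \<plusminus>a. That its level in the affine version is
  the height at k is \<open>height_eq\<close>.\<close>

lemma flip_in: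
  assumes J: "finite J" "J \<subseteq> I" and a: "a \<in> pos_roots" and k: "k \<in> hyp J a" and L: "cut L" "k \<in> L"
  shows "rprod (sym_diff J {k} \<inter> L) = reflect a \<circ> wat J L"
    "weight v I \<beta> (sym_diff J {k} \<inter> L) = aff_refl a (height J a (below k)) (weight v I \<beta> (J \<inter> L))"
proof -
  define A where "A = J \<inter> below k"
  define B where "B = {j \<in> J \<inter> L. k < j}"
  have ar: "a \<in> roots" using a pos_roots_roots by blast
  have kI: "k \<in> I" using k unfolding hyp_def by blast
  have fin: "finite A" "finite B" unfolding A_def B_def using J by auto
  have lt: "\<And>x. x \<in> A \<Longrightarrow> x < k" "\<And>y. y \<in> B \<Longrightarrow> k < y" unfolding A_def B_def below_def by auto
  have fA: "rprod (insert k A) = rprod A \<circ> reflect (\<beta> k)" using rprod_insert_above fin lt by blast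
  have wA: "weight v I \<beta> (insert k A) = weight (aff_refl (\<beta> k) (lev0 k) v) I \<beta> A" for v
    using weight_insert_above fin lt by blast
  have AB: "rprod (A \<union> B) = rprod A \<circ> rprod B" "rprod (insert k A \<union> B) = rprod (insert k A) \<circ> rprod B"
    using lt by (intro rprod_Un; use fin in fastforce)+
  have WAB: "weight v I \<beta> (A \<union> B) = weight (weight v I \<beta> B) I \<beta> A"
    "weight v I \<beta> (insert k A \<union> B) = weight (weight v I \<beta> B) I \<beta> (insert k A)" for v
    using lt by (intro weight_Un; use fin in fastforce)+
  define w where "w = rprod A"
  have w: "w \<in> weyl" unfolding w_def A_def using wat_weyl J by blast
  have gk: "gam \<beta> J k = w (\<beta> k)" unfolding w_def A_def using gam_wat J by blast
  have wk: "w (\<beta> k) = a \<or> w (\<beta> k) = - a" using k gk unfolding hyp_def by auto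
  have wr: "rprod (insert k A) = reflect a \<circ> rprod A"
    using weyl_conj_reflect[OF w, of "\<beta> k"] wk unfolding fA w_def[symmetric] by (auto simp: reflect_uminus)
  define h where "h = height J a (below k)"
  have h: "real_of_int h = ncount (below k) (inv w a) + \<langle>weight 0 I \<beta> A, coroot a\<rangle>"
    using height_eq[OF J a cut_below] unfolding h_def w_def A_def .
  have wW: "weight v I \<beta> (insert k A) = aff_refl a h (weight v I \<beta> A)" for v
  proof -
    define z where "z = weight 0 I \<beta> A"
    have aff: "weight u I \<beta> A = w u + z" for u using weight_affine[OF fin(1), of u] unfolding w_def z_def .
    define c where "c = \<langle>v, coroot (\<beta> k)\<rangle> - lev0 k"
    have lin: "linear w" using weyl_linear_isometry(1)[OF w] .
    have L0: "weight v I \<beta> (insert k A) = w v - c *\<^sub>R w (\<beta> k) + z"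
      unfolding wA aff by (simp add: aff_refl_def reflect_def c_def linear_add[OF lin] linear_diff[OF lin]
          linear_cmul[OF lin] scaleR_diff_left)
    have R0: "aff_refl a h (weight v I \<beta> A) = w v + z - (\<langle>w v, coroot a\<rangle> + \<langle>z, coroot a\<rangle> - h) *\<^sub>R a"
      unfolding aff by (simp add: aff_refl_def reflect_def pairing_simps scaleR_diff_left)
    show ?thesis
    proof (cases "w (\<beta> k) = a")
      case True
      then have "inv w a = \<beta> k" using inv_weyl(2)[OF w] by metis
      then have "\<langle>w v, coroot a\<rangle> + \<langle>z, coroot a\<rangle> - h = c"
        using h weyl_coroot[OF w, of v a] lev0_ncount[OF kI] unfolding c_def z_def by simp
      then show ?thesis unfolding L0 R0 True by simp
    next
      case False
      then have neg: "w (\<beta> k) = - a" using wk by blast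
      then have "w (- \<beta> k) = a" using weyl_minus[OF w] by simp
      then have "inv w a = - \<beta> k" using inv_weyl(2)[OF w] by metis
      then have "\<langle>w v, coroot a\<rangle> + \<langle>z, coroot a\<rangle> - h = - c"
        using h weyl_coroot[OF w, of v a] lev0_ncount[OF kI] ncount_minus[OF beta_root[OF kI]]
        unfolding c_def z_def by (simp add: coroot_minus)
      then show ?thesis unfolding L0 R0 neg by simp
    qed
  qed
  have bL: "below k \<subseteq> L" using below_subset_cut L by blast
  have split: "x = k \<or> x \<in> below k \<or> k < x" if "x \<in> J" for x using that J unfolding below_def by auto
  show "rprod (sym_diff J {k} \<inter> L) = reflect a \<circ> wat J L"
    "weight v I \<beta> (sym_diff J {k} \<inter> L) = aff_refl a h (weight v I \<beta> (J \<inter> L))"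
  proof -
    have "k \<notin> below k" unfolding below_def by simp
    have *: "rprod (sym_diff J {k} \<inter> L) = reflect a \<circ> wat J L \<and>
      weight v I \<beta> (sym_diff J {k} \<inter> L) = aff_refl a h (weight v I \<beta> (J \<inter> L))"
    proof (cases "k \<in> J")
      case True
      then have e: "J \<inter> L = insert k A \<union> B" "sym_diff J {k} \<inter> L = A \<union> B"
        using L(2) bL split \<open>k \<notin> below k\<close> unfolding A_def B_def by auto
      show ?thesis unfolding e AB WAB wr wW root_aff_invol[OF ar]
        using refl_refl[OF root_norm_nz[OF ar]] by (simp add: fun_eq_iff)
    next
      case False
      then have e: "J \<inter> L = A \<union> B" "sym_diff J {k} \<inter> L = insert k A \<union> B"
        using L(2) bL split \<open>k \<notin> below k\<close> unfolding A_def B_def by auto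
      show ?thesis unfolding e AB WAB wr wW by (simp add: comp_assoc)
    qed
    then show "rprod (sym_diff J {k} \<inter> L) = reflect a \<circ> wat J L"
      "weight v I \<beta> (sym_diff J {k} \<inter> L) = aff_refl a h (weight v I \<beta> (J \<inter> L))" by blast+
  qed
qed

lemma flip_finite:
  assumes "finite J" "J \<subseteq> I" "k \<in> hyp J a" shows "finite (sym_diff J {k})" "sym_diff J {k} \<subseteq> I"
  using assms unfolding hyp_def by auto

lemma flip_gam:
  assumes J: "finite J" "J \<subseteq> I" and a: "a \<in> pos_roots" and k: "k \<in> hyp J a"
  shows "gam \<beta> (sym_diff J {k}) i = (if k < i then reflect a (gam \<beta> J i) else gam \<beta> J i)"
proof -
  have kI: "k \<in> I" using k unfolding hyp_def by blast
  note K = flip_finite[OF J k]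
  show ?thesis
  proof (cases "k < i")
    case True
    then have "k \<in> below i" using kI unfolding below_def by simp
    then show ?thesis
      unfolding gam_wat[OF K] gam_wat[OF J] using True flip_in(1)[OF J a k cut_below, of i] by simp
  next
    case False
    then have "sym_diff J {k} \<inter> below i = J \<inter> below i" unfolding below_def by auto
    then show ?thesis unfolding gam_wat[OF K] gam_wat[OF J] using False by simp
  qed
qed

lemma flip_hyp:
  assumes J: "finite J" "J \<subseteq> I" and a: "a \<in> pos_roots" and k: "k \<in> hyp J a"
  shows "hyp (sym_diff J {k}) a = hyp J a"
proof -
  have ar: "a \<in> roots" using a pos_roots_roots by blast
  have ra: "reflect a a = - a" using reflect_self root_norm_nz ar by blast
  have "reflect a x = a \<longleftrightarrow> x = - a" "reflect a x = - a \<longleftrightarrow> x = a" for x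
    using root_refl_refl[OF ar] ra reflect_minus by (metis minus_minus)+
  then show ?thesis unfolding hyp_def flip_gam[OF assms] by auto
qed

text \<open>In \<open>height_eq\<close> the reflection negates w^-1(a), on which
  \<open>ncount\<close> is odd, and negates the pairing up to twice its level.\<close>

lemma flip_height:
  assumes J: "finite J" "J \<subseteq> I" and a: "a \<in> pos_roots" and k: "k \<in> hyp J a" and L: "cut L"
  shows "height (sym_diff J {k}) a L = (if k \<in> L then 2 * height J a (below k) - height J a L else height J a L)"
proof -
  note K = flip_finite[OF J k]
  have ar: "a \<in> roots" using a pos_roots_roots by blast
  have ra: "reflect a a = - a" using reflect_self root_norm_nz ar by blast
  have w: "wat J L \<in> weyl" using wat_weyl[OF J] .
  have iw: "inv (wat J L) a \<in> roots" using weyl_roots[OF inv_weyl(3)[OF w] ar] .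
  have "real_of_int (height (sym_diff J {k}) a L) =
     (if k \<in> L then 2 * height J a (below k) - height J a L else height J a L)"
  proof (cases "k \<in> L")
    case True
    have "inv (reflect a \<circ> wat J L) a = - inv (wat J L) a"
      unfolding inv_reflect_comp(2)[OF w ar] ra using weyl_minus[OF inv_weyl(3)[OF w]] .
    moreover have "\<langle>aff_refl a n v, coroot a\<rangle> = 2 * real_of_int n - \<langle>v, coroot a\<rangle>" for n v
      using pair_coroot_self[OF root_norm_nz[OF ar]] by (simp add: aff_refl_def reflect_def pairing_simps)
    ultimately show ?thesis
      using True height_eq[OF J a L] ncount_minus[OF iw]
      unfolding height_eq[OF K a L] flip_in[OF J a k L True] by simp
  next
    case False
    then have "sym_diff J {k} \<inter> L = J \<inter> L" by auto
    then show ?thesis using False height_eq[OF J a L] unfolding height_eq[OF K a L] by simp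
  qed
  then show ?thesis by simp
qed

subsection \<open>Admissible subsets\<close>

lemma take_sorted_list_of_set:
  fixes J :: "'i set"
  assumes "finite J" "n < card J"
  defines "xs \<equiv> sorted_list_of_set J"
  shows "take n xs = sorted_list_of_set {i \<in> J. i < xs ! n}"
proof -
  have xs: "sorted_wrt (<) xs" "set xs = J" "length xs = card J" unfolding xs_def using assms by auto
  have "set (take n xs) = {i \<in> J. i < xs ! n}"
  proof (intro set_eqI iffI)
    fix x assume "x \<in> set (take n xs)"
    then obtain m where "m < n" "x = xs ! m" using assms xs by (auto simp: in_set_conv_nth)
    then show "x \<in> {i \<in> J. i < xs ! n}"
      using sorted_wrt_nth_less[OF xs(1), of m n] xs assms nth_mem[of m xs] by auto
  next
    fix x assume x: "x \<in> {i \<in> J. i < xs ! n}"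
    then obtain m where m: "m < length xs" "x = xs ! m" using xs by (auto simp: in_set_conv_nth)
    have "m < n"
    proof (rule ccontr)
      assume "\<not> m < n"
      then have "m = n \<or> n < m" by linarith
      then have "m = n \<or> xs ! n < xs ! m" using sorted_wrt_nth_less[OF xs(1), of n m] m by auto
      then show False using x m by auto
    qed
    then show "x \<in> set (take n xs)" using m xs by (auto simp: in_set_conv_nth)
  qed
  then show ?thesis
    by (intro sorted_distinct_set_unique) (use assms in \<open>auto simp: xs_def sorted_wrt_take\<close>)
qed

text \<open>The condition at j depends only on the part of \<open>J\<close> below j, so
  admissibility after a modification can be checked index by index.\<close>

lemma admissible_iff:
  "J \<in> admissible I \<beta> \<longleftrightarrow> finite J \<and> J \<subseteq> I \<and>
    (\<forall>j\<in>J. len (wat J (below j) \<circ> reflect (\<beta> j)) = len (wat J (below j)) + 1)"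
proof (cases "finite J \<and> J \<subseteq> I")
  case True
  then have J: "finite J" "J \<subseteq> I" by auto
  define xs where "xs = sorted_list_of_set J"
  have xs: "set xs = J" "length xs = card J" unfolding xs_def using J by auto
  have cover: "bruhat_cover (refl_product \<beta> (take n xs)) (refl_product \<beta> (take (Suc n) xs)) \<longleftrightarrow>
      len (wat J (below (xs ! n)) \<circ> reflect (\<beta> (xs ! n))) = len (wat J (below (xs ! n))) + 1"
    if n: "n < card J" for n
  proof -
    have 1: "refl_product \<beta> (take n xs) = wat J (below (xs ! n))"
      using take_sorted_list_of_set[OF J(1) n] Int_below[OF J(2)] unfolding rprod_def xs_def by simp
    have 2: "refl_product \<beta> (take (Suc n) xs) = wat J (below (xs ! n)) \<circ> reflect (\<beta> (xs ! n))"
      using n xs 1 by (simp add: take_Suc_conv_app_nth refl_product_append refl_product_def[of _ "[xs ! n]"])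
    have "\<beta> (xs ! n) \<in> pos_roots" using beta_pos J xs n nth_mem by (metis subsetD)
    then show ?thesis unfolding 1 2 bruhat_cover_def using wat_weyl[OF J] by auto
  qed
  have "(\<forall>j\<in>J. P j) \<longleftrightarrow> (\<forall>n<card J. P (xs ! n))" for P
    using xs by (metis in_set_conv_nth)
  then show ?thesis using True cover by (simp add: admissible_def flip: xs_def)
qed (auto simp: admissible_def)

context
  fixes J :: "'i set"
  assumes adm: "J \<in> admissible I \<beta>"
begin

lemma adm_fin: "finite J" "J \<subseteq> I"
  using adm admissible_iff by auto

lemma adm_cover: "j \<in> J \<Longrightarrow> len (wat J (below j) \<circ> reflect (\<beta> j)) = len (wat J (below j)) + 1"
  using adm admissible_iff by blast

lemma adm_gam_pos: "j \<in> J \<Longrightarrow> gam \<beta> J j \<in> pos_roots"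
  using adm_cover len_reflect_less_iff[OF wat_weyl[OF adm_fin] beta_pos] adm_fin gam_wat[OF adm_fin] by fastforce

lemma adm_in_hyp: "j \<in> J \<Longrightarrow> j \<in> hyp J a \<Longrightarrow> a \<in> pos_roots \<Longrightarrow> gam \<beta> J j = a"
  using adm_gam_pos hyp_sign(2)[OF adm_fin] by blast

end

lemma rprod_insert_below:
  assumes "finite J" shows "rprod (insert k (J \<inter> below k)) = wat J (below k) \<circ> reflect (\<beta> k)"
  by (rule rprod_insert_above) (use assms in \<open>auto simp: below_def\<close>)

text \<open>For the product w over \<open>J \<inter> L\<close> this says that multiplication by s_p
  on the left lengthens w (\<open>len_simple_left\<close>).\<close>

abbreviation ascent :: "'i set \<Rightarrow> nat \<Rightarrow> 'i set \<Rightarrow> bool" where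
  "ascent J p L \<equiv> inv (wat J L) (\<alpha> p) \<in> pos_roots"

lemma inv_wat_root: "finite J \<Longrightarrow> J \<subseteq> I \<Longrightarrow> p \<in> {1..r} \<Longrightarrow> inv (wat J L) (\<alpha> p) \<in> roots"
  using weyl_roots[OF inv_weyl(3)[OF wat_weyl]] simple_in_roots by blast

text \<open>An element of \<open>J\<close> between the two cuts is not in \<open>hyp\<close>, so its
  root differs from w^-1(\<alpha> p) and \<open>cover_keeps_left_ascent\<close> applies at each such
  cover.\<close>

lemma ascent_mono:
  assumes adm: "J \<in> admissible I \<beta>" and p: "p \<in> {1..r}" and L: "cut L" "cut L'" "L \<subseteq> L'"
    and no: "hyp J (\<alpha> p) \<inter> (L' - L) = {}" and asc: "ascent J p L"
  shows "ascent J p L'"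
  using L(2,3) no
proof (induction "card (J \<inter> (L' - L))" arbitrary: L')
  case 0
  then have "J \<inter> (L' - L) = {}" using adm_fin[OF adm] by simp
  then have "J \<inter> L' = J \<inter> L" using 0 by auto
  then show ?case using asc by simp
next
  case (Suc n)
  note J = adm_fin[OF adm]
  define k where "k = Max (J \<inter> (L' - L))"
  have fin: "finite (J \<inter> (L' - L))" using J by simp
  have ne: "J \<inter> (L' - L) \<noteq> {}" using Suc(2) by force
  have k: "k \<in> J" "k \<in> L'" "k \<notin> L" using Max_in[OF fin ne] unfolding k_def by auto
  have kmax: "j \<le> k" if "j \<in> J \<inter> (L' - L)" for j using Max_ge[OF fin that] unfolding k_def .
  have Lb: "L \<subseteq> below k"
  proof
    fix x assume x: "x \<in> L"
    then have "\<not> k < x" "x \<noteq> k" using L(1) k J unfolding cut_def by auto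
    then show "x \<in> below k" using x L(1) unfolding below_def cut_def by auto
  qed
  have bL: "below k \<subseteq> L'" using below_subset_cut Suc(3) k by blast
  have kb: "k \<notin> below k" unfolding below_def by simp
  have split: "J \<inter> (L' - L) = insert k (J \<inter> (below k - L))"
    using k kmax bL Suc(3) J unfolding below_def by force
  have "n = card (J \<inter> (below k - L))" using Suc(2) J kb unfolding split by simp
  moreover have "hyp J (\<alpha> p) \<inter> (below k - L) = {}" using Suc(5) bL by auto
  ultimately have IH: "ascent J p (below k)" using Suc(1) Lb by simp
  have JL': "J \<inter> L' = insert k (J \<inter> below k)" using split Lb bL Suc(4) k by auto
  have wL': "wat J L' = wat J (below k) \<circ> reflect (\<beta> k)"
    unfolding JL' using rprod_insert_below[OF J(1)] .
  let ?w = "wat J (below k)"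
  have w: "?w \<in> weyl" using wat_weyl[OF J] .
  have kI: "k \<in> I" using k J by blast
  have "k \<notin> hyp J (\<alpha> p)" using Suc(5) k by auto
  then have "?w (\<beta> k) \<noteq> \<alpha> p" using gam_wat[OF J] kI unfolding hyp_def by auto
  then have "\<beta> k \<noteq> inv ?w (\<alpha> p)" using inv_weyl(1)[OF w] by metis
  then have "reflect (\<beta> k) (inv ?w (\<alpha> p)) \<in> pos_roots"
    using cover_keeps_left_ascent[OF w p inv_wat_root[OF J p] inv_weyl(1)[OF w] IH beta_pos[OF kI] _
        adm_cover[OF adm k(1)]] by blast
  then show ?case unfolding wL' inv_reflect_comp(1)[OF w beta_root[OF kI]] .
qed

lemma wat_upto:
  assumes "finite J" "J \<subseteq> I" "k \<in> I"
  shows "wat J (insert k (below k)) = (if k \<in> J then wat J (below k) \<circ> reflect (\<beta> k) else wat J (below k))"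
proof (cases "k \<in> J")
  case True
  then have "J \<inter> insert k (below k) = insert k (J \<inter> below k)" by auto
  then show ?thesis using True rprod_insert_below[OF assms(1)] by (simp only: if_True)
next
  case False
  then have "J \<inter> insert k (below k) = J \<inter> below k" by auto
  then show ?thesis using False by simp
qed

lemma height_start:
  assumes adm: "J \<in> admissible I \<beta>" and p: "p \<in> {1..r}" and L: "cut L" "hyp J (\<alpha> p) \<inter> L = {}"
  shows "ascent J p L" "height J (\<alpha> p) L = 0"
proof -
  show asc: "ascent J p L"
    by (rule ascent_mono[OF adm p cut_empty L(1)]) (use L simple_pos_root[OF p] in auto)
  have "{j. j \<in> L \<and> j \<notin> J \<and> (gam \<beta> J j = \<alpha> p \<or> gam \<beta> J j = - \<alpha> p)} = {}"
    using L cut_subset[OF L(1)] unfolding hyp_def by auto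
  then show "height J (\<alpha> p) L = 0" unfolding height_def psum_def using asc by (simp only:) simp
qed

text \<open>An unfolded \<alpha> p gives the upward step and keeps the ascent. A folded \<alpha> p
  contributes nothing but leaves a descent behind; an unfolded -\<alpha> p contributes -1 and begins
  with a descent. In these two cases the step is 0 or -1, depending on whether an ascent has been
  regained by the end of \<open>L\<close>.\<close>

lemma height_step:
  assumes adm: "J \<in> admissible I \<beta>" and p: "p \<in> {1..r}" and L: "cut L"
    and k: "k \<in> hyp J (\<alpha> p)" "k \<in> L" "\<And>i. i \<in> hyp J (\<alpha> p) \<Longrightarrow> i \<in> L \<Longrightarrow> i \<le> k"
  shows "k \<notin> J \<and> gam \<beta> J k = \<alpha> p \<and> ascent J p L \<and> height J (\<alpha> p) L = height J (\<alpha> p) (below k) + 1 \<or>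
     (if k \<in> J then gam \<beta> J k = \<alpha> p else gam \<beta> J k = - \<alpha> p) \<and>
       height J (\<alpha> p) L = height J (\<alpha> p) (below k) - (if ascent J p L then 0 else 1)"
proof -
  let ?a = "\<alpha> p"
  note J = adm_fin[OF adm]
  have a: "?a \<in> pos_roots" using simple_pos_root[OF p] .
  have na: "- ?a \<notin> pos_roots" using pos_not_neg[OF a] .
  have kI: "k \<in> I" using k unfolding hyp_def by blast
  have bL: "below k \<subseteq> L" using below_subset_cut L k by blast
  define R where "R = L - insert k (below k)"
  have LR: "L = (below k \<union> {k}) \<union> R" using bL k unfolding R_def by auto
  have R: "hyp J ?a \<inter> R = {}" using k cut_subset[OF L] unfolding R_def below_def by force
  have kb: "k \<notin> below k" unfolding below_def by simp
  have "{j. j \<in> R \<and> j \<notin> J \<and> (gam \<beta> J j = ?a \<or> gam \<beta> J j = - ?a)} = {}"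
    using R cut_subset[OF L] unfolding hyp_def R_def by auto
  then have R0: "psum J ?a R = 0" unfolding psum_def by (simp only: sum.empty)
  have k0: "psum J ?a {k} = (if k \<in> J then 0 else root_sgn (gam \<beta> J k))"
  proof -
    have "{j. j \<in> {k} \<and> j \<notin> J \<and> (gam \<beta> J j = ?a \<or> gam \<beta> J j = - ?a)} = (if k \<in> J then {} else {k})"
      using k(1) unfolding hyp_def by auto
    then show ?thesis unfolding psum_def by (simp only:) simp
  qed
  have s1: "psum J ?a L = psum J ?a (below k \<union> {k}) + psum J ?a R"
    using psum_Un[OF J, of "below k \<union> {k}" R ?a] LR cut_subset[OF L] unfolding R_def by auto
  have s2: "psum J ?a (below k \<union> {k}) = psum J ?a (below k) + psum J ?a {k}"
    using psum_Un[OF J, of "below k" "{k}" ?a] kI kb unfolding below_def by auto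
  have s: "psum J ?a L = psum J ?a (below k) + (if k \<in> J then 0 else root_sgn (gam \<beta> J k))"
    using s1 s2 R0 k0 by simp
  note sg = hyp_sign[OF J a k(1)]
  show ?thesis
  proof (cases "k \<in> J")
    case True
    have g: "gam \<beta> J k = ?a" using adm_in_hyp[OF adm True k(1) a] .
    then show ?thesis using True s sg unfolding height_def by simp
  next
    case False
    show ?thesis
    proof (cases "gam \<beta> J k = ?a")
      case True
      have "ascent J p (insert k (below k))" using wat_upto[OF J kI] False True sg by simp
      then have "ascent J p L"
        by (rule ascent_mono[OF adm p cut_insert_below[OF kI] L, rotated -1]) (use R bL k in \<open>auto simp: R_def\<close>)
      then show ?thesis using s sg True False unfolding height_def root_sgn_def by simp
    next
      case neq: False
      then have g: "gam \<beta> J k = - ?a" using k(1) unfolding hyp_def by auto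
      then show ?thesis using s sg False neq na unfolding height_def root_sgn_def by simp
    qed
  qed
qed


subsection \<open>Reflecting a segment\<close>

text \<open>In a segment, \<open>k\<close> is the last index of \<open>P\<close> in the cut \<open>L\<close>, and \<open>L\<close> ends at the next index
  \<open>m\<close> of \<open>P\<close>, where \<open>N = {m}\<close>, or at infinity, where \<open>N\<close> is empty.\<close>

definition seg :: "'i set \<Rightarrow> 'i \<Rightarrow> 'i set \<Rightarrow> 'i set \<Rightarrow> bool" where
  "seg P k L N \<longleftrightarrow> k \<in> P \<and> k \<in> L \<and> (\<forall>i\<in>P \<inter> L. i \<le> k) \<and>
     (L = I \<and> N = {} \<or> (\<exists>m\<in>P. L = below m \<and> N = {m}))"

lemma seg_cut: "seg P k L N \<Longrightarrow> cut L"
  unfolding seg_def by auto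

lemma seg_unique: "P \<subseteq> I \<Longrightarrow> seg P k L N \<Longrightarrow> seg P k L' N' \<Longrightarrow> L = L' \<and> N = N'"
proof -
  assume P: "P \<subseteq> I" and s: "seg P k L N" "seg P k L' N'"
  have less: "k < m" if "k \<in> below m" for m using that unfolding below_def by simp
  have *: False if "m \<in> P" "L' = below m" "seg P k I N" "seg P k L' N'" for m L' N N'
    using that P less unfolding seg_def by (metis Int_absorb2 leD)
  have **: "m = n" if "m \<in> P" "n \<in> P" "\<forall>i\<in>P \<inter> below m. i \<le> k" "\<forall>i\<in>P \<inter> below n. i \<le> k" "k < m" "k < n" for m n
  proof (rule ccontr)
    assume "m \<noteq> n"
    then consider "m < n" | "n < m" by fastforce
    then show False
    proof cases
      case 1
      then have "m \<in> P \<inter> below n" using that(1) P unfolding below_def by auto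
      then show False using that(4,5) leD by blast
    next
      case 2
      then have "n \<in> P \<inter> below m" using that(2) P unfolding below_def by auto
      then show False using that(3,6) leD by blast
    qed
  qed
  consider "L = I" "N = {}" "L' = I" "N' = {}" | m where "m \<in> P" "L = I" "L' = below m"
    | m where "m \<in> P" "L' = I" "L = below m"
    | m n where "m \<in> P" "n \<in> P" "L = below m" "L' = below n" "N = {m}" "N' = {n}"
    using s unfolding seg_def by blast
  then show "L = L' \<and> N = N'"
  proof cases
    case 2 then show ?thesis using *[of m L' N N'] s by simp
  next
    case 3 then show ?thesis using *[of m L N' N] s by simp
  next
    case 4
    then have "m = n" using **[of m n] s less unfolding seg_def by simp
    then show ?thesis using 4 by simp
  qed simp
qed

lemma seg_exists:
  assumes "finite P" "P \<subseteq> I" "k \<in> P" shows "\<exists>L N. seg P k L N"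
proof (cases "\<exists>i\<in>P. k < i")
  case False
  then have "seg P k I {}" using assms unfolding seg_def by force
  then show ?thesis by blast
next
  case True
  define m where "m = Min {i \<in> P. k < i}"
  have fin: "finite {i \<in> P. k < i}" "{i \<in> P. k < i} \<noteq> {}" using assms True by auto
  have m: "m \<in> P" "k < m" using Min_in[OF fin] unfolding m_def by auto
  have "i \<le> k" if "i \<in> P" "i < m" for i
    using Min_le[OF fin(1), of i] that unfolding m_def[symmetric] by fastforce
  then have "seg P k (below m) {m}" using m assms unfolding seg_def below_def by auto
  then show ?thesis by blast
qed

context
  fixes J :: "'i set" and p k and L N :: "'i set"
  assumes J: "finite J" "J \<subseteq> I" and p: "p \<in> {1..r}" and seg: "seg (hyp J (\<alpha> p)) k L N"
begin

text \<open>Used for F_p and for its inverse alike; the two directions are the two alternatives in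
  \<open>segflip_adm\<close>.\<close>

definition segflip :: "'i set" where "segflip = sym_diff J (insert k N)"

lemma seg_k: "k \<in> hyp J (\<alpha> p)" "k \<in> I" "k \<in> L" "L \<subseteq> I"
  using seg cut_subset[OF seg_cut[OF seg]] unfolding seg_def hyp_def by auto

text \<open>The upper index m is flipped first: this leaves everything below m unchanged, so both
  reflections can be expressed by heights of \<open>J\<close> itself.\<close>

lemma seg_cases:
  obtains (inf) "L = I" "N = {}" "segflip = sym_diff J {k}"
  | (fin) m where "m \<in> hyp J (\<alpha> p)" "m \<in> I" "k < m" "L = below m" "N = {m}"
     "segflip = sym_diff (sym_diff J {m}) {k}"
proof (cases "N = {}")
  case True
  then show thesis using inf seg unfolding seg_def segflip_def by auto
next
  case False
  then obtain m where m: "m \<in> hyp J (\<alpha> p)" "L = below m" "N = {m}" using seg unfolding seg_def by auto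
  then have "k < m" using seg_k unfolding below_def by simp
  then have "segflip = sym_diff (sym_diff J {m}) {k}" using m(3) segflip_def by auto
  then show thesis using fin[of m] m \<open>k < m\<close> unfolding hyp_def by auto
qed

lemma segflip_fin: "finite segflip" "segflip \<subseteq> I"
  using seg J unfolding seg_def segflip_def hyp_def by auto

lemma a_pos: "\<alpha> p \<in> pos_roots"
  using simple_pos_root[OF p] .

lemma segflip_hyp: "hyp segflip (\<alpha> p) = hyp J (\<alpha> p)"
proof (cases rule: seg_cases)
  case inf
  then show ?thesis using flip_hyp[OF J a_pos seg_k(1)] by simp
next
  case (fin m)
  note f = flip_hyp[OF J a_pos fin(1)]
  show ?thesis unfolding fin(6)
    using flip_hyp[OF flip_finite[OF J fin(1)] a_pos, of k] seg_k(1) f by simp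
qed

lemma segflip_low:
  assumes "cut L'" "k \<notin> L'" shows "segflip \<inter> L' = J \<inter> L'"
proof (cases rule: seg_cases)
  case inf
  show ?thesis unfolding inf(3) using assms(2) by blast
next
  case (fin m)
  have "m \<notin> L'" using assms fin(3) seg_k(2) unfolding cut_def by blast
  then show ?thesis unfolding fin(6) using assms(2) by blast
qed

lemma cut_not_subset: "cut L' \<Longrightarrow> \<not> L' \<subseteq> below m \<Longrightarrow> m \<in> I \<Longrightarrow> m \<in> L'"
proof -
  assume L': "cut L'" "\<not> L' \<subseteq> below m" "m \<in> I"
  then obtain x where x: "x \<in> L'" "x \<in> I" "\<not> x < m" unfolding below_def cut_def by auto
  then show "m \<in> L'" using L' unfolding cut_def by (cases "x = m") auto
qed

lemma segflip_mid:
  assumes L': "cut L'" "k \<in> L'" "L' \<subseteq> L"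
  shows "wat segflip L' = reflect (\<alpha> p) \<circ> wat J L'"
proof (cases rule: seg_cases)
  case inf
  then show ?thesis using flip_in(1)[OF J a_pos seg_k(1) L'(1,2)] by simp
next
  case (fin m)
  have "m \<notin> L'" using L' fin unfolding below_def by auto
  then have "segflip \<inter> L' = sym_diff J {k} \<inter> L'" unfolding fin(6) by auto
  then show ?thesis using flip_in(1)[OF J a_pos seg_k(1) L'(1,2)] by simp
qed

lemma segflip_high:
  assumes L': "cut L'" "\<not> L' \<subseteq> L" shows "wat segflip L' = wat J L'"
proof (cases rule: seg_cases)
  case inf
  then show ?thesis using L' cut_subset by blast
next
  case (fin m)
  have m: "m \<in> L'" using cut_not_subset L' fin by blast
  then have k: "k \<in> L'" using L'(1) fin seg_k unfolding cut_def by blast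
  have "k \<in> hyp (sym_diff J {m}) (\<alpha> p)" using flip_hyp[OF J a_pos fin(1)] seg_k by simp
  then have "wat segflip L' = reflect (\<alpha> p) \<circ> (reflect (\<alpha> p) \<circ> wat J L')"
    unfolding fin(6) using flip_in(1)[OF flip_finite[OF J fin(1)] a_pos _ L'(1) k] flip_in(1)[OF J a_pos fin(1) L'(1) m]
    by simp
  then show ?thesis using simple_refl_refl_comp[OF p] by simp
qed

text \<open>Beyond the segment the reflections belonging to its two ends compose to a translation by
  twice the difference of their levels.\<close>

lemma segflip_height:
  assumes L': "cut L'"
  shows "height segflip (\<alpha> p) L' =
    (if k \<notin> L' then height J (\<alpha> p) L'
     else if L' \<subseteq> L then 2 * height J (\<alpha> p) (below k) - height J (\<alpha> p) L'
     else height J (\<alpha> p) L' + 2 * (height J (\<alpha> p) (below k) - height J (\<alpha> p) L))"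
proof (cases rule: seg_cases)
  case inf
  then show ?thesis using flip_height[OF J a_pos seg_k(1) L'] cut_subset[OF L'] by simp
next
  case (fin m)
  have K: "k \<in> hyp (sym_diff J {m}) (\<alpha> p)" using flip_hyp[OF J a_pos fin(1)] seg_k by simp
  have mk: "m \<notin> below k" using fin(3) unfolding below_def by auto
  have sub: "L' \<subseteq> L \<longleftrightarrow> m \<notin> L'" using cut_not_subset[OF L' _ fin(2)] unfolding fin(4) below_def by auto
  have mkL: "k \<in> L'" if "m \<in> L'" using L' that fin seg_k unfolding cut_def by blast
  show ?thesis
    unfolding fin(6) flip_height[OF flip_finite[OF J fin(1)] a_pos K L'] flip_height[OF J a_pos fin(1) L']
      flip_height[OF J a_pos fin(1) cut_below] sub
    using mk mkL fin(4) by auto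
qed

lemma segflip_weight:
  "weight l I \<beta> segflip = (if N = {} then aff_refl (\<alpha> p) (height J (\<alpha> p) (below k)) (weight l I \<beta> J)
     else aff_refl (\<alpha> p) (height J (\<alpha> p) (below k)) (aff_refl (\<alpha> p) (height J (\<alpha> p) L) (weight l I \<beta> J)))"
proof -
  have I: "J \<inter> I = J" "segflip \<inter> I = segflip" using J segflip_fin by blast+
  show ?thesis
  proof (cases rule: seg_cases)
    case inf
    then show ?thesis using flip_in(2)[OF J a_pos seg_k(1) cut_I seg_k(2), of l] I by simp
  next
    case (fin m)
    have K: "k \<in> hyp (sym_diff J {m}) (\<alpha> p)" using flip_hyp[OF J a_pos fin(1)] seg_k by simp
    have "m \<notin> below k" using fin(3) unfolding below_def by auto
    then have h: "height (sym_diff J {m}) (\<alpha> p) (below k) = height J (\<alpha> p) (below k)"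
      using flip_height[OF J a_pos fin(1) cut_below, of k] by simp
    have mI: "sym_diff J {m} \<inter> I = sym_diff J {m}" using flip_finite[OF J fin(1)] by blast
    show ?thesis
      using flip_in(2)[OF flip_finite[OF J fin(1)] a_pos K cut_I seg_k(2), of l]
        flip_in(2)[OF J a_pos fin(1) cut_I fin(2), of l] fin(4,5)
      unfolding fin(6)[symmetric] I mI h by simp
  qed
qed

text \<open>Inside the segment every product is multiplied on the left by s_p. Ascent or descent is
  constant there, so all lengths move by the same amount and covers stay covers. An index newly
  added at an end is itself a cover by s_p.\<close>

lemma segflip_adm:
  assumes adm: "J \<in> admissible I \<beta>"
    and ty: "k \<notin> J \<and> gam \<beta> J k = \<alpha> p \<and> N \<subseteq> J \<and> ascent J p L \<or> k \<in> J \<and> N \<inter> J = {} \<and> \<not> ascent J p L"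
  shows "segflip \<in> admissible I \<beta>"
proof -
  let ?s = "reflect (\<alpha> p)" and ?K = segflip
  have JK: "j \<in> J" if "j \<in> ?K" "j \<noteq> k" "j \<notin> N" for j using that unfolding segflip_def by auto
  have N: "j \<notin> L" if "j \<in> N" for j using that by (cases rule: seg_cases) (auto simp: below_def)
  have Nk: "k < j" if "j \<in> N" for j using that by (cases rule: seg_cases) auto
  have "len (wat ?K (below j) \<circ> reflect (\<beta> j)) = len (wat ?K (below j)) + 1" if j: "j \<in> ?K" for j
  proof -
    have jI: "j \<in> I" using segflip_fin j by blast
    let ?w = "wat J (below j)"
    have w: "?w \<in> weyl" using wat_weyl[OF J] .
    have wj: "?w \<circ> reflect (\<beta> j) \<in> weyl" using weyl_comp[OF w refl_root_weyl[OF beta_root[OF jI]]] .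
    have inv: "?w (inv ?w (\<alpha> p)) = \<alpha> p" using inv_weyl(1)[OF w] .
    have ir: "inv ?w (\<alpha> p) \<in> roots" using inv_wat_root[OF J p] .
    have asc_k: "gam \<beta> J k = \<alpha> p \<longleftrightarrow> ascent J p (below k)" using hyp_sign(1)[OF J a_pos seg_k(1)] .
    consider "j < k" | "j = k" | "k < j" "j \<in> L" | "k < j" "j \<in> N" | "k < j" "j \<notin> L" "j \<notin> N" by fastforce
    then show ?thesis
    proof cases
      case 1
      then have "j \<in> J" using JK[OF j] Nk by force
      moreover have "?K \<inter> below j = J \<inter> below j"
        by (rule segflip_low[OF cut_below]) (use 1 in \<open>auto simp: below_def\<close>)
      ultimately show ?thesis using adm_cover[OF adm] by simp
    next
      case 2
      have "k \<notin> J" using j 2 Nk unfolding segflip_def by auto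
      then have g: "gam \<beta> J k = \<alpha> p" using ty by blast
      have "?K \<inter> below k = J \<inter> below k" using segflip_low[OF cut_below, of k] unfolding below_def by simp
      moreover have "?w \<circ> reflect (\<beta> k) = ?s \<circ> ?w"
        using weyl_conj_reflect[OF w, of "\<beta> k"] gam_wat[OF J, of k] g 2 by simp
      moreover have "ascent J p (below k)" using asc_k g by simp
      ultimately show ?thesis using len_simple_left(1)[OF w p ir inv] 2 by simp
    next
      case 3
      have jJ: "j \<in> J" using JK[OF j] N 3 by blast
      have bL: "below j \<subseteq> L" "insert j (below j) \<subseteq> L" using below_subset_cut seg_cut[OF seg] 3 by blast+
      have kb: "k \<in> below j" using 3 seg_k unfolding below_def by simp
      have no: "hyp J (\<alpha> p) \<inter> (L - insert k (below k)) = {}"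
      proof -
        have "i \<in> insert k (below k)" if "i \<in> hyp J (\<alpha> p)" "i \<in> L" for i
        proof -
          have "i \<le> k" "i \<in> I" using that seg seg_k(4) unfolding seg_def by blast+
          then show ?thesis unfolding below_def by auto
        qed
        then show ?thesis by blast
      qed
      have up: "wat J (insert j (below j)) = ?w \<circ> reflect (\<beta> j)" using wat_upto[OF J jI] jJ by simp
      have kbb: "insert k (below k) \<subseteq> below j" using kb unfolding below_def by auto
      \<comment> \<open>If the segment ends in an ascent, there is one already right after k, and it
        persists. If it ends in a descent, an earlier ascent would have persisted to the
        end.\<close>
      have same: "ascent J p (below j) \<longleftrightarrow> ascent J p L" "ascent J p (insert j (below j)) \<longleftrightarrow> ascent J p L"
      proof -
        have m1: "ascent J p (below j) \<Longrightarrow> ascent J p L"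
          by (rule ascent_mono[OF adm p cut_below seg_cut[OF seg] bL(1)]) (use no kbb in auto)
        have m2: "ascent J p (insert j (below j)) \<Longrightarrow> ascent J p L"
          by (rule ascent_mono[OF adm p cut_insert_below[OF jI] seg_cut[OF seg] bL(2)]) (use no kbb in auto)
        have m3: "ascent J p (below j)" "ascent J p (insert j (below j))" if "ascent J p L"
        proof -
          have f: "k \<notin> J" "gam \<beta> J k = \<alpha> p" using that ty by blast+
          then have "ascent J p (insert k (below k))" using wat_upto[OF J seg_k(2)] asc_k by simp
          note am = ascent_mono[OF adm p cut_insert_below[OF seg_k(2)] _ _ _ this]
          show "ascent J p (below j)" by (rule am) (use no kbb bL in auto)
          show "ascent J p (insert j (below j))" by (rule am) (use no kbb bL cut_insert_below[OF jI] in auto)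
        qed
        show "ascent J p (below j) \<longleftrightarrow> ascent J p L" "ascent J p (insert j (below j)) \<longleftrightarrow> ascent J p L"
          using m1 m2 m3 by blast+
      qed
      have inv': "(?w \<circ> reflect (\<beta> j)) (inv (?w \<circ> reflect (\<beta> j)) (\<alpha> p)) = \<alpha> p" using inv_weyl(1)[OF wj] .
      have ir': "inv (?w \<circ> reflect (\<beta> j)) (\<alpha> p) \<in> roots"
        using weyl_roots[OF inv_weyl(3)[OF wj] simple_in_roots[OF p]] .
      have "len (?s \<circ> (?w \<circ> reflect (\<beta> j))) = len (?s \<circ> ?w) + 1"
      proof (cases "ascent J p L")
        case True
        then show ?thesis
          using len_simple_left(1)[OF w p ir inv] len_simple_left(1)[OF wj p ir' inv'] same adm_cover[OF adm jJ]
          unfolding up by linarith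
      next
        case False
        then show ?thesis
          using len_simple_left(2)[OF w p ir inv] len_simple_left(2)[OF wj p ir' inv'] same adm_cover[OF adm jJ]
          unfolding up by linarith
      qed
      then show ?thesis using segflip_mid[OF cut_below kb bL(1)] by (simp add: comp_assoc)
    next
      \<comment> \<open>Adding m restores the old product w from s_p w; w has a descent at this
        place, so this is a step up.\<close>
      case 4
      then obtain m where m: "m \<in> hyp J (\<alpha> p)" "L = below m" "N = {m}" "j = m"
        by (cases rule: seg_cases) auto
      have "j \<notin> J" using j 4 unfolding segflip_def by auto
      then have na: "\<not> ascent J p (below j)" using ty 4 m by auto
      have "?w (\<beta> j) = \<alpha> p \<or> ?w (\<beta> j) = - \<alpha> p" using m gam_wat[OF J] unfolding hyp_def by auto
      then have sw: "?w \<circ> reflect (\<beta> j) = ?s \<circ> ?w"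
        using weyl_conj_reflect[OF w, of "\<beta> j"] by (auto simp: reflect_uminus)
      have "wat ?K (below j) = ?s \<circ> ?w" using segflip_mid[OF cut_below] seg_k m by simp
      moreover have "?s \<circ> ?w \<circ> reflect (\<beta> j) = ?w"
        using sw simple_refl_refl_comp[OF p, of ?w] by (simp add: comp_assoc)
      ultimately show ?thesis using len_simple_left(2)[OF w p ir inv na] by simp
    next
      case 5
      then obtain m where m: "L = below m" "N = {m}" "m \<in> I" using jI by (cases rule: seg_cases) auto
      then have "m < j" using 5 jI unfolding below_def by auto
      then have "\<not> below j \<subseteq> L" using m unfolding below_def by auto
      moreover have "j \<in> J" using JK[OF j] 5 by auto
      ultimately show ?thesis using segflip_high[OF cut_below] adm_cover[OF adm] by simp
    qed
  qed
  then show ?thesis using admissible_iff segflip_fin by blast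
qed

end

subsection \<open>Maximal levels\<close>

definition maxh :: "'i set \<Rightarrow> nat \<Rightarrow> int" where
  "maxh J p = Max ((\<lambda>i. height J (\<alpha> p) (below i)) ` hyp J (\<alpha> p) \<union> {height J (\<alpha> p) I})"

lemma maxh_ge:
  assumes "finite J" "J \<subseteq> I"
  shows "i \<in> hyp J (\<alpha> p) \<Longrightarrow> height J (\<alpha> p) (below i) \<le> maxh J p" "height J (\<alpha> p) I \<le> maxh J p"
  unfolding maxh_def using finite_hyp[OF assms] by auto

lemma maxh_attained:
  assumes "finite J" "J \<subseteq> I"
  shows "(\<exists>i\<in>hyp J (\<alpha> p). height J (\<alpha> p) (below i) = maxh J p) \<or> height J (\<alpha> p) I = maxh J p"
proof -
  have "maxh J p \<in> (\<lambda>i. height J (\<alpha> p) (below i)) ` hyp J (\<alpha> p) \<union> {height J (\<alpha> p) I}"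
    unfolding maxh_def using finite_hyp[OF assms] by (intro Max_in) auto
  then show ?thesis by auto
qed

lemma maxh_eqI:
  assumes "finite J" "J \<subseteq> I" "\<And>i. i \<in> hyp J (\<alpha> p) \<Longrightarrow> height J (\<alpha> p) (below i) \<le> M" "height J (\<alpha> p) I \<le> M"
    "(\<exists>i\<in>hyp J (\<alpha> p). height J (\<alpha> p) (below i) = M) \<or> height J (\<alpha> p) I = M"
  shows "maxh J p = M"
  unfolding maxh_def using finite_hyp[OF assms(1,2)] assms(3-5) by (intro Max_eqI) auto

lemma max_level_eq:
  assumes J: "finite J" "J \<subseteq> I" and p: "p \<in> {1..r}"
  shows "max_level l I \<beta> J p = of_int (maxh J p)"
proof -
  have a: "\<alpha> p \<in> pos_roots" using simple_pos_root[OF p] .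
  have "mono (of_int :: int \<Rightarrow> real)" by (simp add: mono_def)
  from mono_Max_commute[OF this, of "(\<lambda>i. height J (\<alpha> p) (below i)) ` hyp J (\<alpha> p) \<union> {height J (\<alpha> p) I}"]
  have "real_of_int (maxh J p) =
     Max ((\<lambda>i. of_int (height J (\<alpha> p) (below i))) ` hyp J (\<alpha> p) \<union> {of_int (height J (\<alpha> p) I)})"
    unfolding maxh_def using finite_hyp[OF J] by (simp add: image_image)
  also have "(\<lambda>i. real_of_int (height J (\<alpha> p) (below i))) ` hyp J (\<alpha> p) =
      (\<lambda>i. of_int (level I \<beta> J i)) ` hyp J (\<alpha> p)"
    using level_eq[OF J a] by (intro image_cong) auto
  finally show ?thesis
    unfolding max_level_def simple_inds_def weight_coroot[OF J a] hyp_def by simp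
qed

text \<open>The height is 0 at the first index of \<open>hyp\<close>, or at infinity if there is
  none.\<close>

lemma maxh_nonneg:
  assumes adm: "J \<in> admissible I \<beta>" and p: "p \<in> {1..r}" shows "maxh J p \<ge> 0"
proof (cases "hyp J (\<alpha> p) = {}")
  case True
  then show ?thesis using height_start(2)[OF adm p cut_I] maxh_ge(2)[OF adm_fin[OF adm], of p] by simp
next
  case False
  define i where "i = Min (hyp J (\<alpha> p))"
  have fin: "finite (hyp J (\<alpha> p))" using finite_hyp[OF adm_fin[OF adm]] .
  have i: "i \<in> hyp J (\<alpha> p)" using Min_in[OF fin False] unfolding i_def .
  have "hyp J (\<alpha> p) \<inter> below i = {}" using Min_le[OF fin] unfolding i_def below_def by fastforce
  then show ?thesis using height_start(2)[OF adm p cut_below, of i] maxh_ge(1)[OF adm_fin[OF adm] i] by simp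
qed

text \<open>The segment on which a root operator acts ends at the first maximum of the heights.\<close>

definition first_seg :: "'i set \<Rightarrow> nat \<Rightarrow> 'i \<Rightarrow> 'i set \<Rightarrow> 'i set \<Rightarrow> bool" where
  "first_seg J p k L N \<longleftrightarrow> seg (hyp J (\<alpha> p)) k L N \<and> k \<notin> J \<and> gam \<beta> J k = \<alpha> p \<and> N \<subseteq> J \<and> ascent J p L \<and>
     height J (\<alpha> p) (below k) = maxh J p - 1 \<and> height J (\<alpha> p) L = maxh J p \<and>
     (\<forall>i\<in>hyp J (\<alpha> p). i \<le> k \<longrightarrow> height J (\<alpha> p) (below i) < maxh J p)"

text \<open>The first maximum is reached from a smaller height, so the step at k is the upward one
  of \<open>height_step\<close>; this determines k completely.\<close>

lemma first_max:
  assumes adm: "J \<in> admissible I \<beta>" and p: "p \<in> {1..r}" and pos: "maxh J p > 0"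
  obtains k L N where "first_seg J p k L N" "root_op l I \<beta> p J = Some (sym_diff J (insert k N))"
proof -
  let ?P = "hyp J (\<alpha> p)" and ?h = "height J (\<alpha> p)"
  note J = adm_fin[OF adm]
  have a: "\<alpha> p \<in> pos_roots" using simple_pos_root[OF p] .
  have fin: "finite ?P" using finite_hyp[OF J] .
  have PI: "?P \<subseteq> I" unfolding hyp_def by blast
  define H where "H = {i \<in> ?P. ?h (below i) = maxh J p}"
  define m where "m = Min H"
  define L where "L = (if H = {} then I else below m)"
  define N where "N = (if H = {} then {} else {m})"
  have finH: "finite H" unfolding H_def using fin by simp
  have mH: "H \<noteq> {} \<Longrightarrow> m \<in> H" unfolding m_def using Min_in[OF finH] by blast
  have L: "cut L" unfolding L_def by simp
  have hL: "?h L = maxh J p"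
    using maxh_attained[OF J, of p] mH unfolding L_def H_def by auto
  have low: "?h (below i) < maxh J p" if "i \<in> ?P" "i \<in> L" for i
  proof -
    have "i \<notin> H"
    proof
      assume "i \<in> H"
      then have "i < m" using that(2) unfolding L_def below_def by (auto split: if_splits)
      then show False using Min_le[OF finH \<open>i \<in> H\<close>] unfolding m_def by simp
    qed
    then show ?thesis using maxh_ge(1)[OF J that(1)] that(1) unfolding H_def by simp
  qed
  have ne: "?P \<inter> L \<noteq> {}" using height_start(2)[OF adm p L] hL pos by auto
  define k where "k = Max (?P \<inter> L)"
  have finP: "finite (?P \<inter> L)" using fin by simp
  have k: "k \<in> ?P" "k \<in> L" using Max_in[OF finP ne] unfolding k_def by auto
  have kmax: "i \<le> k" if "i \<in> ?P" "i \<in> L" for i using Max_ge[OF finP] that unfolding k_def by auto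
  have sg: "seg ?P k L N" using k kmax mH unfolding seg_def L_def N_def H_def by auto
  have hk: "?h (below k) < maxh J p" using low k by blast
  then have st: "k \<notin> J" "gam \<beta> J k = \<alpha> p" "ascent J p L" "?h L = ?h (below k) + 1"
    using height_step[OF adm p L k kmax] hL by (auto split: if_splits)
  \<comment> \<open>Otherwise the ascent before m makes m an unfolded \<alpha> p, and the height
    would rise above its maximum M right after m.\<close>
  have "m \<in> J" if "H \<noteq> {}"
  proof (rule ccontr)
    assume mJ: "m \<notin> J"
    have m: "m \<in> ?P" "?h (below m) = maxh J p" using mH[OF that] unfolding H_def by auto
    have Lm: "L = below m" using that unfolding L_def by simp
    then have gm: "gam \<beta> J m = \<alpha> p" using hyp_sign(1)[OF J a m(1)] st(3) by simp
    obtain L2 N2 where s2: "seg ?P m L2 N2" using seg_exists[OF fin PI m(1)] by blast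
    then have "m \<in> L2" "\<And>i. i \<in> ?P \<Longrightarrow> i \<in> L2 \<Longrightarrow> i \<le> m" unfolding seg_def by auto
    from height_step[OF adm p seg_cut[OF s2] m(1) this] have "?h L2 = maxh J p + 1"
      using mJ gm m(2) a pos_not_neg[OF a] by (auto split: if_splits)
    moreover have "?h L2 \<le> maxh J p" using s2 maxh_ge[OF J] unfolding seg_def by auto
    ultimately show False by simp
  qed
  then have NJ: "N \<subseteq> J" unfolding N_def by auto
  have lt: "?h (below i) < maxh J p" if "i \<in> ?P" "i \<le> k" for i
    using low[OF that(1)] that k L PI unfolding cut_def by (metis order_le_less subsetD)
  have "root_op l I \<beta> p J = Some (sym_diff J (insert k N))"
  proof -
    have S: "simple_inds I \<beta> J p = ?P" unfolding simple_inds_def hyp_def ..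
    have HH: "{i \<in> ?P. real_of_int (level I \<beta> J i) = max_level l I \<beta> J p} = H"
      unfolding H_def max_level_eq[OF J p] using level_eq[OF J a] by auto
    show ?thesis
    proof (cases "H = {}")
      case True
      then have "k = Max ?P" unfolding k_def L_def using PI by (simp add: Int_absorb2)
      then show ?thesis
        unfolding root_op_def S HH Let_def using True adm pos max_level_eq[OF J p] unfolding N_def by simp
    next
      case False
      have "?P \<inter> L = {i \<in> ?P. i < m}" using False PI unfolding L_def below_def by auto
      then have "k = Max {i \<in> ?P. i < m}" unfolding k_def by simp
      then show ?thesis
        unfolding root_op_def S HH Let_def m_def[symmetric] using False adm pos max_level_eq[OF J p]
        unfolding N_def by simp
    qed
  qed
  moreover have "first_seg J p k L N"
    unfolding first_seg_def using sg st NJ hL lt by simp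
  ultimately show thesis using that by blast
qed

text \<open>Let M be the maximum for \<open>J\<close>. Heights up to k are unchanged and below M,
  the height at the end of the segment is reflected from M about M - 1, and later ones drop by 2. So
  the new maximum is M - 1 and k is its last index, from which the step can be undone.\<close>

lemma segflip_F:
  assumes adm: "J \<in> admissible I \<beta>" and p: "p \<in> {1..r}"
    and fs: "first_seg J p k L N" and K_def: "K = sym_diff J (insert k N)"
  shows "K \<in> admissible I \<beta>" "weight l I \<beta> K = weight l I \<beta> J - \<alpha> p" "hyp K (\<alpha> p) = hyp J (\<alpha> p)"
    "maxh K p = maxh J p - 1" "height K (\<alpha> p) (below k) = maxh K p" "height K (\<alpha> p) I = height J (\<alpha> p) I - 2"
    "\<And>i. i \<in> hyp K (\<alpha> p) \<Longrightarrow> k < i \<Longrightarrow> height K (\<alpha> p) (below i) < maxh K p"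
    "\<And>L'. cut L' \<Longrightarrow> \<not> L' \<subseteq> L \<Longrightarrow> height K (\<alpha> p) L' = height J (\<alpha> p) L' - 2"
    "L \<noteq> I \<Longrightarrow> height K (\<alpha> p) L = maxh J p - 2"
proof -
  note J = adm_fin[OF adm]
  have sg: "seg (hyp J (\<alpha> p)) k L N" and k: "k \<notin> J" "gam \<beta> J k = \<alpha> p" and N: "N \<subseteq> J"
    and asc: "ascent J p L" and hk: "height J (\<alpha> p) (below k) = maxh J p - 1"
    and hL: "height J (\<alpha> p) L = maxh J p"
    and low: "\<And>i. i \<in> hyp J (\<alpha> p) \<Longrightarrow> i \<le> k \<Longrightarrow> height J (\<alpha> p) (below i) < maxh J p"
    using fs unfolding first_seg_def by auto
  note sd = segflip_def[OF J p sg, folded K_def]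
  have ar: "\<alpha> p \<in> roots" using simple_in_roots p by blast
  show "K \<in> admissible I \<beta>" using segflip_adm[OF J p sg adm] k N asc unfolding sd by blast
  show hyp: "hyp K (\<alpha> p) = hyp J (\<alpha> p)" using segflip_hyp[OF J p sg] unfolding sd .
  note H = segflip_height[OF J p sg, unfolded sd]
  note kk = seg_k[OF J p sg]
  show hK1: "height K (\<alpha> p) L' = height J (\<alpha> p) L' - 2" if L': "cut L'" "\<not> L' \<subseteq> L" for L'
  proof -
    have "k \<in> L'"
    proof (rule ccontr)
      assume "k \<notin> L'"
      then have "L' \<subseteq> below k" using cut_not_subset[OF J p sg L'(1), of k] kk(2) by blast
      then show False using L'(2) below_subset_cut[OF seg_cut[OF sg] kk(3)] by blast
    qed
    then show ?thesis using H[OF L'(1)] L'(2) hk hL by simp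
  qed
  have kb: "k \<notin> below k" unfolding below_def by simp
  have hKk: "height K (\<alpha> p) (below k) = maxh J p - 1" using H[OF cut_below, of k] kb hk by simp
  have hKL: "height K (\<alpha> p) L = maxh J p - 2" using H[OF seg_cut[OF sg]] kk hk hL by simp
  then show "L \<noteq> I \<Longrightarrow> height K (\<alpha> p) L = maxh J p - 2" by blast
  show hKI: "height K (\<alpha> p) I = height J (\<alpha> p) I - 2"
  proof (cases "L = I")
    case True
    then show ?thesis using hKL hL by simp
  next
    case False
    then show ?thesis using hK1[OF cut_I] kk(4) by blast
  qed
  have high: "height K (\<alpha> p) (below i) \<le> maxh J p - 2" if i: "i \<in> hyp J (\<alpha> p)" "k < i" for i
  proof -
    have iI: "i \<in> I" using i unfolding hyp_def by blast
    have nL: "i \<notin> L" using i sg unfolding seg_def by (meson IntI leD)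
    then obtain m where m: "m \<in> I" "L = below m" "k < m" using iI by (cases rule: seg_cases[OF J p sg, case_names inf fin]) auto
    show ?thesis
    proof (cases "i = m")
      case True
      then show ?thesis using hKL m by simp
    next
      case False
      then have "m < i" using nL m iI unfolding below_def by auto
      then have "\<not> below i \<subseteq> L" using m unfolding below_def by auto
      then show ?thesis using hK1[OF cut_below, of i] maxh_ge(1)[OF J i(1)] by simp
    qed
  qed
  have lowK: "height K (\<alpha> p) (below i) \<le> maxh J p - 1" if "i \<in> hyp J (\<alpha> p)" "i \<le> k" for i
  proof -
    have "k \<notin> below i" using that unfolding below_def by auto
    then show ?thesis using H[OF cut_below, of i] low[OF that] by simp
  qed
  show mx: "maxh K p = maxh J p - 1"
  proof (rule maxh_eqI[OF segflip_fin[OF J p sg, unfolded sd]])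
    fix i assume "i \<in> hyp K (\<alpha> p)"
    then show "height K (\<alpha> p) (below i) \<le> maxh J p - 1"
      unfolding hyp using high[of i] lowK[of i] by fastforce
  next
    show "height K (\<alpha> p) I \<le> maxh J p - 1" using hKI maxh_ge(2)[OF J, of p] by simp
  qed (use hKk kk(1) hyp in auto)
  show "height K (\<alpha> p) (below k) = maxh K p" using hKk mx by simp
  show "height K (\<alpha> p) (below i) < maxh K p" if "i \<in> hyp K (\<alpha> p)" "k < i" for i
    using high[of i] that mx unfolding hyp by simp
  have pp: "\<langle>\<alpha> p, coroot (\<alpha> p)\<rangle> = 2" using p by (rule simple_pair_self)
  show "weight l I \<beta> K = weight l I \<beta> J - \<alpha> p"
  proof (cases rule: seg_cases[OF J p sg, case_names inf fin])
    case inf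
    have "\<langle>weight l I \<beta> J, coroot (\<alpha> p)\<rangle> = maxh J p"
      using weight_coroot[OF J simple_pos_root[OF p]] hL inf by simp
    then show ?thesis
      using segflip_weight[OF J p sg] inf hk unfolding sd
      by (simp add: aff_refl_def reflect_def scaleR_diff_left)
  next
    case (fin m)
    \<comment> \<open>Reflections at the adjacent levels M and M - 1 compose to the translation by
      -\<alpha> p. For a segment ending at infinity the weight pairs to M, and the single reflection
      at level M - 1 has the same effect.\<close>
    have tt: "aff_refl (\<alpha> p) (M - 1) (aff_refl (\<alpha> p) M v) = v - \<alpha> p" for M v
    proof -
      have "aff_refl (\<alpha> p) (M - 1) u = aff_refl (\<alpha> p) M u - \<alpha> p" for u
        by (simp add: aff_refl_def scaleR_diff_left)
      then show ?thesis using root_aff_invol[OF ar] by simp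
    qed
    show ?thesis using segflip_weight[OF J p sg] fin hk hL tt unfolding sd by simp
  qed
qed

lemma root_op_Some:
  assumes "root_op l I \<beta> p J = Some K" "p \<in> {1..r}"
  shows "J \<in> admissible I \<beta>" "maxh J p > 0"
proof -
  show J: "J \<in> admissible I \<beta>" using assms unfolding root_op_def by (auto split: if_splits)
  have "max_level l I \<beta> J p > 0" using assms unfolding root_op_def by (auto split: if_splits)
  then show "maxh J p > 0" using max_level_eq[OF adm_fin[OF J] assms(2)] by simp
qed

lemma root_op_step:
  assumes "root_op l I \<beta> p J = Some K" "p \<in> {1..r}"
  obtains k L N where "first_seg J p k L N" "K = sym_diff J (insert k N)"
proof -
  note a = root_op_Some[OF assms]
  show thesis
    using first_max[OF a(1) assms(2) a(2)] that assms(1) by (metis option.inject)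
qed

text \<open>The index k is recovered from K as its last maximum, and \<open>hyp\<close>, which the
  operator preserves, then determines the whole segment.\<close>

lemma root_op_inj:
  assumes "root_op l I \<beta> p J = Some K" "root_op l I \<beta> p J' = Some K" "p \<in> {1..r}"
  shows "J = J'"
proof -
  obtain k L N where 1: "first_seg J p k L N" "K = sym_diff J (insert k N)"
    using root_op_step[OF assms(1,3)] .
  obtain k' L' N' where 2: "first_seg J' p k' L' N'" "K = sym_diff J' (insert k' N')"
    using root_op_step[OF assms(2,3)] .
  note f1 = segflip_F[OF root_op_Some(1)[OF assms(1,3)] assms(3) 1]
  note f2 = segflip_F[OF root_op_Some(1)[OF assms(2,3)] assms(3) 2]
  have s1: "seg (hyp K (\<alpha> p)) k L N" using 1(1) unfolding first_seg_def f1(3) by blast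
  have s2: "seg (hyp K (\<alpha> p)) k' L' N'" using 2(1) unfolding first_seg_def f2(3) by blast
  have "k \<in> hyp K (\<alpha> p)" "k' \<in> hyp K (\<alpha> p)" using s1 s2 unfolding seg_def by auto
  then have "k = k'" using f1(5,7) f2(5,7) by (metis less_irrefl linorder_neqE)
  moreover have "hyp K (\<alpha> p) \<subseteq> I" unfolding hyp_def by blast
  ultimately have "N = N'" using seg_unique[of "hyp K (\<alpha> p)" k L N L' N'] s1 s2 by simp
  have "J = sym_diff K (insert k N)" unfolding 1(2) by blast
  moreover have "J' = sym_diff K (insert k N)" unfolding \<open>k = k'\<close> \<open>N = N'\<close> 2(2) by blast
  ultimately show ?thesis by simp
qed

text \<open>The inverse operator flips the segment beginning at the last maximum. It remains to see
  that the first maximum of the result is at the end of this segment, so that F_p selects the same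
  one.\<close>

lemma root_op_onto:
  assumes adm: "K \<in> admissible I \<beta>" and p: "p \<in> {1..r}" and d: "height K (\<alpha> p) I < maxh K p"
  shows "\<exists>J. root_op l I \<beta> p J = Some K"
proof -
  let ?P = "hyp K (\<alpha> p)" and ?h = "height K (\<alpha> p)" and ?M = "maxh K p"
  note K = adm_fin[OF adm]
  have a: "\<alpha> p \<in> pos_roots" using simple_pos_root[OF p] .
  have ana: "\<alpha> p \<noteq> - \<alpha> p" using pos_not_neg[OF a] a by metis
  have PI: "?P \<subseteq> I" unfolding hyp_def by blast
  define H where "H = {i \<in> ?P. ?h (below i) = ?M}"
  have finH: "finite H" "H \<noteq> {}" using finite_hyp[OF K] maxh_attained[OF K, of p] d unfolding H_def by auto
  define k where "k = Max H"
  have k: "k \<in> ?P" "?h (below k) = ?M" using Max_in[OF finH] unfolding k_def H_def by auto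
  have after: "?h (below i) < ?M" if "i \<in> ?P" "k < i" for i
  proof -
    have "i \<notin> H" using Max_ge[OF finH(1), of i] that(2) unfolding k_def by auto
    then show ?thesis using maxh_ge(1)[OF K that(1)] that(1) unfolding H_def by simp
  qed
  obtain L N where sg: "seg ?P k L N" using seg_exists[OF finite_hyp[OF K] PI k(1)] by blast
  note kk = seg_k[OF K p sg]
  have hL: "?h L < ?M"
  proof (cases rule: seg_cases[OF K p sg, case_names inf fin])
    case inf
    then show ?thesis using d by simp
  next
    case (fin m)
    then show ?thesis using after by simp
  qed
  have kmax: "\<And>i. i \<in> ?P \<Longrightarrow> i \<in> L \<Longrightarrow> i \<le> k" using sg unfolding seg_def by blast
  have st: "(if k \<in> K then gam \<beta> K k = \<alpha> p else gam \<beta> K k = - \<alpha> p)" "\<not> ascent K p L" "?h L = ?M - 1"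
    using height_step[OF adm p seg_cut[OF sg] k(1) kk(3) kmax] hL k(2) by (auto split: if_splits)
  \<comment> \<open>An unfolded -\<alpha> p would mean a descent before k, hence a downward step
    from the preceding index of \<open>hyp\<close>, whose height would exceed the maximum.\<close>
  have kK: "k \<in> K"
  proof (rule ccontr)
    assume "k \<notin> K"
    then have "gam \<beta> K k = - \<alpha> p" using st by simp
    then have na: "\<not> ascent K p (below k)" using hyp_sign(1)[OF K a k(1)] ana by metis
    then have ne: "?P \<inter> below k \<noteq> {}" using height_start(1)[OF adm p cut_below] by blast
    define j where "j = Max (?P \<inter> below k)"
    have fin: "finite (?P \<inter> below k)" using finite_hyp[OF K] by simp
    have j: "j \<in> ?P" "j \<in> below k" using Max_in[OF fin ne] unfolding j_def by auto
    have "\<And>i. i \<in> ?P \<Longrightarrow> i \<in> below k \<Longrightarrow> i \<le> j" using Max_ge[OF fin] unfolding j_def by auto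
    from height_step[OF adm p cut_below j this] na have "?h (below k) = ?h (below j) - 1" by auto
    then show False using maxh_ge(1)[OF K j(1)] k(2) by simp
  qed
  \<comment> \<open>Folded indices in \<open>hyp\<close> have root \<alpha> p and hence an ascent
    before them, but the segment ends in a descent.\<close>
  have NK: "N \<inter> K = {}"
  proof (cases rule: seg_cases[OF K p sg, case_names inf fin])
    case (fin m)
    have "gam \<beta> K m \<noteq> \<alpha> p" using hyp_sign(1)[OF K a fin(1)] st(2) fin(4) by simp
    then have "m \<notin> K" using adm_in_hyp[OF adm _ fin(1) a] by blast
    then show ?thesis using fin(5) by simp
  qed simp
  define J where "J = sym_diff K (insert k N)"
  note sd = segflip_def[OF K p sg, folded J_def]
  have admJ: "J \<in> admissible I \<beta>" using segflip_adm[OF K p sg adm] kK NK st(2) unfolding sd by blast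
  note J = adm_fin[OF admJ]
  have hyp: "hyp J (\<alpha> p) = ?P" using segflip_hyp[OF K p sg] unfolding sd .
  note Hh = segflip_height[OF K p sg, unfolded sd]
  have hJL: "height J (\<alpha> p) L = ?M + 1" using Hh[OF seg_cut[OF sg]] kk k(2) st(3) by simp
  have hJhigh: "height J (\<alpha> p) L' = ?h L' + 2" if L': "cut L'" "\<not> L' \<subseteq> L" for L'
  proof -
    have "k \<in> L'"
    proof (rule ccontr)
      assume "k \<notin> L'"
      then have "L' \<subseteq> below k" using cut_not_subset[OF K p sg L'(1), of k] kk(2) by blast
      then show False using L'(2) below_subset_cut[OF seg_cut[OF sg] kk(3)] by blast
    qed
    then show ?thesis using Hh[OF L'(1)] L'(2) k(2) st(3) by simp
  qed
  have lowJ: "height J (\<alpha> p) (below i) \<le> ?M" if "i \<in> ?P" "i \<le> k" for i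
  proof -
    have "k \<notin> below i" using that unfolding below_def by auto
    then show ?thesis using Hh[OF cut_below, of i] maxh_ge(1)[OF K that(1)] by simp
  qed
  have highJ: "height J (\<alpha> p) (below i) \<le> ?M + 1" if i: "i \<in> ?P" "k < i" for i
  proof -
    have iI: "i \<in> I" using i PI by blast
    have nL: "i \<notin> L" using kmax[OF i(1)] i(2) by auto
    then obtain m where m: "m \<in> I" "L = below m" "k < m" using iI by (cases rule: seg_cases[OF K p sg, case_names inf fin]) auto
    show ?thesis
    proof (cases "i = m")
      case True
      then show ?thesis using hJL m by simp
    next
      case False
      then have "m < i" using nL m iI unfolding below_def by auto
      then have "\<not> below i \<subseteq> L" using m unfolding below_def by auto
      then show ?thesis using hJhigh[OF cut_below, of i] after[OF i] by simp
    qed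
  qed
  have IJ: "height J (\<alpha> p) I \<le> ?M + 1"
  proof (cases "L = I")
    case True
    then show ?thesis using hJL by simp
  next
    case False
    then show ?thesis using hJhigh[OF cut_I] kk(4) d by auto
  qed
  have mJ: "maxh J p = ?M + 1"
  proof (rule maxh_eqI[OF J])
    show "height J (\<alpha> p) (below i) \<le> ?M + 1" if "i \<in> hyp J (\<alpha> p)" for i
      using that lowJ[of i] highJ[of i] unfolding hyp by fastforce
    show "(\<exists>i\<in>hyp J (\<alpha> p). height J (\<alpha> p) (below i) = ?M + 1) \<or> height J (\<alpha> p) I = ?M + 1"
      using hJL sg unfolding seg_def hyp by auto
  qed (use IJ in auto)
  have "?M \<ge> 0" using maxh_nonneg[OF adm p] .
  then have "maxh J p > 0" using mJ by simp
  then obtain k' L' N' where fs: "first_seg J p k' L' N'"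
    and fop: "root_op l I \<beta> p J = Some (sym_diff J (insert k' N'))" using first_max[OF admJ p] by blast
  have f: "seg ?P k' L' N'" "height J (\<alpha> p) L' = maxh J p"
    "\<And>i. i \<in> ?P \<Longrightarrow> i \<le> k' \<Longrightarrow> height J (\<alpha> p) (below i) < maxh J p"
    using fs unfolding first_seg_def hyp by auto
  \<comment> \<open>If k' were smaller, the maximum M + 1 would occur at an index up to k, where
    heights are at most M; if larger, it would occur before the first maximum, namely at the end of
    \<open>L\<close>.\<close>
  have "k' = k"
  proof (rule ccontr)
    assume "k' \<noteq> k"
    then consider "k' < k" | "k < k'" by fastforce
    then show False
    proof cases
      case 1
      then have "k \<notin> L'" using f(1) k(1) unfolding seg_def by (meson IntI leD)
      then obtain m where m: "m \<in> ?P" "L' = below m" using f(1) kk(2) unfolding seg_def by blast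
      then have "m \<le> k" using \<open>k \<notin> L'\<close> kk(2) unfolding below_def by auto
      then show False using lowJ[OF m(1)] f(2) m(2) mJ by simp
    next
      case 2
      have k': "k' \<in> ?P" using f(1) unfolding seg_def by blast
      then have "k' \<notin> L" using kmax 2 leD by blast
      then obtain m where m: "m \<in> ?P" "L = below m" using sg k' PI unfolding seg_def by blast
      then have "m \<le> k'" using \<open>k' \<notin> L\<close> k' PI unfolding below_def by auto
      then show False using f(3)[OF m(1)] hJL m(2) mJ by simp
    qed
  qed
  then have "N' = N" using seg_unique[OF PI sg, of L' N'] f(1) by simp
  have "sym_diff J (insert k' N') = K" unfolding \<open>k' = k\<close> \<open>N' = N\<close> J_def by blast
  then show ?thesis using fop by metis
qed


subsection \<open>The crystal of admissible subsets\<close>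

lemma rise_at_admissible:
  assumes J: "finite J" "J \<subseteq> I" and p: "p \<in> {1..r}"
  shows "rise_at (weight l I \<beta>) (depth l I \<beta>) J p = of_int (maxh J p)"
    "dp_at (depth l I \<beta>) J p = of_int (height J (\<alpha> p) I - maxh J p)"
proof -
  have fw: "\<langle>\<omega> q, coroot (\<alpha> p)\<rangle> = (if q = p then 1 else 0)" if "q \<in> {1..r}" for q
    using fund_weights[OF that p] unfolding coroot_def .
  have "\<langle>\<Sum>q\<in>{1..r}. max_level l I \<beta> J q *\<^sub>R \<omega> q, coroot (\<alpha> p)\<rangle> =
      (\<Sum>q\<in>{1..r}. if q = p then max_level l I \<beta> J p else 0)"
    unfolding pairing_sum
    by (rule sum.cong) (use fw in \<open>auto simp: pairing_simps simp del: atLeastAtMost_iff\<close>)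
  also have "\<dots> = of_int (maxh J p)" using p max_level_eq[OF J p] by simp
  finally have *: "\<langle>\<Sum>q\<in>{1..r}. max_level l I \<beta> J q *\<^sub>R \<omega> q, coroot (\<alpha> p)\<rangle> = of_int (maxh J p)" .
  show "rise_at (weight l I \<beta>) (depth l I \<beta>) J p = of_int (maxh J p)"
    unfolding rise_at_def depth_def using * by simp
  show "dp_at (depth l I \<beta>) J p = of_int (height J (\<alpha> p) I - maxh J p)"
    unfolding dp_at_def depth_def
    using * weight_coroot[OF J simple_pos_root[OF p]] by (simp only: pairing_simps of_int_diff)
qed

lemma root_op_defined:
  assumes "J \<in> admissible I \<beta>" "p \<in> {1..r}"
  shows "(\<exists>K. root_op l I \<beta> p J = Some K) \<longleftrightarrow> maxh J p > 0"
  using first_max[OF assms] root_op_Some(2)[OF _ assms(2)] by blast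

lemma root_op_depth:
  assumes "root_op l I \<beta> p J = Some K" "p \<in> {1..r}"
  shows "K \<in> admissible I \<beta>" "weight l I \<beta> K = weight l I \<beta> J - \<alpha> p"
    "height K (\<alpha> p) I - maxh K p = height J (\<alpha> p) I - maxh J p - 1" "height K (\<alpha> p) I < maxh K p"
proof -
  note a = root_op_Some[OF assms]
  obtain k L N where f: "first_seg J p k L N" "K = sym_diff J (insert k N)" using root_op_step[OF assms] .
  note s = segflip_F[OF a(1) assms(2) f]
  show "K \<in> admissible I \<beta>" "weight l I \<beta> K = weight l I \<beta> J - \<alpha> p" using s(1,2) .
  show "height K (\<alpha> p) I - maxh K p = height J (\<alpha> p) I - maxh J p - 1" using s(4,6) by simp
  then show "height K (\<alpha> p) I < maxh K p" using maxh_ge(2)[OF adm_fin[OF a(1)], of p] by simp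
qed

lemma crystal_admissible:
  "crystal (admissible I \<beta>) (weight l I \<beta>) (depth l I \<beta>) (root_op l I \<beta>)"
proof -
  let ?wt = "weight l I \<beta>" and ?dp = "depth l I \<beta>" and ?F = "root_op l I \<beta>" and ?A = "admissible I \<beta>"
  have wtI: "?wt J \<in> weights" if "J \<in> ?A" for J
    unfolding weights_def using weight_coroot[OF adm_fin[OF that] simple_pos_root] by auto
  have dpI: "?dp J \<in> weights" if "J \<in> ?A" for J
    unfolding weights_def using rise_at_admissible(2)[OF adm_fin[OF that]] unfolding dp_at_def by auto
  have neg: "- ?dp J \<in> dominant" if J: "J \<in> ?A" for J
  proof (rule dominantI)
    show "- ?dp J \<in> weights" using dpI[OF J] unfolding weights_def by auto
    show "\<langle>- ?dp J, coroot (\<alpha> p)\<rangle> \<ge> 0" if p: "p \<in> {1..r}" for p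
      using rise_at_admissible(2)[OF adm_fin[OF J] p] maxh_ge(2)[OF adm_fin[OF J], of p]
      unfolding dp_at_def by simp
  qed
  have rise: "?wt J - ?dp J \<in> dominant" if J: "J \<in> ?A" for J
  proof (rule dominantI)
    show "?wt J - ?dp J \<in> weights" using weights_diff wtI dpI J by blast
    show "\<langle>?wt J - ?dp J, coroot (\<alpha> p)\<rangle> \<ge> 0" if p: "p \<in> {1..r}" for p
      using rise_at_admissible(1)[OF adm_fin[OF J] p] maxh_nonneg[OF J p] unfolding rise_at_def by simp
  qed
  have riseiff: "rise_at ?wt ?dp J p > 0 \<longleftrightarrow> maxh J p > 0" if "J \<in> ?A" "p \<in> {1..r}" for J p
    using rise_at_admissible(1)[OF adm_fin[OF that(1)] that(2)] by simp
  have dpiff: "dp_at ?dp J p < 0 \<longleftrightarrow> height J (\<alpha> p) I < maxh J p" if "J \<in> ?A" "p \<in> {1..r}" for J p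
    using rise_at_admissible(2)[OF adm_fin[OF that(1)] that(2)] by simp
  have dom: "dom (?F p) = {x \<in> ?A. rise_at ?wt ?dp x p > 0}" if p: "p \<in> {1..r}" for p
    using root_op_Some[OF _ p] root_op_defined[OF _ p] riseiff[OF _ p] by blast
  have bij: "bij_betw (the \<circ> ?F p) {x \<in> ?A. rise_at ?wt ?dp x p > 0} {x \<in> ?A. dp_at ?dp x p < 0}"
    if p: "p \<in> {1..r}" for p
    unfolding dom[OF p, symmetric] bij_betw_def
  proof
    show "inj_on (the \<circ> ?F p) (dom (?F p))"
      by (rule inj_onI) (auto dest: root_op_inj[OF _ _ p])
    show "(the \<circ> ?F p) ` dom (?F p) = {x \<in> ?A. dp_at ?dp x p < 0}"
    proof (intro equalityI subsetI)
      fix K assume "K \<in> (the \<circ> ?F p) ` dom (?F p)"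
      then obtain J where "?F p J = Some K" by auto
      then show "K \<in> {x \<in> ?A. dp_at ?dp x p < 0}" using root_op_depth[OF _ p] dpiff[OF _ p] by blast
    next
      fix K assume "K \<in> {x \<in> ?A. dp_at ?dp x p < 0}"
      then obtain J where "?F p J = Some K" using root_op_onto[OF _ p] dpiff[OF _ p] by blast
      then show "K \<in> (the \<circ> ?F p) ` dom (?F p)" by force
    qed
  qed
  have step: "?wt y = ?wt x - \<alpha> p \<and> dp_at ?dp y p = dp_at ?dp x p - 1" if "?F p x = Some y" "p \<in> {1..r}" for x y p
  proof -
    have x: "x \<in> ?A" using root_op_Some(1)[OF that] .
    note d = root_op_depth[OF that]
    show ?thesis
      using d(2,3) unfolding rise_at_admissible(2)[OF adm_fin[OF x] that(2)] rise_at_admissible(2)[OF adm_fin[OF d(1)] that(2)]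
      by (simp flip: of_int_diff)
  qed
  show ?thesis
    unfolding crystal_def
  proof (intro conjI ballI allI impI)
    show "?wt ` ?A \<subseteq> weights" "?dp ` ?A \<subseteq> weights" using wtI dpI by blast+
    show "- ?dp x \<in> dominant" "?wt x - ?dp x \<in> dominant" if "x \<in> ?A" for x
      using neg rise that by blast+
    show "dom (?F p) = {x \<in> ?A. rise_at ?wt ?dp x p > 0}" if "p \<in> {1..r}" for p using dom[OF that] .
    show "bij_betw (the \<circ> ?F p) {x \<in> ?A. rise_at ?wt ?dp x p > 0} {x \<in> ?A. dp_at ?dp x p < 0}"
      if "p \<in> {1..r}" for p using bij[OF that] .
    show "?wt y = ?wt x - \<alpha> p" "dp_at ?dp y p = dp_at ?dp x p - 1"
      if "p \<in> {1..r}" "?F p x = Some y" for x y p using step[OF that(2,1)] by blast+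
  qed
qed

section \<open>The coherent timing pattern\<close>

definition timing :: "'i set \<Rightarrow> nat \<Rightarrow> 'i" where
  "timing J p = Max {i \<in> hyp J (\<alpha> p). height J (\<alpha> p) (below i) = maxh J p}"

lemma timing:
  assumes "J \<in> admissible I \<beta>" "height J (\<alpha> p) I < maxh J p"
  shows "timing J p \<in> hyp J (\<alpha> p)" "height J (\<alpha> p) (below (timing J p)) = maxh J p"
    "\<And>i. i \<in> hyp J (\<alpha> p) \<Longrightarrow> timing J p < i \<Longrightarrow> height J (\<alpha> p) (below i) < maxh J p"
proof -
  note J = adm_fin[OF assms(1)]
  let ?H = "{i \<in> hyp J (\<alpha> p). height J (\<alpha> p) (below i) = maxh J p}"
  have H: "finite ?H" "?H \<noteq> {}" using finite_hyp[OF J] maxh_attained[OF J, of p] assms(2) by auto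
  show "timing J p \<in> hyp J (\<alpha> p)" "height J (\<alpha> p) (below (timing J p)) = maxh J p"
    using Max_in[OF H] unfolding timing_def by auto
  show "height J (\<alpha> p) (below i) < maxh J p" if "i \<in> hyp J (\<alpha> p)" "timing J p < i" for i
  proof -
    have "i \<notin> ?H" using Max_ge[OF H(1), of i] that(2) unfolding timing_def by auto
    then show ?thesis using maxh_ge(1)[OF J that(1)] that(1) by auto
  qed
qed

lemma timing_eqI:
  assumes "J \<in> admissible I \<beta>" "i \<in> hyp J (\<alpha> p)" "height J (\<alpha> p) (below i) = maxh J p"
    "\<And>j. j \<in> hyp J (\<alpha> p) \<Longrightarrow> i < j \<Longrightarrow> height J (\<alpha> p) (below j) < maxh J p"
  shows "timing J p = i"
  unfolding timing_def
proof (rule Max_eqI)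
  show "j \<le> i" if "j \<in> {i \<in> hyp J (\<alpha> p). height J (\<alpha> p) (below i) = maxh J p}" for j
    using assms(4)[of j] that by (cases "i < j") auto
qed (use finite_hyp[OF adm_fin[OF assms(1)]] assms in auto)

text \<open>\<open>late J q n s\<close> says that \<open>s\<close> is the last index at which the height exceeds the final height
  by at least \<open>n\<close>, and that it exceeds it by exactly \<open>n\<close>. This describes the times of all elements
  above \<open>J\<close> in its \<open>q\<close>-string through \<open>J\<close> alone.\<close>

definition rel :: "'i set \<Rightarrow> nat \<Rightarrow> 'i \<Rightarrow> int" where
  "rel J q i = height J (\<alpha> q) (below i) - height J (\<alpha> q) I"

definition late :: "'i set \<Rightarrow> nat \<Rightarrow> int \<Rightarrow> 'i \<Rightarrow> bool" where
  "late J q n s \<longleftrightarrow> s \<in> hyp J (\<alpha> q) \<and> rel J q s = n \<and> (\<forall>i\<in>hyp J (\<alpha> q). s < i \<longrightarrow> rel J q i < n)"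

lemma late_bound:
  assumes "J \<in> admissible I \<beta>" "late J q n s" shows "n \<le> maxh J q - height J (\<alpha> q) I"
  using assms maxh_ge(1)[OF adm_fin[OF assms(1)]] unfolding late_def rel_def by fastforce

lemma late_top:
  assumes "J \<in> admissible I \<beta>" "height J (\<alpha> q) I < maxh J q"
  shows "late J q (maxh J q - height J (\<alpha> q) I) s \<longleftrightarrow> timing J q = s"
proof
  assume "late J q (maxh J q - height J (\<alpha> q) I) s"
  then show "timing J q = s" unfolding late_def rel_def by (intro timing_eqI[OF assms(1)]) auto
next
  assume "timing J q = s"
  then show "late J q (maxh J q - height J (\<alpha> q) I) s" using timing[OF assms] unfolding late_def rel_def by auto
qed

text \<open>Negative depth means that the maximum is not attained at infinity. Hence the first
  maximum, where the segment ends, is an index not later than the last maximum, which is the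
  time.\<close>

lemma first_seg_finite:
  assumes J: "J \<in> admissible I \<beta>" and p: "p \<in> {1..r}" and f: "first_seg J p k L N"
    and d: "height J (\<alpha> p) I < maxh J p"
  obtains m where "m \<in> hyp J (\<alpha> p)" "m \<in> I" "k < m" "L = below m" "N = {m}" "L \<noteq> I" "m \<le> timing J p"
proof -
  have sg: "seg (hyp J (\<alpha> p)) k L N" and hL: "height J (\<alpha> p) L = maxh J p" using f unfolding first_seg_def by auto
  have LI: "L \<noteq> I" using hL d by auto
  show thesis
  proof (cases rule: seg_cases[OF adm_fin[OF J] p sg])
    case 1
    then show ?thesis using LI by blast
  next
    case (2 m)
    have "\<not> timing J p < m" using timing(3)[OF J d 2(1)] hL 2(4) by auto
    then show ?thesis using that[OF 2(1-5) LI] by simp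
  qed
qed

text \<open>From m on, including infinity, all q-heights drop by 2, so differences from the final
  height stay the same. At m this difference is at least n, so the index sought cannot precede
  m.\<close>

lemma late_step:
  assumes F: "root_op l I \<beta> q y = Some z" "q \<in> {1..r}" and d: "height y (\<alpha> q) I < maxh y q"
    and n: "n \<le> maxh y q - height y (\<alpha> q) I"
  shows "late y q n s \<longleftrightarrow> late z q n s"
proof -
  note a = root_op_Some[OF F]
  obtain k L N where f: "first_seg y q k L N" "z = sym_diff y (insert k N)" using root_op_step[OF F] .
  note S = segflip_F[OF a(1) F(2) f]
  obtain m where m: "m \<in> hyp y (\<alpha> q)" "m \<in> I" "k < m" "L = below m" "N = {m}" "L \<noteq> I"
    using first_seg_finite[OF a(1) F(2) f(1) d] .
  have hL: "height y (\<alpha> q) (below m) = maxh y q" using f(1) m unfolding first_seg_def by simp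
  have eq: "rel z q i = rel y q i" if i: "m \<le> i" for i
  proof (cases "i = m")
    case True
    then show ?thesis using S(6) S(9)[OF m(6)] hL m(4) unfolding rel_def by simp
  next
    case False
    then have "m < i" using i by simp
    then have "\<not> below i \<subseteq> L" using m(2,4) unfolding below_def by auto
    then show ?thesis using S(6) S(8)[OF cut_below] unfolding rel_def by simp
  qed
  have rm: "rel y q m \<ge> n" using hL n unfolding rel_def by simp
  have "m \<le> s" if "late y q n s \<or> late z q n s"
  proof (rule ccontr)
    assume "\<not> m \<le> s"
    then have "s < m" by simp
    then have "rel y q m < n" using that m(1) eq[of m] S(3) unfolding late_def by auto
    then show False using rm by simp
  qed
  moreover have "late y q n s \<longleftrightarrow> late z q n s" if "m \<le> s"
  proof -
    have "rel z q i = rel y q i" if "s \<le> i" for i using eq \<open>m \<le> s\<close> that by simp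
    then show ?thesis unfolding late_def S(3) by auto
  qed
  ultimately show ?thesis by blast
qed

text \<open>Beyond m the products, the folded roots and the membership in the set agree for x and y.
  The heights themselves may change there, but not their differences from the final height.\<close>

lemma late_other:
  assumes F: "root_op l I \<beta> p x = Some y" "p \<in> {1..r}" and d: "height x (\<alpha> p) I < maxh x p"
    and q: "q \<in> {1..r}" "q \<noteq> p" and s: "timing x p \<le> s"
  shows "late x q n s \<longleftrightarrow> late y q n s"
proof -
  note a = root_op_Some[OF F]
  note X = adm_fin[OF a(1)]
  obtain k L N where f: "first_seg x p k L N" "y = sym_diff x (insert k N)" using root_op_step[OF F] .
  note S = segflip_F[OF a(1) F(2) f]
  note Y = adm_fin[OF S(1)]
  obtain m where m: "m \<in> hyp x (\<alpha> p)" "m \<in> I" "k < m" "L = below m" "N = {m}" "L \<noteq> I" "m \<le> timing x p"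
    using first_seg_finite[OF a(1) F(2) f(1) d] .
  have sg: "seg (hyp x (\<alpha> p)) k L N" using f(1) unfolding first_seg_def by blast
  note high = segflip_high[OF X F(2) sg, unfolded segflip_def[OF X F(2) sg, folded f(2)]]
  have ms: "m \<le> s" using m(7) s by simp
  show ?thesis
  proof (cases "s = m")
    case True
    have "\<alpha> p \<noteq> \<alpha> q" using inj_simple F(2) q by (auto dest: inj_onD)
    moreover have "\<alpha> p \<noteq> - \<alpha> q"
      using pos_not_neg[OF simple_pos_root[OF q(1)]] simple_pos_root[OF F(2)] by metis
    ultimately have "m \<notin> hyp J (\<alpha> q)" if "m \<in> hyp J (\<alpha> p)" for J
      using that unfolding hyp_def by auto
    then have "m \<notin> hyp x (\<alpha> q)" "m \<notin> hyp y (\<alpha> q)" using m(1) S(3) by auto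
    then show ?thesis unfolding late_def True by simp
  next
    case False
    have nsub: "\<not> below i \<subseteq> L" if "m < i" for i using that m(2,4) unfolding below_def by auto
    have wi: "wat y (below i) = wat x (below i)" if "m < i" for i using high[OF cut_below nsub[OF that]] .
    have wI: "wat y I = wat x I" using high[OF cut_I] m(2,4) unfolding below_def by blast
    have gam: "gam \<beta> y i = gam \<beta> x i" if "m < i" for i
      unfolding gam_wat[OF X] gam_wat[OF Y] wi[OF that] ..
    have hyp: "i \<in> hyp y (\<alpha> q) \<longleftrightarrow> i \<in> hyp x (\<alpha> q)" if "m < i" for i
      unfolding hyp_def using gam[OF that] by simp
    have mem: "j \<in> y \<longleftrightarrow> j \<in> x" if "m < j" for j using that m(3) unfolding f(2) m(5) by auto
    \<comment> \<open>The difference involves only the contributions from i on and the signs at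
      \<open>below i\<close> and \<open>I\<close>, all of them beyond m.\<close>
    have rel: "rel y q i = rel x q i" if i: "m < i" for i
    proof -
      have I: "I = below i \<union> (I - below i)" unfolding below_def by auto
      have sum: "psum J (\<alpha> q) I = psum J (\<alpha> q) (below i) + psum J (\<alpha> q) (I - below i)"
        if "finite J" "J \<subseteq> I" for J
      proof -
        have "psum J (\<alpha> q) (below i \<union> (I - below i)) = psum J (\<alpha> q) (below i) + psum J (\<alpha> q) (I - below i)"
          by (rule psum_Un[OF that]) (auto simp: below_def)
        then show ?thesis using I by metis
      qed
      have gt: "m < j" if "j \<in> I - below i" for j using that i unfolding below_def by auto
      have "psum y (\<alpha> q) (I - below i) = psum x (\<alpha> q) (I - below i)"
        unfolding psum_def by (rule sum.cong) (use gam gt mem in auto)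
      then show ?thesis
        unfolding rel_def height_def sum[OF X] sum[OF Y] wi[OF i] wI by simp
    qed
    have "m < s" using False ms by simp
    then have "rel y q i = rel x q i" "i \<in> hyp y (\<alpha> q) \<longleftrightarrow> i \<in> hyp x (\<alpha> q)" if "s \<le> i" for i
      using rel[of i] hyp[of i] that by simp_all
    then show ?thesis unfolding late_def by auto
  qed
qed

text \<open>For the element at depth d itself the condition just defines its time
  (\<open>late_top\<close>); \<open>late_step\<close> then carries it unchanged down the string to
  x.\<close>

lemma string_late:
  fixes d :: int
  assumes x: "x \<in> admissible I \<beta>" and q: "q \<in> {1..r}" and d: "d < 0"
  shows "(\<exists>y. string_le (admissible I \<beta>) (root_op l I \<beta>) q x y \<and> dp_at (depth l I \<beta>) y q = of_int d \<and>
     timing y q = s) \<longleftrightarrow> late x q (- d) s"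
proof -
  let ?A = "admissible I \<beta>" and ?wt = "weight l I \<beta>" and ?dp = "depth l I \<beta>" and ?F = "root_op l I \<beta>"
  note cr = crystal_admissible
  define n where "n = nat (- d)"
  have n: "n > 0" "- d = int n" "real_of_int d = - real n" using d unfolding n_def by auto
  let ?at = "\<lambda>n. str_at ?A ?dp ?F q n x" and ?dn = "\<lambda>x. dn ?dp x q" and ?rn = "\<lambda>x. rn ?wt ?dp x q"
  have dn: "int (?dn J) = maxh J q - height J (\<alpha> q) I" if "J \<in> ?A" for J
  proof -
    have "real (?dn J) = of_int (maxh J q - height J (\<alpha> q) I)"
      using dp_at_dn[OF cr that q] rise_at_admissible(2)[OF adm_fin[OF that] q] by simp
    then show ?thesis by linarith
  qed
  have lstr: "late (?at n) q (int n) s \<longleftrightarrow> late (?at (n + j)) q (int n) s" if "n + j \<le> ?rn x + ?dn x" for j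
    using that
  proof (induction j)
    case (Suc j)
    note a = str_at[OF cr x q, of "n + j"]
    have le: "n + j \<le> ?rn x + ?dn x" using Suc.prems by simp
    have F: "?F q (?at (n + j)) = Some (?at (n + Suc j))"
      using F_str_at[OF cr x q, of "n + j"] Suc.prems by simp
    have e: "int (n + j) = maxh (?at (n + j)) q - height (?at (n + j)) (\<alpha> q) I"
      using dn[OF a(1)[OF le]] a(2)[OF le] by simp
    have "late (?at (n + j)) q (int n) s \<longleftrightarrow> late (?at (n + Suc j)) q (int n) s"
      by (rule late_step[OF F q]) (use e n(1) in linarith)+
    then show ?case using Suc by simp
  qed simp
  have "(\<exists>y. string_le ?A ?F q x y \<and> dp_at ?dp y q = of_int d \<and> timing y q = s) \<longleftrightarrow>
      n \<le> ?dn x \<and> timing (?at n) q = s"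
  proof -
    have iff: "string_le ?A ?F q x y \<and> dp_at ?dp y q = of_int d \<longleftrightarrow> n \<le> ?dn x \<and> y = ?at n" for y
      using string_le_iff[OF cr x q n(1), of y] unfolding n(3) .
    show ?thesis unfolding conj_assoc[symmetric] iff by blast
  qed
  also have "\<dots> \<longleftrightarrow> late x q (int n) s"
  proof (cases "n \<le> ?dn x")
    case True
    then have le: "n \<le> ?rn x + ?dn x" by simp
    note a = str_at[OF cr x q le]
    have e: "int n = maxh (?at n) q - height (?at n) (\<alpha> q) I" using dn[OF a(1)] a(2) by simp
    have "late (?at n) q (int n) s \<longleftrightarrow> timing (?at n) q = s"
      unfolding e by (rule late_top[OF a(1)]) (use e n(1) in linarith)
    moreover have "late (?at n) q (int n) s \<longleftrightarrow> late x q (int n) s"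
      using lstr[of "?dn x - n"] True str_at_self[OF cr x q] by simp
    ultimately show ?thesis using True by simp
  next
    case False
    then have "\<not> late x q (int n) s" using late_bound[OF x, of q "int n" s] dn[OF x] by auto
    then show ?thesis using False by simp
  qed
  finally show ?thesis unfolding n(2) .
qed

text \<open>Condition (ii) is \<open>late_other\<close> read through \<open>string_late\<close>;
  condition (i) compares the two ends of the segment.\<close>

lemma coherent_timing_admissible:
  "coherent_timing (admissible I \<beta>) (weight l I \<beta>) (depth l I \<beta>) (root_op l I \<beta>) I
     {(a, b). a \<in> I \<and> b \<in> I \<and> a \<le> b} timing"
  unfolding coherent_timing_def
proof (intro conjI ballI impI allI)
  show "linear_order_on I {(a, b). a \<in> I \<and> b \<in> I \<and> a \<le> b}"
    unfolding order_on_defs refl_on_def trans_def antisym_def total_on_def by auto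
next
  fix x p assume x: "x \<in> admissible I \<beta>" "p \<in> {1..r}" "dp_at (depth l I \<beta>) x p < 0"
  then have "height x (\<alpha> p) I < maxh x p" using rise_at_admissible(2)[OF adm_fin[OF x(1)] x(2)] by simp
  then show "timing x p \<in> I" using timing(1)[OF x(1)] unfolding hyp_def by blast
next
  fix x p assume x: "x \<in> admissible I \<beta>" "p \<in> {1..r}"
    and dr: "dp_at (depth l I \<beta>) x p < 0 \<and> rise_at (weight l I \<beta>) (depth l I \<beta>) x p > 0"
  have d: "height x (\<alpha> p) I < maxh x p" using rise_at_admissible(2)[OF adm_fin[OF x(1)] x(2)] dr by simp
  have "maxh x p > 0" using rise_at_admissible(1)[OF adm_fin[OF x(1)] x(2)] dr by simp
  then obtain y where F: "root_op l I \<beta> p x = Some y" using root_op_defined[OF x] by blast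
  obtain k L N where f: "first_seg x p k L N" "y = sym_diff x (insert k N)" using root_op_step[OF F x(2)] .
  note S = segflip_F[OF x f]
  obtain m where m: "m \<in> hyp x (\<alpha> p)" "m \<in> I" "k < m" "L = below m" "N = {m}" "L \<noteq> I" "m \<le> timing x p"
    using first_seg_finite[OF x f(1) d] .
  have "k \<in> hyp y (\<alpha> p)" using f(1) S(3) unfolding first_seg_def seg_def by simp
  \<comment> \<open>After the step the last maximum is the lower end k of the segment, while before
    it the last maximum was at the upper end m or later.\<close>
  then have "timing y p = k" "k \<in> I" using timing_eqI[OF S(1) _ S(5,7)] unfolding hyp_def by blast+
  then have "timing y p \<le> timing x p" "timing y p \<in> I" using m by auto
  moreover have "timing x p \<in> I" using timing(1)[OF x(1) d] unfolding hyp_def by blast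
  ultimately show "(timing (the (root_op l I \<beta> p x)) p, timing x p) \<in> {(a, b). a \<in> I \<and> b \<in> I \<and> a \<le> b}"
    using F by simp
  fix q d' s assume q: "q \<in> {1..r}" "q \<noteq> p" and d': "d' < (0::int)"
    and s: "s \<in> I" "(timing x p, s) \<in> {(a, b). a \<in> I \<and> b \<in> I \<and> a \<le> b}"
  have "late x q (- d') s \<longleftrightarrow> late y q (- d') s" using late_other[OF F x(2) d q] s by simp
  then show "(\<exists>y. string_le (admissible I \<beta>) (root_op l I \<beta>) q x y \<and> dp_at (depth l I \<beta>) y q = of_int d' \<and> timing y q = s) \<longleftrightarrow>
    (\<exists>y. string_le (admissible I \<beta>) (root_op l I \<beta>) q (the (root_op l I \<beta> p x)) y \<and>
       dp_at (depth l I \<beta>) y q = of_int d' \<and> timing y q = s)"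
    using string_late[OF x(1) q(1) d', of s] string_late[OF S(1) q(1) d', of s] F by simp
qed

subsection \<open>The empty set is the maximum\<close>

lemma empty_admissible: "{} \<in> admissible I \<beta>"
  unfolding admissible_iff by simp

lemma admissible_below:
  assumes "J \<in> admissible I \<beta>" shows "J \<inter> below k \<in> admissible I \<beta>"
proof -
  have "J \<inter> below k \<inter> below j = J \<inter> below j" if "j \<in> below k" for j
    using that unfolding below_def by auto
  then show ?thesis using assms unfolding admissible_iff by auto
qed

lemma admissible_Max:
  assumes "J \<in> admissible I \<beta>" "J \<noteq> {}"
  shows "Max J \<in> J" "J = insert (Max J) (J \<inter> below (Max J))"
proof -
  note J = adm_fin[OF assms(1)]
  show "Max J \<in> J" using Max_in J assms(2) by blast
  then show "J = insert (Max J) (J \<inter> below (Max J))"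
    using Max_ge[OF J(1)] J(2) unfolding below_def by fastforce
qed

text \<open>Removing the largest index k adds c times the positive folded root at k to the weight,
  where c is the number of occurrences of \<beta> k not lying before k.\<close>

lemma ht_weight_le: "J \<in> admissible I \<beta> \<Longrightarrow> ht (weight l I \<beta> J) \<le> ht l"
proof (induction "card J" arbitrary: J)
  case 0
  then show ?case using adm_fin[of J] by simp
next
  case (Suc n)
  note J = adm_fin[OF Suc(3)]
  define k where "k = Max J"
  define J0 where "J0 = J \<inter> below k"
  have ne: "J \<noteq> {}" using Suc(2) by auto
  have k: "k \<in> J" "J = insert k J0" unfolding J0_def k_def using admissible_Max[OF Suc(3) ne] by simp_all
  have kI: "k \<in> I" using k J by blast
  have adm0: "J0 \<in> admissible I \<beta>" unfolding J0_def using admissible_below Suc(3) by blast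
  note J0 = adm_fin[OF adm0]
  have lt: "x < k" if "x \<in> J0" for x using that unfolding J0_def below_def by auto
  then have "k \<notin> J0" by blast
  then have "n = card J0" using Suc(2) k(2) J0 by (metis card_insert_disjoint nat.inject)
  then have IH: "ht (weight l I \<beta> J0) \<le> ht l" using Suc(1) adm0 by blast
  define c where "c = \<langle>l, coroot (\<beta> k)\<rangle> - lev0 k"
  have w: "rprod J0 \<in> weyl" using rprod_weyl J0 by blast
  have lin: "linear (rprod J0)" using weyl_linear_isometry(1)[OF w] .
  have "aff_refl (\<beta> k) (lev0 k) l = l - c *\<^sub>R \<beta> k"
    by (simp add: aff_refl_def reflect_def c_def scaleR_diff_left)
  moreover have "weight l I \<beta> (insert k J0) = weight (aff_refl (\<beta> k) (lev0 k) l) I \<beta> J0"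
    using J0(1) lt by (rule weight_insert_above)
  ultimately have "weight l I \<beta> J = weight (l - c *\<^sub>R \<beta> k) I \<beta> J0"
    using k(2) by metis
  also have "\<dots> = weight l I \<beta> J0 - c *\<^sub>R rprod J0 (\<beta> k)"
    using weight_affine[OF J0(1), of l] weight_affine[OF J0(1), of "l - c *\<^sub>R \<beta> k"]
    by (simp add: linear_diff[OF lin] linear_cmul[OF lin])
  finally have "ht (weight l I \<beta> J) = ht (weight l I \<beta> J0) - c * ht (rprod J0 (\<beta> k))"
    by (simp add: linear_diff[OF linear_ht] linear_cmul[OF linear_ht])
  moreover have "rprod J0 (\<beta> k) \<in> pos_roots"
    using adm_gam_pos[OF Suc(3) k(1)] gam_wat[OF J] unfolding J0_def by simp
  then have "ht (rprod J0 (\<beta> k)) \<ge> 1" by (rule pos_root_ht)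
  moreover have "c \<ge> 0"
  proof -
    have "card {j \<in> I. j < k \<and> \<beta> j = \<beta> k} \<le> card {j \<in> I. \<beta> j = \<beta> k}"
      by (rule card_mono[OF finite_beta]) auto
    moreover have "\<langle>l, coroot (\<beta> k)\<rangle> = card {j \<in> I. \<beta> j = \<beta> k}"
      using ncount_I[OF beta_root[OF kI]] beta_pos[OF kI] unfolding ncount_def by simp
    ultimately show ?thesis unfolding c_def lev0_def by simp
  qed
  ultimately have "ht (weight l I \<beta> J) \<le> ht (weight l I \<beta> J0)" by simp
  then show ?case using IH by simp
qed

text \<open>The product over a nonempty admissible set has positive length and thus a left descent
  p. A descent at infinity means that the last step of the p-heights goes down.\<close>

lemma nonempty_depth:
  assumes adm: "J \<in> admissible I \<beta>" "J \<noteq> {}"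
  shows "\<exists>p\<in>{1..r}. height J (\<alpha> p) I < maxh J p"
proof -
  note J = adm_fin[OF adm(1)]
  have JI: "J \<inter> I = J" using J by blast
  define w where "w = rprod J"
  have w: "w \<in> weyl" unfolding w_def using rprod_weyl J by blast
  define k where "k = Max J"
  have k: "k \<in> J" "J = insert k (J \<inter> below k)" unfolding k_def using admissible_Max[OF adm] by simp_all
  have "w = wat J (below k) \<circ> reflect (\<beta> k)" unfolding w_def using k(2) rprod_insert_below[OF J(1), of k] by simp
  then have len: "len w \<noteq> 0" using adm_cover[OF adm(1) k(1)] by simp
  obtain qs where qs: "set qs \<subseteq> {1..r}" "w = word qs" "length qs = len w" using reduced_word[OF w] .
  then obtain p ps where ps: "qs = p # ps" using len by (cases qs) auto
  have p: "p \<in> {1..r}" using qs ps by auto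
  have "reflect (\<alpha> p) \<circ> w = word ps" unfolding qs(2) ps word_simps simple_refl_refl_comp[OF p] ..
  then have less: "len (reflect (\<alpha> p) \<circ> w) < len w" using len_word_le[of ps] qs ps by auto
  have na: "\<not> ascent J p I"
    using len_simple_left(1)[OF w p _ inv_weyl(1)[OF w]] less inv_wat_root[OF J p, of I]
    unfolding JI w_def[symmetric] by fastforce
  let ?P = "hyp J (\<alpha> p)"
  have fin: "finite ?P" using finite_hyp[OF J] .
  have PI: "?P \<subseteq> I" unfolding hyp_def by blast
  have ne: "?P \<noteq> {}" using height_start(1)[OF adm(1) p cut_I] na by blast
  have "height J (\<alpha> p) I = height J (\<alpha> p) (below (Max ?P)) - 1"
    using height_step[OF adm(1) p cut_I Max_in[OF fin ne]] Max_in[OF fin ne] PI Max_ge[OF fin] na by auto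
  then have "height J (\<alpha> p) I < maxh J p" using maxh_ge(1)[OF J Max_in[OF fin ne]] by simp
  then show ?thesis using p by blast
qed

text \<open>Going up a string raises the height of the weight by 1, while
  \<open>ht_weight_le\<close> bounds it; the ascent therefore ends, and by
  \<open>nonempty_depth\<close> only at the empty set.\<close>

lemma le_empty:
  "J \<in> admissible I \<beta> \<Longrightarrow>
    (\<lambda>u v. \<exists>p\<in>{1..r}. string_le (admissible I \<beta>) (root_op l I \<beta>) p u v)\<^sup>*\<^sup>* J {}"
proof (induction "nat \<lfloor>ht l - ht (weight l I \<beta> J)\<rfloor>" arbitrary: J rule: less_induct)
  case less
  show ?case
  proof (cases "J = {}")
    case False
    then obtain p where p: "p \<in> {1..r}" "height J (\<alpha> p) I < maxh J p"
      using nonempty_depth less.prems by blast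
    obtain K where K: "root_op l I \<beta> p K = Some J" using root_op_onto[OF less.prems p] by blast
    have adm: "K \<in> admissible I \<beta>" using root_op_Some(1)[OF K p(1)] .
    have "ht (weight l I \<beta> J) = ht (weight l I \<beta> K) - 1"
      using root_op_depth(2)[OF K p(1)] ht_simple[OF p(1)] by (simp add: linear_diff[OF linear_ht])
    then have "nat \<lfloor>ht l - ht (weight l I \<beta> K)\<rfloor> < nat \<lfloor>ht l - ht (weight l I \<beta> J)\<rfloor>"
      using ht_weight_le[OF adm] by linarith
    then have IH: "(\<lambda>u v. \<exists>p\<in>{1..r}. string_le (admissible I \<beta>) (root_op l I \<beta>) p u v)\<^sup>*\<^sup>* K {}"
      using less.hyps adm by blast
    have "((\<lambda>z. Option.bind z (root_op l I \<beta> p)) ^^ 1) (Some K) = Some J" using K by (simp add: One_nat_def)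
    then have "string_le (admissible I \<beta>) (root_op l I \<beta>) p J K"
      unfolding string_le_def using less.prems adm by blast
    then show ?thesis using IH p(1) by (intro converse_rtranclp_into_rtranclp[OF _ IH]) blast
  qed simp
qed

lemma semiperfect_admissible:
  "semiperfect (admissible I \<beta>) (weight l I \<beta>) (depth l I \<beta>) (root_op l I \<beta>)"
  using crystal_admissible coherent_timing_admissible
  by (rule semiperfect_if_coherent_timing) (use le_empty empty_admissible in blast)

lemma admissible_character:
  "formal_summable (admissible I \<beta>) (weight l I \<beta>)"
  "weyl_char l = formal_sum (admissible I \<beta>) (\<lambda>_. 1) (weight l I \<beta>)"
  using semiperfect_character[OF semiperfect_admissible empty_admissible] ht_weight_le by simp_all

end

theorem theorem8p2:
  fixes pairing :: "'v::real_vector \<Rightarrow> 'v \<Rightarrow> real"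
    and r :: nat
    and \<alpha> \<omega> :: "nat \<Rightarrow> 'v"
    and \<rho> l :: 'v
    and ht :: "'v \<Rightarrow> real"
    and I :: "'i::linorder set"
    and \<beta> :: "'i \<Rightarrow> 'v"
  assumes "kac_moody_roots pairing r \<alpha> \<omega> \<rho> ht"
    and "l \<in> kac_moody_roots.dominant pairing r \<alpha>"
    and "kac_moody_roots.lambda_chain pairing r \<alpha> l I \<beta>"
  shows "kac_moody_roots.semiperfect pairing r \<alpha>
           (kac_moody_roots.admissible pairing r \<alpha> I \<beta>)
           (kac_moody_roots.weight pairing l I \<beta>)
           (kac_moody_roots.depth pairing r \<alpha> \<omega> \<rho> l I \<beta>)
           (kac_moody_roots.root_op pairing r \<alpha> \<rho> l I \<beta>)
       \<and> kac_moody_roots.formal_summable pairing r \<alpha> ht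
           (kac_moody_roots.admissible pairing r \<alpha> I \<beta>)
           (kac_moody_roots.weight pairing l I \<beta>)
       \<and> kac_moody_roots.weyl_char pairing r \<alpha> \<rho> ht l =
           kac_moody_roots.formal_sum
             (kac_moody_roots.admissible pairing r \<alpha> I \<beta>)
             (\<lambda>_. 1)
             (kac_moody_roots.weight pairing l I \<beta>)"
proof -
  interpret kac_moody_roots pairing r \<alpha> \<omega> \<rho> ht by fact
  interpret root_chain pairing r \<alpha> \<omega> \<rho> ht l I \<beta> by unfold_locales (fact assms)
  show ?thesis using semiperfect_admissible admissible_character by blast
qed

end
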